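(* There is a deterministic algorithm that computes a $(1+\varepsilon)$-approximate $(\min,+)$-convolution (and likewise $(\max,+)$-convolution) of two sequences of length $n$ of positive integers bounded by $W$ in $\mathcal{O}\big(\frac{n}{\varepsilon}\log(\frac{n}{\varepsilon})\log W\big)$ time.
   Context: For sequences $(A[i])_{i=0}^{n-1},(B[i])_{i=0}^{n-1}$ of positive integers at most $W$, the $(\min,+)$-convolution is $\mathrm{OPT}[k]=\min_{0\le i\le k}(A[i]+B[k-i])$, and the $(\max,+)$-convolution uses $\max$ instead. Given $0<\varepsilon<1$, a $(1+\varepsilon)$-approximation is a sequence $(C[k])_{k=0}^{n-1}$ with $\mathrm{OPT}[k]\le C[k]\le(1+\varepsilon)\mathrm{OPT}[k]$ for every $k$. *)

theory Defs
  imports Complex_Main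
begin

text \<open>
  Model of computation: the word RAM with word size \<open>w\<close>.  Registers and memory cells hold words,
  i.e. naturals below \<open>2 ^ w\<close>; memory is addressed by words; every arithmetic operation, comparison,
  register access and memory access costs one unit of time.  Arithmetic wraps around modulo
  \<open>2 ^ w\<close>, so long integers cannot be packed into a single cell.  Programs use structured control
  flow instead of jumps, which does not affect running times beyond constant factors, and do not
  depend on \<open>w\<close>.  The language has no source of randomness; see \<open>exec_deterministic\<close>.
\<close>

datatype binop = Add | Sub | Mul | Div | Mod | Less | Equal

datatype wexp =
    Const nat
  | Reg nat
  | Load wexp
  | Bin binop wexp wexp

datatype wcom =
    Skip
  | Assign nat wexp
  | Store wexp wexp
  | Seq wcom wcom
  | Cond wexp wcom wcom
  | While wexp wcom

text \<open>Register contents and memory contents.\<close>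

type_synonym state = "(nat \<Rightarrow> nat) \<times> (nat \<Rightarrow> nat)"

text \<open>Division by zero follows the HOL convention (\<open>a div 0 = 0\<close>, \<open>a mod 0 = a\<close>).\<close>

fun binop_val :: "nat \<Rightarrow> binop \<Rightarrow> nat \<Rightarrow> nat \<Rightarrow> nat" where
  "binop_val w Add a b = (a + b) mod 2 ^ w"
| "binop_val w Sub a b = nat ((int a - int b) mod 2 ^ w)"
| "binop_val w Mul a b = (a * b) mod 2 ^ w"
| "binop_val w Div a b = a div b"
| "binop_val w Mod a b = a mod b"
| "binop_val w Less a b = of_bool (a < b)"
| "binop_val w Equal a b = of_bool (a = b)"

fun wexp_val :: "nat \<Rightarrow> wexp \<Rightarrow> state \<Rightarrow> nat" where
  "wexp_val w (Const k) s = k mod 2 ^ w"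
| "wexp_val w (Reg x) s = fst s x"
| "wexp_val w (Load e) s = snd s (wexp_val w e s)"
| "wexp_val w (Bin f e1 e2) s = binop_val w f (wexp_val w e1 s) (wexp_val w e2 s)"

fun wexp_cost :: "wexp \<Rightarrow> nat" where
  "wexp_cost (Const k) = 1"
| "wexp_cost (Reg x) = 1"
| "wexp_cost (Load e) = 1 + wexp_cost e"
| "wexp_cost (Bin f e1 e2) = 1 + wexp_cost e1 + wexp_cost e2"

text \<open>
  \<open>exec w c s t s'\<close>: with word size \<open>w\<close>, program \<open>c\<close> started in state \<open>s\<close> terminates in state
  \<open>s'\<close> after exactly \<open>t\<close> units of time.
\<close>

inductive exec :: "nat \<Rightarrow> wcom \<Rightarrow> state \<Rightarrow> nat \<Rightarrow> state \<Rightarrow> bool" for w :: nat where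
  exec_Skip: "exec w Skip s 1 s"
| exec_Assign:
    "exec w (Assign x e) s (1 + wexp_cost e) ((fst s)(x := wexp_val w e s), snd s)"
| exec_Store:
    "exec w (Store e1 e2) s (1 + wexp_cost e1 + wexp_cost e2)
       (fst s, (snd s)(wexp_val w e1 s := wexp_val w e2 s))"
| exec_Seq:
    "exec w c1 s t1 s' \<Longrightarrow> exec w c2 s' t2 s'' \<Longrightarrow> exec w (Seq c1 c2) s (t1 + t2) s''"
| exec_CondTrue:
    "wexp_val w e s \<noteq> 0 \<Longrightarrow> exec w c1 s t s' \<Longrightarrow> exec w (Cond e c1 c2) s (1 + wexp_cost e + t) s'"
| exec_CondFalse:
    "wexp_val w e s = 0 \<Longrightarrow> exec w c2 s t s' \<Longrightarrow> exec w (Cond e c1 c2) s (1 + wexp_cost e + t) s'"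
| exec_WhileFalse:
    "wexp_val w e s = 0 \<Longrightarrow> exec w (While e c) s (1 + wexp_cost e) s"
| exec_WhileTrue:
    "wexp_val w e s \<noteq> 0 \<Longrightarrow> exec w c s t1 s' \<Longrightarrow> exec w (While e c) s' t2 s'' \<Longrightarrow>
     exec w (While e c) s (1 + wexp_cost e + t1 + t2) s''"

inductive_cases exec_SkipE: "exec w Skip s t s'"
inductive_cases exec_AssignE: "exec w (Assign x e) s t s'"
inductive_cases exec_StoreE: "exec w (Store e1 e2) s t s'"
inductive_cases exec_SeqE: "exec w (Seq c1 c2) s t s'"
inductive_cases exec_CondE: "exec w (Cond e c1 c2) s t s'"
inductive_cases exec_WhileE: "exec w (While e c) s t s'"

lemma exec_deterministic:
  "exec w c s t s' \<Longrightarrow> exec w c s u s'' \<Longrightarrow> t = u \<and> s' = s''"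
proof (induction arbitrary: u s'' rule: exec.induct)
  case (exec_Skip s)
  then show ?case by (rule exec_SkipE) simp
next
  case (exec_Assign x e s)
  then show ?case by (rule exec_AssignE) simp
next
  case (exec_Store e1 e2 s)
  then show ?case by (rule exec_StoreE) simp
next
  case (exec_Seq c1 s t1 s' c2 t2 s3)
  from exec_Seq.prems show ?case
  proof (rule exec_SeqE)
    fix u1 r u2
    assume u: "u = u1 + u2" and 1: "exec w c1 s u1 r" and 2: "exec w c2 r u2 s''"
    from exec_Seq.IH(1)[OF 1] have r: "t1 = u1" "r = s'" by simp_all
    from exec_Seq.IH(2)[OF 2[unfolded r(2)]] u r(1) show ?thesis by simp
  qed
next
  case (exec_CondTrue e s c1 t s' c2)
  from exec_CondTrue.prems show ?case
  proof (rule exec_CondE)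
    fix v assume "u = Suc (wexp_cost e + v)" "exec w c1 s v s''"
    with exec_CondTrue.IH[of v s''] show ?thesis by simp
  next
    assume "wexp_val w e s = 0"
    with exec_CondTrue.hyps(1) show ?thesis by simp
  qed
next
  case (exec_CondFalse e s c2 t s' c1)
  from exec_CondFalse.prems show ?case
  proof (rule exec_CondE)
    assume "0 < wexp_val w e s"
    with exec_CondFalse.hyps(1) show ?thesis by simp
  next
    fix v assume "u = Suc (wexp_cost e + v)" "exec w c2 s v s''"
    with exec_CondFalse.IH[of v s''] show ?thesis by simp
  qed
next
  case (exec_WhileFalse e s c)
  from exec_WhileFalse.prems show ?case
  proof (rule exec_WhileE)
    assume "u = Suc (wexp_cost e)" "s'' = s"
    then show ?thesis by simp
  next
    assume "0 < wexp_val w e s"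
    with exec_WhileFalse.hyps show ?thesis by simp
  qed
next
  case (exec_WhileTrue e s c t1 s' t2 s3)
  from exec_WhileTrue.prems show ?case
  proof (rule exec_WhileE)
    assume "wexp_val w e s = 0"
    with exec_WhileTrue.hyps(1) show ?thesis by simp
  next
    fix u1 r u2
    assume u: "u = Suc (wexp_cost e + u1 + u2)"
      and 1: "exec w c s u1 r" and 2: "exec w (While e c) r u2 s''"
    from exec_WhileTrue.IH(1)[OF 1] have r: "t1 = u1" "r = s'" by simp_all
    from exec_WhileTrue.IH(2)[OF 2[unfolded r(2)]] u r(1) show ?thesis by simp
  qed
qed

text \<open>
  A sequence of length \<open>n\<close> is a function on \<open>nat\<close> of which only the values below \<open>n\<close> matter:
  for \<open>k < n\<close> the convolutions at \<open>k\<close> only look at indices up to \<open>k\<close>.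
\<close>

definition min_plus_conv :: "(nat \<Rightarrow> nat) \<Rightarrow> (nat \<Rightarrow> nat) \<Rightarrow> nat \<Rightarrow> nat" where
  "min_plus_conv A B k = Min ((\<lambda>i. A i + B (k - i)) ` {0..k})"

definition max_plus_conv :: "(nat \<Rightarrow> nat) \<Rightarrow> (nat \<Rightarrow> nat) \<Rightarrow> nat \<Rightarrow> nat" where
  "max_plus_conv A B k = Max ((\<lambda>i. A i + B (k - i)) ` {0..k})"

definition is_approximation :: "real \<Rightarrow> nat \<Rightarrow> (nat \<Rightarrow> nat) \<Rightarrow> (nat \<Rightarrow> real) \<Rightarrow> bool" where
  "is_approximation \<epsilon> n opt C \<longleftrightarrow>
     (\<forall>k<n. real (opt k) \<le> C k \<and> C k \<le> (1 + \<epsilon>) * real (opt k))"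

definition bounded_positive_seq :: "nat \<Rightarrow> nat \<Rightarrow> (nat \<Rightarrow> nat) \<Rightarrow> bool" where
  "bounded_positive_seq n W A \<longleftrightarrow> (\<forall>i<n. 1 \<le> A i \<and> A i \<le> W)"

text \<open>
  The accuracy is handed to the machine as a fraction \<open>p / q\<close> of two words.  A rational \<open>\<epsilon>\<close> may be
  given exactly; to cover real \<open>\<epsilon>\<close>, any lower approximation up to a factor of two is admitted.
\<close>

definition encodes_accuracy :: "nat \<Rightarrow> nat \<Rightarrow> real \<Rightarrow> bool" where
  "encodes_accuracy p q \<epsilon> \<longleftrightarrow>
     0 < p \<and> 0 < q \<and> real p / real q \<le> \<epsilon> \<and> \<epsilon> \<le> 2 * (real p / real q)"

text \<open>
  Input: \<open>n\<close>, \<open>p\<close>, \<open>q\<close> in registers 0, 1, 2; the sequences \<open>A\<close> and \<open>B\<close> consecutively in memory from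
  address 0; zero elsewhere.  The bound \<open>W\<close> is not part of the input.
\<close>

definition input_state :: "nat \<Rightarrow> nat \<Rightarrow> nat \<Rightarrow> (nat \<Rightarrow> nat) \<Rightarrow> (nat \<Rightarrow> nat) \<Rightarrow> state" where
  "input_state n p q A B =
     ((\<lambda>_. 0)(0 := n, 1 := p, 2 := q),
      (\<lambda>a. if a < n then A a else if a < 2 * n then B (a - n) else 0))"

text \<open>
  There is one program, with one constant \<open>K\<close> for the running time and one constant \<open>c\<close> for the
  word size, which for all inputs and all words of at least \<open>c * log 2 (n + W + q)\<close> bits
  (in particular \<open>c\<close> can be chosen such that the input fits into words) leaves a
  \<open>(1 + \<epsilon>)\<close>-approximation of the convolution in memory cells \<open>0, \<dots>, n - 1\<close> within time
  \<open>K * T n W \<epsilon>\<close>.  As this is demanded of all \<open>n\<close>, \<open>W\<close> and \<open>\<epsilon>\<close>, logarithms in \<open>T\<close> have to be kept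
  away from zero, which is done by \<open>log 2 (max 2 x)\<close>.
\<close>

definition approx_conv_computable_in_time ::
  "((nat \<Rightarrow> nat) \<Rightarrow> (nat \<Rightarrow> nat) \<Rightarrow> nat \<Rightarrow> nat) \<Rightarrow> (nat \<Rightarrow> nat \<Rightarrow> real \<Rightarrow> real) \<Rightarrow> bool" where
  "approx_conv_computable_in_time conv T \<longleftrightarrow>
     (\<exists>(prog :: wcom) (c :: real) (K :: real).
        \<forall>(n :: nat) (W :: nat) (A :: nat \<Rightarrow> nat) (B :: nat \<Rightarrow> nat) (\<epsilon> :: real)
          (p :: nat) (q :: nat) (w :: nat).
          1 \<le> n \<longrightarrow> 0 < \<epsilon> \<longrightarrow> \<epsilon> < 1 \<longrightarrow>
          bounded_positive_seq n W A \<longrightarrow> bounded_positive_seq n W B \<longrightarrow>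
          encodes_accuracy p q \<epsilon> \<longrightarrow>
          c * log 2 (real (n + W + q)) \<le> real w \<longrightarrow>
          (\<exists>t s. exec w prog (input_state n p q A B) t s \<and>
                 real t \<le> K * T n W \<epsilon> \<and>
                 is_approximation \<epsilon> n (conv A B) (\<lambda>k. real (snd s k))))"

end

theory Submission
  imports Defs "HOL-Library.Discrete_Functions"
begin

text \<open>
  Scaling: for every power of two \<open>s\<close> up to the largest entry, round the entries up to multiples of
  \<open>s\<close>, discard those above \<open>s * L\<close> for some \<open>L\<close> of order \<open>1 / \<epsilon>\<close>, and compute all sums
  \<open>d\<close> of rounded entries exactly.  A candidate \<open>s * d\<close> is accepted if \<open>s = 1\<close> or \<open>2 * d > L\<close>.  Then
  every accepted candidate is a \<open>(1 + \<epsilon>)\<close>-approximation of the pair of entries it stems from, and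
  every pair yields an accepted candidate at the least scale \<open>s\<close> with \<open>s * L\<close> at least its sum; hence
  both the minimum and the maximum of the accepted candidates are as required.

  The sums at one scale form the sumset of two sets of numbers of size \<open>O(n / \<epsilon>)\<close>, an entry \<open>v\<close> at
  index \<open>i\<close> being represented by \<open>i * (2 * L + 1) + v\<close>.  The two indicator functions are the real and
  imaginary part of a single vector \<open>x\<close>; transforming, squaring and transforming again yields the
  self-convolution of \<open>x\<close> in reverse order, whose imaginary part counts representations twice.
  Complex numbers are rounded to multiples of \<open>N powi (-8)\<close>, where \<open>N\<close> is the length of the transform:
  all errors grow by factors polynomial in \<open>N\<close>, so that words of \<open>O(log N)\<close> bits suffice to tell zero
  counts from positive ones.  The primitive root of unity comes from the half-angle formula with
  integer square roots, which avoids any search for primes in arithmetic progressions.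
\<close>

section \<open>The discrete Fourier transform\<close>

text \<open>The exponents in the proof come from an error budget, counted in units of the last
  place, with \<open>N\<close> the transform length and \<open>F\<close> the fixed-point unit. The
  root of unity is off by \<open>O(N)\<close>, which is the loss of extracting a small sine as a
  square root; its powers, obtained by repeated multiplication, are off by \<open>O(N ^ 2)\<close>.
  A transform multiplies the error of its input, together with the twiddle error weighted by the
  size of the input, by at most \<open>3 ^ m \<le> N ^ 2\<close>. Transforming 0-1 data thus costs
  \<open>O(N ^ 4)\<close>, squaring raises this to at most \<open>N ^ 6\<close>, and the other
  transform to \<open>2 * N ^ 8\<close>. Once \<open>F\<close> is large enough these bounds do not
  depend on it, whereas a single representation contributes \<open>2 * N * F\<close> to the
  imaginary part. So \<open>F = N ^ 8\<close> is the least power of \<open>N\<close> at which the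
  bounds separate zero from positive counts. All dividends then stay below \<open>N ^ 20\<close>,
  which explains words of \<open>22 * m\<close> bits for \<open>N = 2 ^ m\<close>.\<close>

definition zeta :: "nat \<Rightarrow> complex" where
  "zeta t = cis (2 * pi / 2 ^ t)"

lemma zeta_sq: "zeta (Suc t) ^ 2 = zeta t"
  by (simp add: zeta_def Complex.DeMoivre)

lemma zeta_pow2: "zeta (t + j) ^ (2 ^ j) = zeta t"
proof (induction j)
  case (Suc j)
  have "zeta (t + Suc j) ^ (2 ^ Suc j) = (zeta (Suc (t + j)) ^ 2) ^ (2 ^ j)"
    by (simp add: power_mult [symmetric])
  then show ?case using Suc by (simp add: zeta_sq)
qed simp

lemma zeta_order: "zeta t ^ (2 ^ t) = 1"
  using zeta_pow2 [of 0 t] by (simp add: zeta_def)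

lemma norm_zeta [simp]: "cmod (zeta t) = 1"
  by (simp add: zeta_def)

text \<open>A transform of length \<open>2 ^ t\<close> is periodic in its output index, and
  \<open>src\<close> accordingly reduces that index; this removes the reduction again from the
  exponents in \<open>fft_stage\<close>.\<close>

lemma zeta_mod: "zeta t ^ (v * (k mod 2 ^ t)) = zeta t ^ (v * k)"
proof -
  have "zeta t ^ k = zeta t ^ (k mod 2 ^ t + 2 ^ t * (k div 2 ^ t))" by simp
  also have "\<dots> = zeta t ^ (k mod 2 ^ t)"
    by (simp only: power_add power_mult zeta_order) simp
  finally have "(zeta t ^ k) ^ v = (zeta t ^ (k mod 2 ^ t)) ^ v" by simp
  then show ?thesis by (simp add: power_mult [symmetric] mult.commute)
qed

lemma zeta_pow_eq_1_iff: "zeta t ^ k = 1 \<longleftrightarrow> 2 ^ t dvd k"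
proof
  assume "zeta t ^ k = 1"
  then have "cis (real k * (2 * pi / 2 ^ t)) = 1"
    by (simp add: zeta_def Complex.DeMoivre)
  then have "cos (real k * (2 * pi / 2 ^ t)) = 1"
    by (metis cis.sel(1) one_complex.sel(1))
  then obtain i :: int where i: "real k * (2 * pi / 2 ^ t) = of_int i * 2 * pi"
    using cos_one_2pi_int by auto
  then have "real k * (2 * pi) = of_int i * 2 ^ t * (2 * pi)" by (simp add: field_simps)
  then have "real k = of_int i * 2 ^ t" by simp
  then have "int k = i * 2 ^ t"
    by (metis of_int_eq_iff of_int_mult of_int_numeral of_int_of_nat_eq of_int_power)
  then have "(2::int) ^ t dvd int k" by simp
  then show "2 ^ t dvd k" by (metis int_dvd_int_iff of_nat_numeral of_nat_power)
next
  assume "2 ^ t dvd k"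
  then show "zeta t ^ k = 1" by (auto simp: dvd_def power_mult zeta_order)
qed

lemma sum_zeta: "(\<Sum>k<2 ^ t. zeta t ^ (k * r)) = (if 2 ^ t dvd r then 2 ^ t else 0)"
proof -
  have "(\<Sum>k<2 ^ t. zeta t ^ (k * r)) = (\<Sum>k<2 ^ t. (zeta t ^ r) ^ k)"
    by (simp add: power_mult [symmetric] mult.commute)
  also have "\<dots> = (if 2 ^ t dvd r then 2 ^ t else 0)"
  proof (cases "2 ^ t dvd r")
    case True
    then have "zeta t ^ r = 1" by (simp add: zeta_pow_eq_1_iff)
    then show ?thesis using True by simp
  next
    case False
    then have "zeta t ^ r \<noteq> 1" by (simp add: zeta_pow_eq_1_iff)
    then have "(\<Sum>k<2 ^ t. (zeta t ^ r) ^ k) = ((zeta t ^ r) ^ 2 ^ t - 1) / (zeta t ^ r - 1)"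
      by (rule geometric_sum)
    also have "(zeta t ^ r) ^ 2 ^ t = (zeta t ^ 2 ^ t) ^ r"
      by (simp add: power_mult [symmetric] mult.commute)
    finally show ?thesis using False by (simp add: zeta_order)
  qed
  finally show ?thesis .
qed

text \<open>
  After \<open>t\<close> stages, position \<open>k * 2 ^ (m - t) + j\<close> holds the \<open>k\<close>-th coefficient of the transform of
  length \<open>2 ^ t\<close> of the subsequence of entries at positions congruent to \<open>j\<close> modulo \<open>2 ^ (m - t)\<close>.
  With this layout input and output are in natural order.
\<close>

definition src :: "nat \<Rightarrow> nat \<Rightarrow> nat \<Rightarrow> nat" where
  "src N S i = 2 * (i - i mod S) mod N + i mod S"

text \<open>Both outputs of a butterfly use the same formula: the exponent
  \<open>i - i mod S\<close> runs through a full turn, and its second half supplies the usual minus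
  sign.\<close>

primrec fft :: "nat \<Rightarrow> (nat \<Rightarrow> complex) \<Rightarrow> nat \<Rightarrow> nat \<Rightarrow> complex" where
  "fft m x 0 = x"
| "fft m x (Suc t) = (\<lambda>i. let S = 2 ^ (m - Suc t); a = src (2 ^ m) S i in
     fft m x t a + zeta m ^ (i - i mod S) * fft m x t (a + S))"

text \<open>With \<open>i = k * S + j\<close>, doubling the start \<open>k * S\<close> of the block
  and reducing modulo \<open>2 ^ m\<close> drops the top bit of \<open>k\<close>. What remains is an
  even multiple of \<open>S\<close> plus \<open>j\<close>, so one more \<open>S\<close> stays below
  \<open>2 ^ m\<close>.\<close>

lemma src_less:
  assumes "t < m" "i < 2 ^ m"
  shows "src (2 ^ m) (2 ^ (m - Suc t)) i + 2 ^ (m - Suc t) < 2 ^ m"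
    "src (2 ^ m) (2 ^ (m - Suc t)) i = i div 2 ^ (m - Suc t) mod 2 ^ t * 2 ^ (m - t) +
       i mod 2 ^ (m - Suc t)"
proof -
  define S :: nat where "S = 2 ^ (m - Suc t)"
  define k where "k = i div S"
  have S: "2 ^ (m - t) = 2 * S" "2 ^ m = 2 ^ t * (2 * S)" and "S > 0"
    using assms by (auto simp: S_def power_add [symmetric] power_Suc [symmetric]
        simp del: power_Suc intro!: arg_cong [where f = "power 2"])
  have "i - i mod S = k * S" unfolding k_def by (simp add: minus_mod_eq_div_mult)
  then have "2 * (i - i mod S) mod 2 ^ m = (k * (2 * S)) mod (2 ^ t * (2 * S))"
    by (simp add: S mult_ac)
  also have "\<dots> = k mod 2 ^ t * (2 * S)" by (simp add: mod_mult_mult2)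
  finally have e: "src (2 ^ m) S i = k mod 2 ^ t * (2 * S) + i mod S" by (simp add: src_def)
  then show "src (2 ^ m) (2 ^ (m - Suc t)) i = i div 2 ^ (m - Suc t) mod 2 ^ t * 2 ^ (m - t) +
       i mod 2 ^ (m - Suc t)" by (simp add: S k_def S_def)
  have "i mod S < S" using \<open>S > 0\<close> by simp
  moreover have "(k mod 2 ^ t + 1) * (2 * S) \<le> 2 ^ t * (2 * S)"
    by (intro mult_right_mono) (simp_all add: Suc_leI)
  ultimately show "src (2 ^ m) (2 ^ (m - Suc t)) i + 2 ^ (m - Suc t) < 2 ^ m"
    unfolding S_def [symmetric] e unfolding S(2) by (simp add: algebra_simps)
qed

lemma sum_even_plus_odd:
  fixes f :: "nat \<Rightarrow> 'a :: comm_monoid_add"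
  shows "(\<Sum>v<n. f (2 * v)) + (\<Sum>v<n. f (2 * v + 1)) = (\<Sum>u<2 * n. f u)"
  by (induction n) (simp_all add: ac_simps)

text \<open>Decimation in time: even \<open>u\<close> form the subsequence at residue
  \<open>j\<close> modulo \<open>2 * S\<close>, odd \<open>u\<close> the one at
  \<open>j + S\<close>, and \<open>zeta t = zeta (Suc t) ^ 2\<close> turns their exponents into
  those of the longer transform.\<close>

lemma fft_stage:
  assumes "t \<le> m" "k < 2 ^ t" "j < 2 ^ (m - t)"
  shows "fft m x t (k * 2 ^ (m - t) + j) =
    (\<Sum>u<2 ^ t. x (j + u * 2 ^ (m - t)) * zeta t ^ (u * k))"
  using assms
proof (induction t arbitrary: k j)
  case 0
  then show ?case by simp
next
  case (Suc t)
  define S :: nat where "S = 2 ^ (m - Suc t)"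
  have t: "t < m" using Suc.prems by simp
  have j: "j < S" using Suc.prems by (simp add: S_def)
  have S: "2 ^ (m - t) = 2 * S" "2 ^ m = 2 ^ Suc t * S"
    using t by (auto simp: S_def power_add [symmetric] power_Suc [symmetric]
        simp del: power_Suc intro!: arg_cong [where f = "power 2"])
  define i where "i = k * S + j"
  have i: "i mod S = j" "i div S = k" "i - i mod S = k * S" using j by (simp_all add: i_def)
  have "(k + 1) * S \<le> 2 ^ Suc t * S" using Suc.prems by (intro mult_right_mono) auto
  then have "i < 2 ^ m" using j S by (simp add: i_def algebra_simps)
  define a where "a = src (2 ^ m) S i"
  have a: "a = k mod 2 ^ t * 2 ^ (m - t) + j"
    using src_less(2) [OF t \<open>i < 2 ^ m\<close>] i by (simp add: a_def S_def)
  have Y0: "fft m x t a = (\<Sum>u<2 ^ t. x (j + u * 2 ^ (m - t)) * zeta t ^ (u * (k mod 2 ^ t)))"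
    unfolding a using j t S by (intro Suc.IH) auto
  have Y1: "fft m x t (a + S) = (\<Sum>u<2 ^ t. x (j + S + u * 2 ^ (m - t)) * zeta t ^ (u * (k mod 2 ^ t)))"
    unfolding a add.assoc [of _ j] using j t S by (intro Suc.IH) auto
  have "zeta m ^ (k * S) = (zeta m ^ S) ^ k" by (simp add: power_mult [symmetric] mult.commute)
  also have "zeta m ^ S = zeta (Suc t)"
    using zeta_pow2 [of "Suc t" "m - Suc t"] t by (simp add: S_def)
  finally have tw: "zeta m ^ (k * S) = zeta (Suc t) ^ k" .
  have dbl: "zeta t ^ (v * k) = zeta (Suc t) ^ (2 * v * k)" for v
    unfolding mult.assoc power_mult [of _ 2] zeta_sq ..
  have "fft m x (Suc t) i = fft m x t a + zeta (Suc t) ^ k * fft m x t (a + S)"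
    using i tw by (simp add: S_def [symmetric] a_def Let_def)
  also have "fft m x t a = (\<Sum>v<2 ^ t. x (j + (2 * v) * S) * zeta (Suc t) ^ ((2 * v) * k))"
    unfolding Y0 zeta_mod dbl S(1) by (simp only: mult_ac)
  also have "zeta (Suc t) ^ k * fft m x t (a + S) =
      (\<Sum>v<2 ^ t. x (j + (2 * v + 1) * S) * zeta (Suc t) ^ ((2 * v + 1) * k))"
    unfolding Y1 zeta_mod sum_distrib_left dbl
  proof (intro sum.cong refl)
    fix v
    have 1: "j + S + v * 2 ^ (m - t) = j + (2 * v + 1) * S" by (simp add: S)
    have 2: "(2 * v + 1) * k = k + 2 * v * k" by simp
    show "zeta (Suc t) ^ k * (x (j + S + v * 2 ^ (m - t)) * zeta (Suc t) ^ (2 * v * k)) =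
        x (j + (2 * v + 1) * S) * zeta (Suc t) ^ ((2 * v + 1) * k)"
      unfolding 1 2 power_add by (simp only: mult_ac)
  qed
  also have "(\<Sum>v<2 ^ t. x (j + (2 * v) * S) * zeta (Suc t) ^ ((2 * v) * k)) + \<dots> =
      (\<Sum>u<2 * 2 ^ t. x (j + u * S) * zeta (Suc t) ^ (u * k))"
    by (rule sum_even_plus_odd)
  finally show ?case by (simp add: i_def S_def)
qed

lemma fft_final:
  assumes "k < 2 ^ m"
  shows "fft m x m k = (\<Sum>u<2 ^ m. x u * zeta m ^ (u * k))"
  using fft_stage [of m m k 0 x] assms by simp

text \<open>Expanding the square leaves for each pair \<open>u\<close>, \<open>v\<close> a geometric
  sum over \<open>k\<close>, which vanishes unless \<open>2 ^ m\<close> divides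
  \<open>u + v + r\<close> with \<open>r\<close> congruent to \<open>-i\<close>. A forward transform
  thus replaces the inverse one, and a single table of twiddle factors serves both.\<close>

lemma fft_square_fft:
  assumes "i < 2 ^ m"
  shows "fft m (\<lambda>k. (fft m x m k)\<^sup>2) m ((2 ^ m - i) mod 2 ^ m) =
    2 ^ m * (\<Sum>(u, v) \<in> {(u, v). u < 2 ^ m \<and> v < 2 ^ m \<and> (u + v) mod 2 ^ m = i}. x u * x v)"
proof -
  let ?N = "2 ^ m :: nat"
  define r where "r = (?N - i) mod ?N"
  have r: "r < ?N" by (simp add: r_def)
  have dvd: "?N dvd u + v + r \<longleftrightarrow> (u + v) mod ?N = i" for u v
  proof -
    have "?N dvd u + v + r \<longleftrightarrow> (u + v + (?N - i)) mod ?N = 0"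
      by (simp add: r_def dvd_eq_mod_eq_0 mod_simps)
    also have "\<dots> \<longleftrightarrow> (u + v) mod ?N = i"
    proof -
      define x where "x = (u + v) mod ?N"
      have "x < ?N" by (simp add: x_def)
      have "(u + v + (?N - i)) mod ?N = (x + (?N - i)) mod ?N"
        by (simp add: x_def mod_simps)
      also have "\<dots> = (if x < i then x + (?N - i) else x - i)"
      proof (cases "x < i")
        case False
        then have "x + (?N - i) = ?N + (x - i)" using assms by simp
        then have "(x + (?N - i)) mod ?N = (x - i) mod ?N" by (metis mod_add_self1)
        then show ?thesis using False \<open>x < ?N\<close> by simp
      qed (use assms in auto)
      also have "\<dots> = 0 \<longleftrightarrow> x = i" using assms by auto
      finally show ?thesis by (simp add: x_def)
    qed
    finally show ?thesis .
  qed
  have "fft m (\<lambda>k. (fft m x m k)\<^sup>2) m r =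
      (\<Sum>k<?N. (\<Sum>u<?N. x u * zeta m ^ (u * k))\<^sup>2 * zeta m ^ (k * r))"
    using r by (simp add: fft_final)
  also have "\<dots> = (\<Sum>k<?N. \<Sum>u<?N. \<Sum>v<?N. x u * x v * zeta m ^ (k * (u + v + r)))"
    by (intro sum.cong refl)
      (simp add: power2_eq_square sum_product sum_distrib_left power_add algebra_simps)
  also have "\<dots> = (\<Sum>u<?N. \<Sum>k<?N. \<Sum>v<?N. x u * x v * zeta m ^ (k * (u + v + r)))"
    by (rule sum.swap)
  also have "\<dots> = (\<Sum>u<?N. \<Sum>v<?N. \<Sum>k<?N. x u * x v * zeta m ^ (k * (u + v + r)))"
    by (intro sum.cong refl sum.swap)
  also have "\<dots> = (\<Sum>u<?N. \<Sum>v<?N. x u * x v * (\<Sum>k<?N. zeta m ^ (k * (u + v + r))))"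
    by (simp add: sum_distrib_left)
  also have "\<dots> = (\<Sum>u<?N. \<Sum>v<?N. if (u + v) mod ?N = i then 2 ^ m * (x u * x v) else 0)"
    by (intro sum.cong refl) (simp add: sum_zeta dvd)
  also have "\<dots> = (\<Sum>(u, v) \<in> {..<?N} \<times> {..<?N}. if (u + v) mod ?N = i then 2 ^ m * (x u * x v) else 0)"
    by (simp add: sum.cartesian_product)
  also have "\<dots> = (\<Sum>(u, v) \<in> {(u, v). u < ?N \<and> v < ?N \<and> (u + v) mod ?N = i}. 2 ^ m * (x u * x v))"
    by (intro sum.mono_neutral_cong_right) (auto split: if_splits)
  finally show ?thesis by (simp add: r_def sum_distrib_left case_prod_unfold)
qed

section \<open>Fixed-point arithmetic\<close>

definition cx :: "int \<times> int \<Rightarrow> complex" where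
  "cx z = Complex (of_int (fst z)) (of_int (snd z))"

text \<open>Components are rounded down, also when negative. This is the rounding that an unsigned
  division produces after a multiple of \<open>F\<close> has been added to the dividend.\<close>

definition fmul :: "int \<Rightarrow> int \<times> int \<Rightarrow> int \<times> int \<Rightarrow> int \<times> int" where
  "fmul F z y = ((fst z * fst y - snd z * snd y) div F, (fst z * snd y + snd z * fst y) div F)"

lemma of_int_div_bounds:
  assumes "F > 0"
  shows "\<bar>real_of_int (a div F) - a / F\<bar> \<le> 1"
proof -
  have "real_of_int (a div F) = \<lfloor>real_of_int a / real_of_int F\<rfloor>"
    by (simp add: floor_divide_of_int_eq)
  then show ?thesis by linarith
qed

lemma abs_components_le_cx: "\<bar>real_of_int (fst z)\<bar> \<le> cmod (cx z)" "\<bar>real_of_int (snd z)\<bar> \<le> cmod (cx z)"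
  using abs_Re_le_cmod [of "cx z"] abs_Im_le_cmod [of "cx z"] by (simp_all add: cx_def)

lemma fmul_error:
  assumes "F > 0"
  shows "cmod (cx (fmul F z y) - cx z * cx y / of_int F) \<le> 2"
proof -
  let ?d = "cx (fmul F z y) - cx z * cx y / of_int F"
  have F: "(of_int F :: complex) = of_real (of_int F)" by simp
  have "Re ?d = real_of_int ((fst z * fst y - snd z * snd y) div F)
      - real_of_int (fst z * fst y - snd z * snd y) / F"
    unfolding F Re_divide_of_real minus_complex.sel by (simp add: cx_def fmul_def)
  moreover have "Im ?d = real_of_int ((fst z * snd y + snd z * fst y) div F)
      - real_of_int (fst z * snd y + snd z * fst y) / F"
    unfolding F Im_divide_of_real minus_complex.sel by (simp add: cx_def fmul_def)
  ultimately have "\<bar>Re ?d\<bar> \<le> 1" "\<bar>Im ?d\<bar> \<le> 1"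
    using of_int_div_bounds [OF assms] by presburger+
  then show ?thesis using cmod_le [of ?d] by linarith
qed

text \<open>The factors are replaced one at a time: \<open>z * y / F - F * \<zeta> * \<eta>\<close>
  equals \<open>(z - F * \<zeta>) * y / F + \<zeta> * (y - F * \<eta>)\<close>. Bounding the exact
  value of one factor but the computed value of the other avoids a product of two errors; the
  \<open>2\<close> is the rounding of \<open>fmul\<close>.\<close>

lemma fmul_approx:
  assumes "F > 0"
    and z: "cmod (cx z - of_int F * \<zeta>) \<le> d" and y: "cmod (cx y - of_int F * \<eta>) \<le> e"
    and b: "cmod \<zeta> \<le> b" and c: "cmod (cx y) \<le> c"
  shows "cmod (cx (fmul F z y) - of_int F * (\<zeta> * \<eta>)) \<le> d * c / F + b * e + 2"
proof -
  have "d \<ge> 0" by (rule order_trans [OF norm_ge_zero z])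
  have "e \<ge> 0" by (rule order_trans [OF norm_ge_zero y])
  have eq: "cx z * cx y / of_int F - of_int F * (\<zeta> * \<eta>) =
      (cx z - of_int F * \<zeta>) * cx y / of_int F + \<zeta> * (cx y - of_int F * \<eta>)"
    using assms(1) by (simp add: field_simps)
  have "cmod (cx z * cx y / of_int F - of_int F * (\<zeta> * \<eta>)) \<le>
      cmod ((cx z - of_int F * \<zeta>) * cx y / of_int F) + cmod (\<zeta> * (cx y - of_int F * \<eta>))"
    unfolding eq by (rule norm_triangle_ineq)
  also have "\<dots> \<le> d * c / F + b * e"
    unfolding norm_mult norm_divide using assms \<open>d \<ge> 0\<close> \<open>e \<ge> 0\<close>
    by (intro add_mono divide_mono mult_mono)
      (auto simp: norm_of_int intro: order_trans [OF norm_ge_zero])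
  finally show ?thesis
    using fmul_error [OF assms(1), of z y]
      norm_triangle_ineq [of "cx (fmul F z y) - cx z * cx y / of_int F"
        "cx z * cx y / of_int F - of_int F * (\<zeta> * \<eta>)"] by simp
qed

primrec int_fft :: "int \<Rightarrow> (nat \<Rightarrow> int \<times> int) \<Rightarrow> nat \<Rightarrow> (nat \<Rightarrow> int \<times> int) \<Rightarrow> nat \<Rightarrow> nat \<Rightarrow> int \<times> int" where
  "int_fft F W m x 0 = x"
| "int_fft F W m x (Suc t) = (\<lambda>i. let S = 2 ^ (m - Suc t); a = src (2 ^ m) S i;
     u = int_fft F W m x t a; v = fmul F (W (i - i mod S)) (int_fft F W m x t (a + S))
     in (fst u + fst v, snd u + snd v))"

text \<open>
  One stage turns an error \<open>e\<close> and a magnitude \<open>b\<close> into at most \<open>3 e + b \<Delta> + 2\<close> and \<open>2 b\<close>; the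
  bounds below solve this recurrence.
\<close>

lemma int_fft_error:
  fixes \<Delta> E B :: real
  assumes F: "F > 0" and \<Delta>: "\<Delta> \<le> F"
    and W: "\<And>e. e < 2 ^ m \<Longrightarrow> cmod (cx (W e) - of_int F * zeta m ^ e) \<le> \<Delta>"
    and x: "\<And>i. i < 2 ^ m \<Longrightarrow> cmod (cx (x i) - of_int F * y i) \<le> E"
    and y: "\<And>i. i < 2 ^ m \<Longrightarrow> cmod (y i) \<le> B"
    and "t \<le> m" "i < 2 ^ m"
  shows "cmod (cx (int_fft F W m x t i) - of_int F * fft m y t i)
      \<le> 3 ^ t * (E + (B * \<Delta> + 2)) - 2 ^ t * (B * \<Delta> + 2) \<and>
    cmod (fft m y t i) \<le> 2 ^ t * B"
  using assms(6,7)
proof (induction t arbitrary: i)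
  case 0
  then show ?case using x y by simp
next
  case (Suc t)
  let ?S = "2 ^ (m - Suc t)"
  define a where "a = src (2 ^ m) ?S i"
  define k where "k = i - i mod ?S"
  have t: "t < m" using Suc.prems by simp
  have aS: "a + ?S < 2 ^ m" using src_less(1) [OF t Suc.prems(2)] by (simp add: a_def)
  then have a: "a < 2 ^ m" by simp
  have k: "k < 2 ^ m" using Suc.prems by (simp add: k_def)
  define e where "e = 3 ^ t * (E + (B * \<Delta> + 2)) - 2 ^ t * (B * \<Delta> + 2)"
  define b where "b = 2 ^ t * B"
  note IHa = Suc.IH [OF less_imp_le [OF t] a, folded e_def b_def]
  note IHb = Suc.IH [OF less_imp_le [OF t] aS, folded e_def b_def]
  have "\<Delta> \<ge> 0" by (rule order_trans [OF norm_ge_zero W [of 0]]) simp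
  have "e \<ge> 0" by (rule order_trans [OF norm_ge_zero conjunct1 [OF IHa]])
  have c: "cmod (cx (int_fft F W m x t (a + ?S))) \<le> F * b + e"
  proof -
    have "cmod (cx (int_fft F W m x t (a + ?S))) \<le>
      cmod (cx (int_fft F W m x t (a + ?S)) - of_int F * fft m y t (a + ?S)) +
      cmod (of_int F * fft m y t (a + ?S))"
      using norm_triangle_ineq [of "cx (int_fft F W m x t (a + ?S)) - of_int F * fft m y t (a + ?S)"
          "of_int F * fft m y t (a + ?S)"] by simp
    also have "\<dots> \<le> e + F * b"
      unfolding norm_mult norm_of_int using IHb F by (intro add_mono mult_mono) auto
    finally show ?thesis by simp
  qed
  define v where "v = fmul F (W k) (int_fft F W m x t (a + ?S))"
  define u where "u = int_fft F W m x t a"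
  have v: "cmod (cx v - of_int F * (zeta m ^ k * fft m y t (a + ?S))) \<le> \<Delta> * (F * b + e) / F + 1 * e + 2"
    unfolding v_def using W [OF k] IHb c F
    by (intro fmul_approx) (auto simp: norm_power)
  have "\<Delta> * (F * b + e) / F = b * \<Delta> + \<Delta> / F * e" using F by (simp add: field_simps)
  \<comment> \<open>This copy of \<open>e\<close>, the one from \<open>1 * e\<close> and the error
    of the entry at \<open>a\<close> make up the factor 3 per stage.\<close>
  also have "\<Delta> / F * e \<le> 1 * e" using F \<Delta> \<open>e \<ge> 0\<close> by (intro mult_right_mono) auto
  finally have v': "cmod (cx v - of_int F * (zeta m ^ k * fft m y t (a + ?S))) \<le> b * \<Delta> + 2 * e + 2"
    using v by simp
  have i: "int_fft F W m x (Suc t) i = (fst u + fst v, snd u + snd v)"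
    "fft m y (Suc t) i = fft m y t a + zeta m ^ k * fft m y t (a + ?S)"
    by (simp_all add: Let_def u_def v_def a_def k_def)
  have eq: "cx (int_fft F W m x (Suc t) i) - of_int F * fft m y (Suc t) i =
    (cx u - of_int F * fft m y t a) + (cx v - of_int F * (zeta m ^ k * fft m y t (a + ?S)))"
    unfolding i by (simp add: cx_def complex_eq_iff algebra_simps)
  have "cmod (cx (int_fft F W m x (Suc t) i) - of_int F * fft m y (Suc t) i)
      \<le> e + (b * \<Delta> + 2 * e + 2)"
    unfolding eq using IHa v' by (intro norm_triangle_le add_mono) (auto simp: u_def)
  also have "\<dots> \<le> 3 * e + 2 ^ t * (B * \<Delta> + 2)"
    using one_le_power [of "2::real" t] by (simp add: b_def algebra_simps)
  also have "\<dots> = 3 ^ Suc t * (E + (B * \<Delta> + 2)) - 2 ^ Suc t * (B * \<Delta> + 2)"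
    by (simp add: e_def algebra_simps)
  finally have 1: "cmod (cx (int_fft F W m x (Suc t) i) - of_int F * fft m y (Suc t) i) \<le> \<dots>" .
  have "cmod (fft m y (Suc t) i) \<le> b + b"
    unfolding i using IHa IHb by (intro norm_triangle_le add_mono) (auto simp: norm_mult norm_power)
  then have "cmod (fft m y (Suc t) i) \<le> 2 ^ Suc t * B"
    by (simp add: b_def mult_ac del: fft.simps)
  then show ?case using 1 by (rule conjI [rotated])
qed

section \<open>Approximating a root of unity and its powers\<close>

primrec twiddle :: "int \<Rightarrow> int \<times> int \<Rightarrow> nat \<Rightarrow> int \<times> int" where
  "twiddle F \<omega> 0 = (F, 0)"
| "twiddle F \<omega> (Suc e) = fmul F (twiddle F \<omega> e) \<omega>"

text \<open>One multiplication adds \<open>\<rho>\<close> for the inexact root and \<open>2\<close>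
  for rounding, and multiplies the old error by \<open>1 + \<rho> / F\<close>. As long as that error
  is at most \<open>F\<close>, the last effect amounts to another \<open>\<rho>\<close>, so errors
  add up linearly in \<open>e\<close> rather than geometrically.\<close>

lemma twiddle_error:
  fixes \<rho> :: real
  assumes F: "F > 0" and \<omega>: "cmod (cx \<omega> - of_int F * z) \<le> \<rho>" and z: "cmod z = 1"
    and "2 * real M * (\<rho> + 2) \<le> F" and "e \<le> M"
  shows "cmod (cx (twiddle F \<omega> e) - of_int F * z ^ e) \<le> 2 * real e * (\<rho> + 2)"
  using assms(5)
proof (induction e)
  case 0
  then show ?case by (simp add: cx_def complex_eq_iff)
next
  case (Suc e)
  have "\<rho> \<ge> 0" by (rule order_trans [OF norm_ge_zero \<omega>])
  define d where "d = 2 * real e * (\<rho> + 2)"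
  have "d \<le> 2 * real M * (\<rho> + 2)" unfolding d_def using Suc.prems \<open>\<rho> \<ge> 0\<close>
    by (intro mult_right_mono) auto
  then have d: "d \<le> F" using assms(4) by (rule order_trans)
  have "d \<ge> 0" using \<open>\<rho> \<ge> 0\<close> by (simp add: d_def)
  have "cmod (cx \<omega>) \<le> F + \<rho>"
    using norm_triangle_ineq [of "cx \<omega> - of_int F * z" "of_int F * z"] \<omega> z F
    by (simp add: norm_mult)
  then have "cmod (cx (fmul F (twiddle F \<omega> e) \<omega>) - of_int F * (z ^ e * z)) \<le> d * (F + \<rho>) / F + 1 * \<rho> + 2"
    using Suc.prems Suc.IH z F \<omega> by (intro fmul_approx) (auto simp: norm_power d_def)
  also have "d * (F + \<rho>) / F = d + d / F * \<rho>" using F by (simp add: field_simps)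
  also have "d / F * \<rho> \<le> 1 * \<rho>" using d F \<open>\<rho> \<ge> 0\<close> by (intro mult_right_mono) auto
  finally have "cmod (cx (fmul F (twiddle F \<omega> e) \<omega>) - of_int F * (z ^ e * z)) \<le> d + 2 * (\<rho> + 2)"
    by simp
  then show ?case by (simp add: d_def algebra_simps)
qed

text \<open>The formula \<open>cos (\<theta> / 2) ^ 2 = (1 + cos \<theta>) / 2\<close> scaled by
  \<open>F\<close>, from the start value \<open>cos (pi / 2) = 0\<close>; hence index
  \<open>j\<close> belongs to the angle \<open>2 * pi / 2 ^ (j + 2)\<close>.\<close>

primrec half_angle_cos :: "nat \<Rightarrow> nat \<Rightarrow> nat" where
  "half_angle_cos F 0 = 0"
| "half_angle_cos F (Suc j) = floor_sqrt (F * (F + half_angle_cos F j) div 2)"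

lemma half_angle_cos_le: "half_angle_cos F j \<le> F"
proof (induction j)
  case (Suc j)
  then have "F * (F + half_angle_cos F j) div 2 \<le> F * (F + F) div 2"
    by (intro div_le_mono mult_le_mono) auto
  also have "\<dots> = F\<^sup>2" by (simp add: power2_eq_square algebra_simps)
  finally show ?case using mono_floor_sqrt' by fastforce
qed simp

text \<open>The second bound uses integrality to gain one over plain strictness. That one pays for
  the truncated halving of the radicand in \<open>half_angle_cos\<close>.\<close>

lemma floor_sqrt_bounds:
  "(real (floor_sqrt x))\<^sup>2 \<le> real x" "real x + 1 \<le> (real (floor_sqrt x) + 1)\<^sup>2"
proof -
  show "(real (floor_sqrt x))\<^sup>2 \<le> real x"
    using floor_sqrt_power2_le [of x] by (metis of_nat_le_iff of_nat_power)
  have "x + 1 \<le> (Suc (floor_sqrt x))\<^sup>2" using Suc_floor_sqrt_power2_gt [of x] by simp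
  then have "real (x + 1) \<le> real ((Suc (floor_sqrt x))\<^sup>2)" by (simp only: of_nat_le_iff)
  then show "real x + 1 \<le> (real (floor_sqrt x) + 1)\<^sup>2" by (simp add: add.commute)
qed

text \<open>The error does not accumulate over the halvings. An error of 4 in the previous cosine is
  \<open>2 * F\<close> in the squares, and since \<open>\<theta> \<le> pi / 3\<close> gives
  \<open>v \<ge> F / 2\<close>, taking the root shrinks this to about 2, leaving room for rounding
  within the same bound 4.\<close>

lemma half_angle_cos_error:
  assumes "F \<ge> 9"
  shows "\<bar>real (half_angle_cos F j) - F * cos (2 * pi / 2 ^ (j + 2))\<bar> \<le> 4"
proof (induction j)
  case 0
  then show ?case by simp
next
  case (Suc j)
  define C where "C = half_angle_cos F j"
  define \<theta> where "\<theta> = 2 * pi / 2 ^ (Suc j + 2)"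
  have double: "2 * pi / 2 ^ (j + 2) = 2 * \<theta>" by (simp add: \<theta>_def)
  define v where "v = F * cos \<theta>"
  define r where "r = real (floor_sqrt (F * (F + C) div 2))"
  have IH: "\<bar>real C - F * cos (2 * \<theta>)\<bar> \<le> 4" using Suc.IH unfolding C_def double .
  have "(1::real) \<le> 2 ^ j" by simp
  then have "(6::real) \<le> 8 * 2 ^ j" by linarith
  then have "(6::real) \<le> 2 ^ (Suc j + 2)" by simp
  then have "2 * pi / 2 ^ (Suc j + 2) \<le> 2 * pi / 6" by (intro divide_left_mono) auto
  then have "\<theta> \<le> pi / 3" "\<theta> \<ge> 0" by (simp_all add: \<theta>_def)
  then have "cos \<theta> \<ge> cos (pi / 3)" using pi_gt_zero by (subst cos_mono_le_eq) auto
  then have v: "v \<ge> F / 2" using assms by (simp add: v_def cos_60)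
  have c2: "cos (2 * \<theta>) = 2 * (cos \<theta> * cos \<theta>) - 1"
    unfolding cos_double_cos power2_eq_square ..
  have v2: "v\<^sup>2 = F * (F + F * cos (2 * \<theta>)) / 2"
    unfolding v_def c2 by (simp add: power2_eq_square algebra_simps)
  define x where "x = F * (F + C) div 2"
  have x: "real x \<le> F * (F + real C) / 2" "F * (F + real C) / 2 < real x + 1"
  proof -
    have "2 * x \<le> F * (F + C)" "F * (F + C) < 2 * (x + 1)"
      unfolding x_def using div_mult_mod_eq [of "F * (F + C)" 2] mod_less_divisor [of 2 "F * (F + C)"]
      by presburger+
    then have "real (2 * x) \<le> real (F * (F + C))" "real (F * (F + C)) < real (2 * (x + 1))"
      by (simp_all only: of_nat_le_iff of_nat_less_iff)
    then show "real x \<le> F * (F + real C) / 2" "F * (F + real C) / 2 < real x + 1" by simp_all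
  qed
  have d: "\<bar>real F * (F + real C) / 2 - v\<^sup>2\<bar> \<le> 2 * F"
  proof -
    have "real F * (F + real C) / 2 - v\<^sup>2 = F / 2 * (real C - F * cos (2 * \<theta>))"
      unfolding v2 by (simp add: algebra_simps diff_divide_distrib [symmetric] add_divide_distrib [symmetric])
    then have "\<bar>real F * (F + real C) / 2 - v\<^sup>2\<bar> = F / 2 * \<bar>real C - F * cos (2 * \<theta>)\<bar>"
      by (simp only: abs_mult)
    also have "\<dots> \<le> F / 2 * 4" using IH by (intro mult_left_mono) auto
    finally show ?thesis by simp
  qed
  have r: "r\<^sup>2 \<le> x" "real x + 1 \<le> (r + 1)\<^sup>2" "r \<ge> 0"
    using floor_sqrt_bounds [of x] by (simp_all add: r_def x_def)
  have "r\<^sup>2 \<le> v\<^sup>2 + 2 * F" using r x d by linarith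
  also have "\<dots> \<le> (v + 4)\<^sup>2" using v by (simp add: power2_eq_square algebra_simps)
  finally have up: "r \<le> v + 4" using power2_le_imp_le [of r "v + 4"] v by simp
  have lo: "v - 4 \<le> r"
  proof (rule ccontr)
    assume "\<not> v - 4 \<le> r"
    then have "(r + 1)\<^sup>2 \<le> (v - 3)\<^sup>2" using r(3) by (intro power_mono) auto
    \<comment> \<open>Here \<open>F \<ge> 9\<close> is used:
      \<open>6 * v \<ge> 3 * F \<ge> 2 * F + 9\<close>.\<close>
    also have "\<dots> \<le> v\<^sup>2 - 2 * F" using v assms by (simp add: power2_eq_square algebra_simps)
    finally show False using r x d by linarith
  qed
  have "\<bar>r - v\<bar> \<le> 4" using up lo by linarith
  then show ?case by (simp only: half_angle_cos.simps r_def v_def \<theta>_def C_def)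
qed

definition half_angle_sin :: "nat \<Rightarrow> nat \<Rightarrow> nat" where
  "half_angle_sin F j = floor_sqrt (F * F - half_angle_cos F j * half_angle_cos F j)"

text \<open>From \<open>sin (2 * \<theta>) \<le> 2 * sin \<theta>\<close>: halving the angle at most
  halves the sine. A lower bound is needed because a square root near zero amplifies errors by the
  reciprocal of its value.\<close>

lemma sin_lower: "1 / 2 ^ j \<le> sin (2 * pi / 2 ^ (j + 2))"
proof (induction j)
  case 0
  then show ?case by simp
next
  case (Suc j)
  define \<theta> where "\<theta> = 2 * pi / 2 ^ (Suc j + 2)"
  have double: "2 * pi / 2 ^ (j + 2) = 2 * \<theta>" by (simp add: \<theta>_def)
  have "(1::real) \<le> 2 ^ Suc j" by (rule one_le_power) simp
  then have "2 ^ 1 * (1::real) \<le> 2 ^ (Suc j + 2)" by simp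
  then have "\<theta> \<le> pi" "\<theta> \<ge> 0" unfolding \<theta>_def by (auto simp: divide_simps)
  then have "sin \<theta> \<ge> 0" by (simp add: sin_ge_zero)
  have "1 / 2 ^ j \<le> 2 * sin \<theta> * cos \<theta>" using Suc.IH unfolding double sin_double .
  also have "\<dots> \<le> 2 * sin \<theta> * 1" using \<open>sin \<theta> \<ge> 0\<close> by (intro mult_left_mono) auto
  finally show ?case by (simp add: \<theta>_def field_simps)
qed

text \<open>An error of 4 in the cosine is at most \<open>8 * F\<close> in the squares. By
  \<open>sin_lower\<close> the scaled sine is at least \<open>4 * F / M\<close> with
  \<open>M = 2 ^ (j + 2)\<close>, and dividing by it leaves an error of order \<open>M\<close>:
  accuracy is lost only in proportion to the order of the root.\<close>

lemma half_angle_sin_error: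
  assumes "F \<ge> 9"
  shows "\<bar>real (half_angle_sin F j) - F * sin (2 * pi / 2 ^ (j + 2))\<bar> \<le> 2 * 2 ^ (j + 2) + 1"
proof -
  define \<theta> where "\<theta> = 2 * pi / 2 ^ (j + 2)"
  define M :: real where "M = 2 ^ (j + 2)"
  define C where "C = half_angle_cos F j"
  define r where "r = real (half_angle_sin F j)"
  define v where "v = F * sin \<theta>"
  have "M > 0" by (simp add: M_def)
  have "4 / M \<le> sin \<theta>" using sin_lower [of j] by (simp add: M_def \<theta>_def)
  then have "F * (4 / M) \<le> v" unfolding v_def by (intro mult_left_mono) auto
  then have v: "v * M \<ge> 4 * F" using \<open>M > 0\<close> by (simp add: field_simps)
  have "v * M > 0" using v assms by linarith
  then have "v > 0" using \<open>M > 0\<close> by (simp add: zero_less_mult_iff)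
  have CF: "C \<le> F" by (simp add: C_def half_angle_cos_le)
  then have CF2: "C * C \<le> F * F" by (intro mult_le_mono)
  have x: "real (F * F - C * C) = F\<^sup>2 - (real C)\<^sup>2"
    using CF2 by (simp add: of_nat_diff power2_eq_square)
  have r: "r\<^sup>2 \<le> F\<^sup>2 - (real C)\<^sup>2" "F\<^sup>2 - (real C)\<^sup>2 + 1 \<le> (r + 1)\<^sup>2" "r \<ge> 0"
    using floor_sqrt_bounds [of "F * F - C * C"] unfolding x
    by (simp_all add: r_def half_angle_sin_def C_def)
  have v2: "v\<^sup>2 = F\<^sup>2 - (F * cos \<theta>)\<^sup>2"
    by (simp add: v_def power_mult_distrib sin_squared_eq algebra_simps)
  have "\<bar>(real C)\<^sup>2 - (F * cos \<theta>)\<^sup>2\<bar> = \<bar>real C - F * cos \<theta>\<bar> * \<bar>real C + F * cos \<theta>\<bar>"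
    unfolding abs_mult [symmetric] by (simp add: power2_eq_square algebra_simps)
  also have "\<dots> \<le> 4 * (2 * real F)"
  proof (intro mult_mono)
    show "\<bar>real C - F * cos \<theta>\<bar> \<le> 4"
      using half_angle_cos_error [OF assms, of j] by (simp add: C_def \<theta>_def)
    have "\<bar>F * cos \<theta>\<bar> \<le> real F * 1" unfolding abs_mult by (intro mult_mono) auto
    then show "\<bar>real C + F * cos \<theta>\<bar> \<le> 2 * real F" using CF by linarith
  qed auto
  finally have d: "\<bar>(F\<^sup>2 - (real C)\<^sup>2) - v\<^sup>2\<bar> \<le> 8 * F" unfolding v2 by linarith
  have "r\<^sup>2 \<le> v\<^sup>2 + 8 * F" using r d by linarith
  also have "\<dots> \<le> v\<^sup>2 + 4 * (v * M) + 4 * (M * M)" using v mult_pos_pos [OF \<open>M > 0\<close> \<open>M > 0\<close>] by linarith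
  also have "\<dots> = (v + 2 * M)\<^sup>2" by (simp add: power2_eq_square algebra_simps)
  finally have up: "r \<le> v + 2 * M" using power2_le_imp_le [of r "v + 2 * M"] \<open>v > 0\<close> \<open>M > 0\<close> by simp
  have lo: "v - (2 * M + 1) \<le> r"
  proof (rule ccontr)
    assume *: "\<not> v - (2 * M + 1) \<le> r"
    then have "(r + 1)\<^sup>2 \<le> (v - 2 * M)\<^sup>2" using r(3) by (intro power_mono) auto
    also have "\<dots> = v\<^sup>2 - 2 * (v * M) - 2 * M * (v - 2 * M)" by (simp add: power2_eq_square algebra_simps)
    also have "\<dots> \<le> v\<^sup>2 - 8 * F"
    proof -
      \<comment> \<open>The negated claim together with \<open>r \<ge> 0\<close> gives
        \<open>v > 2 * M + 1\<close>.\<close>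
      have "0 \<le> 2 * M * (v - 2 * M)" using * r(3) \<open>M > 0\<close> by (intro mult_nonneg_nonneg) auto
      then show ?thesis using v by linarith
    qed
    finally show False using r d by linarith
  qed
  have "\<bar>r - v\<bar> \<le> 2 * M + 1" using up lo \<open>M > 0\<close> by linarith
  then show ?thesis by (simp only: r_def v_def \<theta>_def M_def)
qed

lemma root_error:
  assumes "F \<ge> 9"
  shows "cmod (cx (int (half_angle_cos F j), int (half_angle_sin F j)) - of_int (int F) * zeta (j + 2))
    \<le> 2 * 2 ^ (j + 2) + 5"
proof -
  let ?d = "cx (int (half_angle_cos F j), int (half_angle_sin F j)) - of_int (int F) * zeta (j + 2)"
  have "Re ?d = real (half_angle_cos F j) - F * cos (2 * pi / 2 ^ (j + 2))"
    "Im ?d = real (half_angle_sin F j) - F * sin (2 * pi / 2 ^ (j + 2))"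
    by (simp_all add: cx_def zeta_def)
  then show ?thesis
    using half_angle_cos_error [OF assms, of j] half_angle_sin_error [OF assms, of j] cmod_le [of ?d]
    by linarith
qed

section \<open>Error budget of the rounded convolution in powers of the transform length\<close>

definition scl :: "nat \<Rightarrow> nat" where
  "scl m = 2 ^ (8 * m)"

definition root_approx :: "nat \<Rightarrow> int \<times> int" where
  "root_approx m = (int (half_angle_cos (scl m) (m - 2)), int (half_angle_sin (scl m) (m - 2)))"

definition tw :: "nat \<Rightarrow> nat \<Rightarrow> int \<times> int" where
  "tw m = twiddle (int (scl m)) (root_approx m)"

text \<open>The condition for exact division on the machine. It concerns the combined numerators
  only: the four products may overflow separately, since word arithmetic is arithmetic modulo
  \<open>2 ^ w\<close>.\<close>

definition fits :: "nat \<Rightarrow> int \<times> int \<Rightarrow> int \<times> int \<Rightarrow> bool" where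
  "fits m z y \<longleftrightarrow> \<bar>fst z * fst y - snd z * snd y\<bar> \<le> 2 ^ (20 * m) \<and> \<bar>fst z * snd y + snd z * fst y\<bar> \<le> 2 ^ (20 * m)"

lemma fits_if_norm:
  assumes "cmod (cx z) \<le> b" "cmod (cx y) \<le> c" "b * c \<le> 2 ^ (20 * m)"
  shows "fits m z y"
proof -
  have "b \<ge> 0" by (rule order_trans [OF norm_ge_zero assms(1)])
  then have le: "cmod (cx z * cx y) \<le> 2 ^ (20 * m)"
    using assms mult_mono [OF assms(1,2)] by (simp add: norm_mult)
  have "\<bar>real_of_int (fst z * fst y - snd z * snd y)\<bar> = \<bar>Re (cx z * cx y)\<bar>"
    "\<bar>real_of_int (fst z * snd y + snd z * fst y)\<bar> = \<bar>Im (cx z * cx y)\<bar>"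
    by (simp_all add: cx_def)
  then have "\<bar>real_of_int (fst z * fst y - snd z * snd y)\<bar> \<le> 2 ^ (20 * m)"
    "\<bar>real_of_int (fst z * snd y + snd z * fst y)\<bar> \<le> 2 ^ (20 * m)"
    using le abs_Re_le_cmod [of "cx z * cx y"] abs_Im_le_cmod [of "cx z * cx y"] by linarith+
  then have "real_of_int \<bar>fst z * fst y - snd z * snd y\<bar> \<le> real_of_int (2 ^ (20 * m))"
    "real_of_int \<bar>fst z * snd y + snd z * fst y\<bar> \<le> real_of_int (2 ^ (20 * m))"
    by simp_all
  then show ?thesis unfolding fits_def of_int_le_iff by simp
qed

context
  fixes m :: nat
  assumes m: "m \<ge> 6"
begin

abbreviation N :: real where "N \<equiv> 2 ^ m"

lemma N_ge: "N \<ge> 64"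
  using power_increasing [OF m, of "2::real"] by simp

text \<open>One spare power of \<open>N\<close> pays for any constant up to 64, which is what
  \<open>m \<ge> 6\<close> buys; the largest constant that occurs below is 57. The estimates thereby
  reduce to comparing exponents.\<close>

lemma N_powers:
  assumes "c \<le> 64" "k < l"
  shows "c * N ^ k \<le> N ^ l"
proof -
  have "c * N ^ k \<le> N * N ^ k" using assms(1) N_ge by (intro mult_right_mono) auto
  also have "\<dots> = N ^ Suc k" by simp
  also have "\<dots> \<le> N ^ l" using assms(2) N_ge by (intro power_increasing) auto
  finally show ?thesis .
qed

lemma N_power_9: "N ^ 8 * N = N ^ 9"
  unfolding power_Suc2 [symmetric] by simp

lemma scl_eq: "real (scl m) = N ^ 8" "(2::real) ^ (20 * m) = N ^ 20"
  by (simp_all add: scl_def power_mult [symmetric] mult.commute)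

lemma scl_pos: "int (scl m) > 0"
  by (simp add: scl_def)

text \<open>The error factor 3 of each of the \<open>m\<close> stages becomes a factor
  \<open>N ^ 2\<close> for a whole transform.\<close>

lemma three_power: "(3::real) ^ m \<le> N ^ 2"
proof -
  have "(3::real) ^ m \<le> 4 ^ m" by (intro power_mono) auto
  also have "\<dots> = N ^ 2" by (simp add: power2_eq_square power_mult_distrib [symmetric])
  finally show ?thesis .
qed

lemma root_approx_error: "cmod (cx (root_approx m) - of_int (int (scl m)) * zeta m) \<le> 2 * N + 5"
proof -
  have "real (scl m) \<ge> 9" unfolding scl_eq using N_powers [of 9 0 8] by simp
  then have "scl m \<ge> 9" by simp
  note root_error [OF this, of "m - 2"]
  moreover have "m - 2 + 2 = m" using m by simp
  ultimately show ?thesis by (simp only: root_approx_def)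
qed

lemma tw_error:
  assumes "e \<le> 2 ^ m"
  shows "cmod (cx (tw m e) - of_int (int (scl m)) * zeta m ^ e) \<le> 5 * N ^ 2"
proof -
  have big: "2 * N * (2 * N + 7) \<le> 5 * N ^ 2" using N_ge by (simp add: power2_eq_square algebra_simps)
  also have "\<dots> \<le> N ^ 8" by (rule N_powers) simp_all
  finally have c: "2 * real (2 ^ m) * ((2 * N + 5) + 2) \<le> real_of_int (int (scl m))"
    by (simp add: scl_eq add.commute)
  have "cmod (cx (tw m e) - of_int (int (scl m)) * zeta m ^ e) \<le> 2 * real e * ((2 * N + 5) + 2)"
    unfolding tw_def using scl_pos root_approx_error c assms
    by (intro twiddle_error [where M = "2 ^ m"]) auto
  also have "\<dots> \<le> 2 * N * (2 * N + 7)"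
  proof -
    have "real e \<le> N" using assms of_nat_le_iff [of e "2 ^ m", where 'a = real] by simp
    then show ?thesis by (intro mult_mono) auto
  qed
  finally show ?thesis using big by simp
qed

lemma norm_le_of_error:
  assumes "cmod (cx z - of_int (int (scl m)) * y) \<le> e" "cmod y \<le> b"
  shows "cmod (cx z) \<le> N ^ 8 * b + e"
proof -
  have "cmod (of_int (int (scl m)) * y) \<le> N ^ 8 * b"
    using assms(2) unfolding norm_mult by (simp add: scl_eq)
  then show ?thesis
    using norm_triangle_ineq [of "cx z - of_int (int (scl m)) * y" "of_int (int (scl m)) * y"] assms(1)
    by simp
qed

lemma tw_norm: "e \<le> 2 ^ m \<Longrightarrow> cmod (cx (tw m e)) \<le> 2 * N ^ 8"
proof -
  assume "e \<le> 2 ^ m"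
  from norm_le_of_error [OF tw_error [OF this], of 1]
  have "cmod (cx (tw m e)) \<le> N ^ 8 + 5 * N ^ 2" by (simp add: norm_power)
  moreover have "5 * N ^ 2 \<le> N ^ 8" by (rule N_powers) simp_all
  ultimately show ?thesis by simp
qed

lemma tw_fits_root: "e \<le> 2 ^ m \<Longrightarrow> fits m (tw m e) (root_approx m)"
proof (rule fits_if_norm [OF tw_norm])
  have "2 * N + 5 \<le> N ^ 8" using N_powers [of 7 1 8] N_ge by simp
  then show "cmod (cx (root_approx m)) \<le> 2 * N ^ 8"
    using norm_le_of_error [OF root_approx_error, of 1] by simp
  have "2 * N ^ 8 * (2 * N ^ 8) = 4 * N ^ 16" by simp
  also have "\<dots> \<le> N ^ 20" by (rule N_powers) simp_all
  finally show "2 * N ^ 8 * (2 * N ^ 8) \<le> 2 ^ (20 * m)" by (simp only: scl_eq)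
qed

lemma fft_stage_bounds:
  assumes x: "\<And>i. i < 2 ^ m \<Longrightarrow> cmod (cx (x i) - of_int (int (scl m)) * y i) \<le> E"
    and y: "\<And>i. i < 2 ^ m \<Longrightarrow> cmod (y i) \<le> B"
    and "t \<le> m" "i < 2 ^ m"
  shows "cmod (cx (int_fft (int (scl m)) (tw m) m x t i) - of_int (int (scl m)) * fft m y t i)
      \<le> N ^ 2 * (E + (B * (5 * N ^ 2) + 2))"
    "cmod (fft m y t i) \<le> N * B"
proof -
  have "5 * N ^ 2 \<le> N ^ 8" by (rule N_powers) simp_all
  then have le: "5 * N ^ 2 \<le> of_int (int (scl m))" by (simp add: scl_eq)
  have "E \<ge> 0" by (rule order_trans [OF norm_ge_zero x [of 0]]) simp
  have "B \<ge> 0" by (rule order_trans [OF norm_ge_zero y [of 0]]) simp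
  define \<kappa> where "\<kappa> = B * (5 * N ^ 2) + 2"
  have "\<kappa> \<ge> 0" using \<open>B \<ge> 0\<close> by (simp add: \<kappa>_def)
  note err = int_fft_error [where x = x and y = y, OF scl_pos le tw_error [OF less_imp_le] x y assms(3,4), folded \<kappa>_def]
  have "2 ^ t * B \<le> N * B" using assms(3) \<open>B \<ge> 0\<close> by (intro mult_right_mono power_increasing) auto
  with err show "cmod (fft m y t i) \<le> N * B" by simp
  have "(3::real) ^ t \<le> 3 ^ m" using assms(3) by (intro power_increasing) auto
  then have "(3::real) ^ t \<le> N ^ 2" using three_power by linarith
  then have "(3::real) ^ t * (E + \<kappa>) \<le> N ^ 2 * (E + \<kappa>)"
    using \<open>E \<ge> 0\<close> \<open>\<kappa> \<ge> 0\<close> by (intro mult_right_mono) auto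
  moreover have "0 \<le> 2 ^ t * \<kappa>" using \<open>\<kappa> \<ge> 0\<close> by simp
  ultimately show "cmod (cx (int_fft (int (scl m)) (tw m) m x t i) - of_int (int (scl m)) * fft m y t i)
      \<le> N ^ 2 * (E + (B * (5 * N ^ 2) + 2))" using err unfolding \<kappa>_def by linarith
qed

definition marks :: "(nat \<Rightarrow> bool) \<Rightarrow> (nat \<Rightarrow> bool) \<Rightarrow> nat \<Rightarrow> int \<times> int" where
  "marks a b u = (if a u then int (scl m) else 0, if b u then int (scl m) else 0)"

definition spectrum :: "(nat \<Rightarrow> bool) \<Rightarrow> (nat \<Rightarrow> bool) \<Rightarrow> nat \<Rightarrow> nat \<Rightarrow> int \<times> int" where
  "spectrum a b t = int_fft (int (scl m)) (tw m) m (marks a b) t"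

definition squared :: "(nat \<Rightarrow> bool) \<Rightarrow> (nat \<Rightarrow> bool) \<Rightarrow> nat \<Rightarrow> int \<times> int" where
  "squared a b i = fmul (int (scl m)) (spectrum a b m i) (spectrum a b m i)"

definition counts :: "(nat \<Rightarrow> bool) \<Rightarrow> (nat \<Rightarrow> bool) \<Rightarrow> nat \<Rightarrow> nat \<Rightarrow> int \<times> int" where
  "counts a b t = int_fft (int (scl m)) (tw m) m (squared a b) t"

context
  fixes a b :: "nat \<Rightarrow> bool"
begin

definition ind :: "nat \<Rightarrow> complex" where
  "ind u = Complex (of_bool (a u)) (of_bool (b u))"

lemma norm_ind: "cmod (ind u) \<le> 2"
  using cmod_le [of "ind u"] by (auto simp: ind_def)

lemma spectrum_error:
  assumes "t \<le> m" "i < 2 ^ m"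
  shows "cmod (cx (spectrum a b t i) - of_int (int (scl m)) * fft m ind t i) \<le> 11 * N ^ 4"
    "cmod (fft m ind t i) \<le> 2 * N"
    "cmod (cx (spectrum a b t i)) \<le> 3 * N ^ 9"
proof -
  have 0: "cmod (cx (marks a b u) - of_int (int (scl m)) * ind u) \<le> 0" for u
    by (simp add: marks_def ind_def cx_def complex_eq_iff)
  note * = fft_stage_bounds [where x = "marks a b" and y = ind, OF 0 norm_ind assms]
  have "N ^ 2 * (0 + (2 * (5 * N ^ 2) + 2)) = 10 * N ^ 4 + 2 * N ^ 2" by (simp add: algebra_simps)
  also have "\<dots> \<le> 11 * N ^ 4" using N_powers [of 2 2 4] by simp
  finally show e: "cmod (cx (spectrum a b t i) - of_int (int (scl m)) * fft m ind t i) \<le> 11 * N ^ 4"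
    using *(1) unfolding spectrum_def by linarith
  show y: "cmod (fft m ind t i) \<le> 2 * N" using *(2) by simp
  have "N ^ 8 * (2 * N) = 2 * N ^ 9" unfolding N_power_9 [symmetric] by (simp only: mult_ac)
  then have "N ^ 8 * (2 * N) + 11 * N ^ 4 \<le> 3 * N ^ 9"
    using N_powers [of 11 4 9] by linarith
  then show "cmod (cx (spectrum a b t i)) \<le> 3 * N ^ 9"
    using norm_le_of_error [OF e y] by linarith
qed

lemma spectrum_fits:
  assumes "t \<le> m" "i < 2 ^ m" "e \<le> 2 ^ m"
  shows "fits m (tw m e) (spectrum a b t i)" "fits m (spectrum a b t i) (spectrum a b t i)"
proof -
  have "2 * N ^ 8 * (3 * N ^ 9) = 6 * N ^ 17" "3 * N ^ 9 * (3 * N ^ 9) = 9 * N ^ 18" by simp_all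
  moreover have "6 * N ^ 17 \<le> N ^ 20" "9 * N ^ 18 \<le> N ^ 20"
    by (rule N_powers; simp)+
  ultimately have le: "2 * N ^ 8 * (3 * N ^ 9) \<le> 2 ^ (20 * m)" "3 * N ^ 9 * (3 * N ^ 9) \<le> 2 ^ (20 * m)"
    by (simp_all only: scl_eq)
  note n = spectrum_error(3) [OF assms(1,2)]
  show "fits m (tw m e) (spectrum a b t i)" by (rule fits_if_norm [OF tw_norm [OF assms(3)] n le(1)])
  show "fits m (spectrum a b t i) (spectrum a b t i)" by (rule fits_if_norm [OF n n le(2)])
qed

lemma squared_error:
  assumes "i < 2 ^ m"
  shows "cmod (cx (squared a b i) - of_int (int (scl m)) * (fft m ind m i)\<^sup>2) \<le> N ^ 6"
proof -
  note s = spectrum_error [OF order_refl assms]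
  have "cmod (cx (squared a b i) - of_int (int (scl m)) * (fft m ind m i * fft m ind m i))
      \<le> 11 * N ^ 4 * (3 * N ^ 9) / of_int (int (scl m)) + 2 * N * (11 * N ^ 4) + 2"
    unfolding squared_def by (rule fmul_approx [OF scl_pos s(1) s(1) s(2) s(3)])
  also have "11 * N ^ 4 * (3 * N ^ 9) / of_int (int (scl m)) = 33 * N ^ 5"
  proof -
    have "11 * N ^ 4 * (3 * N ^ 9) = 33 * N ^ 5 * N ^ 8" by simp
    then show ?thesis by (simp only: of_int_of_nat_eq scl_eq) (simp add: field_simps)
  qed
  also have "2 * N * (11 * N ^ 4) = 22 * N ^ 5" using power_Suc [of N 4] by simp
  also have "33 * N ^ 5 + 22 * N ^ 5 + 2 \<le> N ^ 6"
    using N_powers [of 57 5 6] one_le_power [of N 5] N_ge by linarith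
  finally show ?thesis by (simp add: power2_eq_square)
qed

lemma counts_error:
  assumes "t \<le> m" "i < 2 ^ m"
  shows "cmod (cx (counts a b t i) - of_int (int (scl m)) * fft m (\<lambda>i. (fft m ind m i)\<^sup>2) t i) \<le> 2 * N ^ 8"
    "cmod (cx (counts a b t i)) \<le> 6 * N ^ 11"
proof -
  have 1: "cmod ((fft m ind m u)\<^sup>2) \<le> 4 * N ^ 2" if "u < 2 ^ m" for u
    using power_mono [OF spectrum_error(2) [OF order_refl that], of 2]
    by (simp add: norm_power power_mult_distrib)
  note * = fft_stage_bounds [where x = "squared a b" and y = "\<lambda>i. (fft m ind m i)\<^sup>2", OF squared_error 1 assms]
  have "N ^ 2 * (N ^ 6 + (4 * N ^ 2 * (5 * N ^ 2) + 2)) = N ^ 8 + 20 * N ^ 6 + 2 * N ^ 2"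
    by (simp add: algebra_simps)
  also have "\<dots> \<le> 2 * N ^ 8"
    using N_powers [of 21 6 8] N_powers [of 2 2 6] by simp
  finally show e: "cmod (cx (counts a b t i) - of_int (int (scl m)) * fft m (\<lambda>i. (fft m ind m i)\<^sup>2) t i) \<le> 2 * N ^ 8"
    using *(1) unfolding counts_def by linarith
  have y: "cmod (fft m (\<lambda>i. (fft m ind m i)\<^sup>2) t i) \<le> 4 * N ^ 3"
    using *(2) by (simp add: power2_eq_square power3_eq_cube)
  have "N ^ 8 * (4 * N ^ 3) = 4 * N ^ 11" by (subst mult.left_commute, subst power_add [symmetric]) simp
  then have "N ^ 8 * (4 * N ^ 3) + 2 * N ^ 8 \<le> 6 * N ^ 11"
    using N_powers [of 1 8 11] by linarith
  then show "cmod (cx (counts a b t i)) \<le> 6 * N ^ 11"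
    using norm_le_of_error [OF e y] by linarith
qed

lemma counts_fits:
  assumes "t \<le> m" "i < 2 ^ m" "e \<le> 2 ^ m"
  shows "fits m (tw m e) (counts a b t i)"
proof -
  have "2 * N ^ 8 * (6 * N ^ 11) = 12 * N ^ 19" by simp
  also have "\<dots> \<le> N ^ 20" by (rule N_powers) simp_all
  finally show ?thesis
    using fits_if_norm [OF tw_norm [OF assms(3)] counts_error(2) [OF assms(1,2)]] by (simp only: scl_eq)
qed

lemma counts_bound:
  assumes "t \<le> m" "i < 2 ^ m"
  shows "\<bar>snd (counts a b t i)\<bar> \<le> 2 ^ (20 * m)"
proof -
  have "6 * N ^ 11 \<le> N ^ 20" by (rule N_powers) simp_all
  then have "\<bar>real_of_int (snd (counts a b t i))\<bar> \<le> 2 ^ (20 * m)"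
    unfolding scl_eq using counts_error(2) [OF assms] abs_components_le_cx(2) [of "counts a b t i"] by linarith
  then have "real_of_int \<bar>snd (counts a b t i)\<bar> \<le> real_of_int (2 ^ (20 * m))" by simp
  then show ?thesis unfolding of_int_le_iff .
qed

text \<open>A pair with sum \<open>i\<close> shows up in the imaginary part as \<open>(u, v)\<close>
  and as \<open>(v, u)\<close>, so \<open>c\<close> pairs contribute
  \<open>2 * c * N * scl m\<close>. The threshold \<open>N * scl m = N ^ 9\<close> lies halfway
  between no pair and one pair, and the error \<open>2 * N ^ 8\<close> is smaller than this margin.
  The support condition rules out sums that wrap around modulo \<open>2 ^ m\<close>.\<close>

lemma counts_hit:
  assumes supp: "\<And>u. a u \<or> b u \<Longrightarrow> 2 * u < 2 ^ m" and i: "i < 2 ^ m"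
  shows "snd (counts a b m ((2 ^ m - i) mod 2 ^ m)) > int (2 ^ m * scl m) \<longleftrightarrow> (\<exists>u v. a u \<and> b v \<and> u + v = i)"
proof -
  define P where "P = {(u, v). u < 2 ^ m \<and> v < 2 ^ m \<and> (u + v) mod 2 ^ m = i}"
  define P' where "P' = P \<inter> {p. a (fst p) \<and> b (snd p)}"
  have "finite P" by (rule finite_subset [of _ "{..<2 ^ m} \<times> {..<2 ^ m}"]) (auto simp: P_def)
  have swap: "(\<Sum>(u, v)\<in>P. f u v) = (\<Sum>(u, v)\<in>P. f v u)" for f :: "nat \<Rightarrow> nat \<Rightarrow> real"
    by (rule sum.reindex_bij_witness [of _ prod.swap prod.swap]) (auto simp: P_def add.commute)
  have "Im (\<Sum>(u, v)\<in>P. ind u * ind v) = (\<Sum>(u, v)\<in>P. of_bool (a u \<and> b v) + of_bool (a v \<and> b u))"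
    by (simp add: ind_def case_prod_unfold of_bool_conj mult.commute add.commute)
  also have "\<dots> = 2 * (\<Sum>(u, v)\<in>P. of_bool (a u \<and> b v))"
    using swap [of "\<lambda>u v. of_bool (a u \<and> b v)"] by (simp add: case_prod_unfold sum.distrib)
  also have "(\<Sum>(u, v)\<in>P. of_bool (a u \<and> b v)) = real (card P')"
    unfolding P'_def using \<open>finite P\<close>
    by (simp add: case_prod_unfold of_bool_def sum.If_cases)
  finally have im: "Im (\<Sum>(u, v)\<in>P. ind u * ind v) = 2 * real (card P')" .
  let ?r = "(2 ^ m - i) mod 2 ^ m"
  define Y where "Y = fft m (\<lambda>i. (fft m ind m i)\<^sup>2) m ?r"
  have "Y = of_real N * (\<Sum>(u, v)\<in>P. ind u * ind v)"
    unfolding Y_def fft_square_fft [OF i] P_def by simp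
  then have "Im Y = N * Im (\<Sum>(u, v)\<in>P. ind u * ind v)" by (simp only: times_complex.sel Re_complex_of_real Im_complex_of_real)
  then have "Im Y = N * (2 * real (card P'))" by (simp only: im)
  then have "Im (of_int (int (scl m)) * Y) = N ^ 8 * (N * (2 * real (card P')))"
    by (simp add: scl_eq)
  then have imY: "Im (of_int (int (scl m)) * Y) = N ^ 9 * (2 * real (card P'))"
    by (simp only: N_power_9 mult.assoc [symmetric])
  have "cmod (cx (counts a b m ?r) - of_int (int (scl m)) * Y) \<le> 2 * N ^ 8"
    unfolding Y_def by (rule counts_error) auto
  then have "\<bar>Im (cx (counts a b m ?r) - of_int (int (scl m)) * Y)\<bar> \<le> 2 * N ^ 8"
    using abs_Im_le_cmod order_trans by blast
  then have close: "\<bar>real_of_int (snd (counts a b m ?r)) - N ^ 9 * (2 * real (card P'))\<bar> \<le> 2 * N ^ 8"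
    unfolding minus_complex.sel imY by (simp add: cx_def)
  have big: "2 * N ^ 8 < N ^ 9" using N_powers [of 3 8 9] zero_less_power [of N 8] N_ge by linarith
  have "int (2 ^ m * scl m) < snd (counts a b m ?r) \<longleftrightarrow>
      real_of_int (int (2 ^ m * scl m)) < real_of_int (snd (counts a b m ?r))"
    by (simp only: of_int_less_iff)
  also have "real_of_int (int (2 ^ m * scl m)) = N ^ 9" using N_power_9 by (simp add: scl_eq mult.commute)
  finally have "snd (counts a b m ?r) > int (2 ^ m * scl m) \<longleftrightarrow> real_of_int (snd (counts a b m ?r)) > N ^ 9" .
  also have "\<dots> \<longleftrightarrow> card P' > 0"
  proof (cases "card P' = 0")
    case True
    then show ?thesis using close big by simp
  next
    case False
    then have "N ^ 9 * (2 * 1) \<le> N ^ 9 * (2 * real (card P'))" by (intro mult_left_mono) auto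
    then show ?thesis using close big False by linarith
  qed
  also have "\<dots> \<longleftrightarrow> P' \<noteq> {}" using \<open>finite P\<close> by (simp add: P'_def card_gt_0_iff)
  also have "\<dots> \<longleftrightarrow> (\<exists>u v. a u \<and> b v \<and> u + v = i)"
  proof
    assume "P' \<noteq> {}"
    then obtain p where p: "p \<in> P'" by auto
    then have uv: "a (fst p)" "b (snd p)" "(fst p + snd p) mod 2 ^ m = i"
      by (auto simp: P'_def P_def)
    then have "fst p + snd p < 2 ^ m" using supp [of "fst p"] supp [of "snd p"] by simp
    then show "\<exists>u v. a u \<and> b v \<and> u + v = i" using uv by auto
  next
    assume "\<exists>u v. a u \<and> b v \<and> u + v = i"
    then obtain u v where "a u" "b v" "u + v = i" by auto
    then have "(u, v) \<in> P'" using i supp [of u] supp [of v] by (auto simp: P'_def P_def)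
    then show "P' \<noteq> {}" by auto
  qed
  finally show ?thesis .
qed

end

end

section \<open>A program logic for the word RAM\<close>

text \<open>Total correctness with an upper bound on the time; exact times would depend on the
  branches taken.\<close>

definition runs :: "nat \<Rightarrow> wcom \<Rightarrow> state \<Rightarrow> nat \<Rightarrow> (state \<Rightarrow> bool) \<Rightarrow> bool" where
  "runs w c s T Q \<longleftrightarrow> (\<exists>t s'. exec w c s t s' \<and> t \<le> T \<and> Q s')"

lemma runs_mono: "runs w c s T Q \<Longrightarrow> T \<le> T' \<Longrightarrow> (\<And>s'. Q s' \<Longrightarrow> Q' s') \<Longrightarrow> runs w c s T' Q'"
  unfolding runs_def by (meson order_trans)

lemma runs_Seq:
  assumes "runs w c1 s T1 P" and "\<And>s'. P s' \<Longrightarrow> runs w c2 s' T2 Q"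
  shows "runs w (Seq c1 c2) s (T1 + T2) Q"
proof -
  obtain t1 s1 where 1: "exec w c1 s t1 s1" "t1 \<le> T1" "P s1" using assms(1) by (auto simp: runs_def)
  obtain t2 s2 where 2: "exec w c2 s1 t2 s2" "t2 \<le> T2" "Q s2" using assms(2) [OF 1(3)] by (auto simp: runs_def)
  from exec_Seq [OF 1(1) 2(1)] 1 2 show ?thesis unfolding runs_def by (meson add_mono)
qed

primrec straight :: "wcom \<Rightarrow> bool" where
  "straight Skip = True"
| "straight (Assign x e) = True"
| "straight (Store e1 e2) = True"
| "straight (Seq c1 c2) = (straight c1 \<and> straight c2)"
| "straight (Cond e c1 c2) = (straight c1 \<and> straight c2)"
| "straight (While e c) = False"

text \<open>For loop-free commands the final state is computed by simplification instead of by
  derivations of \<open>exec\<close>. The values for \<open>While\<close>, here and in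
  \<open>cost\<close>, are placeholders excluded by \<open>straight\<close>.\<close>

primrec sem :: "nat \<Rightarrow> wcom \<Rightarrow> state \<Rightarrow> state" where
  "sem w Skip s = s"
| "sem w (Assign x e) s = ((fst s)(x := wexp_val w e s), snd s)"
| "sem w (Store e1 e2) s = (fst s, (snd s)(wexp_val w e1 s := wexp_val w e2 s))"
| "sem w (Seq c1 c2) s = sem w c2 (sem w c1 s)"
| "sem w (Cond e c1 c2) s = (if wexp_val w e s \<noteq> 0 then sem w c1 s else sem w c2 s)"
| "sem w (While e c) s = s"

primrec cost :: "wcom \<Rightarrow> nat" where
  "cost Skip = 1"
| "cost (Assign x e) = 1 + wexp_cost e"
| "cost (Store e1 e2) = 1 + wexp_cost e1 + wexp_cost e2"
| "cost (Seq c1 c2) = cost c1 + cost c2"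
| "cost (Cond e c1 c2) = 1 + wexp_cost e + max (cost c1) (cost c2)"
| "cost (While e c) = 0"

lemma exec_straight: "straight c \<Longrightarrow> \<exists>t. exec w c s t (sem w c s) \<and> t \<le> cost c"
proof (induction c arbitrary: s)
  case Skip
  show ?case using exec_Skip [of w s] by auto
next
  case (Assign x e)
  show ?case using exec_Assign [of w x e s] by auto
next
  case (Store e1 e2)
  show ?case using exec_Store [of w e1 e2 s] by auto
next
  case (Seq c1 c2)
  then have c: "straight c1" "straight c2" by simp_all
  obtain t1 where 1: "exec w c1 s t1 (sem w c1 s)" "t1 \<le> cost c1" using Seq.IH(1) [OF c(1)] by blast
  obtain t2 where 2: "exec w c2 (sem w c1 s) t2 (sem w c2 (sem w c1 s))" "t2 \<le> cost c2"
    using Seq.IH(2) [OF c(2)] by blast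
  from exec_Seq [OF 1(1) 2(1)] 1 2 show ?case by (auto intro: add_mono)
next
  case (Cond e c1 c2)
  then have c: "straight c1" "straight c2" by simp_all
  obtain t1 where 1: "exec w c1 s t1 (sem w c1 s)" "t1 \<le> cost c1" using Cond.IH(1) [OF c(1)] by blast
  obtain t2 where 2: "exec w c2 s t2 (sem w c2 s)" "t2 \<le> cost c2" using Cond.IH(2) [OF c(2)] by blast
  show ?case
  proof (cases "wexp_val w e s = 0")
    case True
    from exec_CondFalse [OF True 2(1), of c1] 2(2) True show ?thesis by (auto intro!: exI)
  next
    case False
    from exec_CondTrue [OF False 1(1), of c2] 1(2) False show ?thesis by (auto intro!: exI)
  qed
qed simp

lemma runs_straight:
  assumes "straight c" "cost c \<le> T" "Q (sem w c s)"
  shows "runs w c s T Q"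
proof -
  obtain t where "exec w c s t (sem w c s)" "t \<le> cost c" using exec_straight [OF assms(1)] by blast
  then show ?thesis using assms unfolding runs_def by (meson order_trans)
qed

lemma runs_straight_Seq:
  "straight c1 \<Longrightarrow> runs w c2 (sem w c1 s) T Q \<Longrightarrow> runs w (Seq c1 c2) s (cost c1 + T) Q"
  by (rule runs_Seq [where P = "\<lambda>s'. s' = sem w c1 s"]) (simp_all add: runs_straight)

text \<open>The invariant is indexed by the number of completed rounds and determines the guard from
  that number, so the loop makes exactly \<open>k\<close> rounds.\<close>

lemma runs_While:
  assumes "I 0 s"
    and guard: "\<And>j s. j < k \<Longrightarrow> I j s \<Longrightarrow> wexp_val w e s \<noteq> 0"
    and step: "\<And>j s. j < k \<Longrightarrow> I j s \<Longrightarrow> runs w c s T (I (Suc j))"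
    and exit: "\<And>s. I k s \<Longrightarrow> wexp_val w e s = 0"
  shows "runs w (While e c) s (k * (1 + wexp_cost e + T) + (1 + wexp_cost e)) (I k)"
proof -
  have "runs w (While e c) s ((k - j) * (1 + wexp_cost e + T) + (1 + wexp_cost e)) (I k)"
    if "j \<le> k" "I j s" for j s
    using that
  proof (induction "k - j" arbitrary: j s)
    case 0
    then have "j = k" by simp
    then have "wexp_val w e s = 0" using 0 exit by simp
    then have "exec w (While e c) s (1 + wexp_cost e) s" by (rule exec_WhileFalse)
    moreover have "I k s" using 0 \<open>j = k\<close> by simp
    ultimately show ?case unfolding runs_def by (meson le_add2)
  next
    case (Suc d)
    from Suc.hyps(2) have j: "j < k" and d: "d = k - Suc j" "Suc j \<le> k" by linarith+
    obtain t1 s1 where 1: "exec w c s t1 s1" "t1 \<le> T" "I (Suc j) s1"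
      using step [OF j Suc.prems(2)] by (auto simp: runs_def)
    from Suc.hyps(1) [OF d 1(3)] obtain t2 s2 where 2: "exec w (While e c) s1 t2 s2" "I k s2"
      "t2 \<le> d * (1 + wexp_cost e + T) + (1 + wexp_cost e)"
      by (auto simp: runs_def d)
    have "exec w (While e c) s (1 + wexp_cost e + t1 + t2) s2"
      by (rule exec_WhileTrue [OF guard [OF j Suc.prems(2)] 1(1) 2(1)])
    moreover have "1 + wexp_cost e + t1 + t2 \<le> Suc d * (1 + wexp_cost e + T) + (1 + wexp_cost e)"
      using 1 2 by simp
    ultimately show ?case using 2(2) Suc.hyps(2) unfolding runs_def by metis
  qed
  from this [of 0 s] show ?thesis using assms(1) by simp
qed

definition For :: "nat \<Rightarrow> nat \<Rightarrow> wcom \<Rightarrow> wcom" where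
  "For x r c = Seq (Assign x (Const 0))
     (While (Bin Less (Reg x) (Reg r)) (Seq c (Assign x (Bin Add (Reg x) (Const 1)))))"

text \<open>The invariant must be insensitive to the counter \<open>x\<close>, so that
  initialization and increment preserve it; the value of the counter is tracked beside it. The bound
  \<open>k < 2 ^ w\<close> keeps the increment from wrapping around.\<close>

lemma runs_For:
  assumes k: "k < 2 ^ w"
    and init: "I 0 s"
    and indep: "\<And>j s v. I j s \<Longrightarrow> I j ((fst s)(x := v), snd s)"
    and bound: "\<And>j s. I j s \<Longrightarrow> fst s r = k" and "r \<noteq> x"
    and step: "\<And>j s. j < k \<Longrightarrow> I j s \<Longrightarrow> fst s x = j \<Longrightarrow>
      runs w c s T (\<lambda>s'. I (Suc j) s' \<and> fst s' x = j)"
  shows "runs w (For x r c) s (k * (T + 8) + 6) (I k)"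
proof -
  have one: "1 mod 2 ^ w = (1::nat)" if "j < k" for j
    using that k by (cases w) auto
  let ?I = "\<lambda>j s. I j s \<and> fst s x = j"
  have "runs w (While (Bin Less (Reg x) (Reg r)) (Seq c (Assign x (Bin Add (Reg x) (Const 1)))))
      (sem w (Assign x (Const 0)) s)
      (k * (1 + wexp_cost (Bin Less (Reg x) (Reg r)) + (T + 4)) + (1 + wexp_cost (Bin Less (Reg x) (Reg r)))) (?I k)"
  proof (rule runs_While [where I = ?I])
    show "?I 0 (sem w (Assign x (Const 0)) s)" using init indep by simp
    show "wexp_val w (Bin Less (Reg x) (Reg r)) s \<noteq> 0" if "j < k" "?I j s" for j s
      using that bound [of j s] by simp
    show "wexp_val w (Bin Less (Reg x) (Reg r)) s = 0" if "?I k s" for s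
      using that bound [of k s] by simp
    show "runs w (Seq c (Assign x (Bin Add (Reg x) (Const 1)))) s (T + 4) (?I (Suc j))"
      if j: "j < k" and I: "?I j s" for j s
    proof (rule runs_Seq)
      show "runs w c s T (\<lambda>s'. I (Suc j) s' \<and> fst s' x = j)" using step [OF j] I by blast
      fix s' assume s': "I (Suc j) s' \<and> fst s' x = j"
      have "wexp_val w (Bin Add (Reg x) (Const 1)) s' = Suc j"
        using s' one [OF j] j k by simp
      then show "runs w (Assign x (Bin Add (Reg x) (Const 1))) s' 4 (?I (Suc j))"
        using s' indep [of "Suc j" s' "Suc j"] by (intro runs_straight) (simp_all del: wexp_val.simps)
    qed
  qed
  note loop = this
  have "runs w (For x r c) s (cost (Assign x (Const 0)) +
      (k * (1 + wexp_cost (Bin Less (Reg x) (Reg r)) + (T + 4)) + (1 + wexp_cost (Bin Less (Reg x) (Reg r))))) (?I k)"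
    unfolding For_def by (rule runs_straight_Seq [OF _ loop]) simp
  then show ?thesis by (rule runs_mono) (auto simp: algebra_simps)
qed

text \<open>Registers are allotted by lifetime: a loop or subprogram tracked in this way writes only
  registers from some number on, so what it preserves is an initial segment.\<close>

definition agree :: "nat \<Rightarrow> (nat \<Rightarrow> nat) \<Rightarrow> state \<Rightarrow> bool" where
  "agree k E s \<longleftrightarrow> (\<forall>r<k. fst s r = E r)"

lemma agree_upd [simp]:
  "k \<le> x \<Longrightarrow> agree k E (R(x := v), M) \<longleftrightarrow> agree k E (R, M)"
  "agree k E (fst s, M) \<longleftrightarrow> agree k E s"
  by (auto simp: agree_def)

lemma agreeD: "agree k E s \<Longrightarrow> r < k \<Longrightarrow> fst s r = E r"
  by (simp add: agree_def)

lemma agree_mono: "agree k E s \<Longrightarrow> j \<le> k \<Longrightarrow> agree j E s"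
  by (simp add: agree_def)

text \<open>Two's complement. The encoding respects sums, differences and products modulo
  \<open>2 ^ w\<close>, so intermediate values may overflow as long as the final one is small; only
  division and comparison need bounds on their operands.\<close>

definition enc :: "nat \<Rightarrow> int \<Rightarrow> nat" where
  "enc w v = nat (v mod 2 ^ w)"

lemma enc_binop:
  "binop_val w Add (enc w x) (enc w y) = enc w (x + y)"
  "binop_val w Sub (enc w x) (enc w y) = enc w (x - y)"
  "binop_val w Mul (enc w x) (enc w y) = enc w (x * y)"
proof -
  have i: "int (enc w z) = z mod 2 ^ w" for z by (simp add: enc_def)
  have "int (binop_val w Add (enc w x) (enc w y)) = int (enc w (x + y))"
    by (simp add: i zmod_int mod_simps)
  then show "binop_val w Add (enc w x) (enc w y) = enc w (x + y)" by (simp only: of_nat_eq_iff)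
  have "int (binop_val w Mul (enc w x) (enc w y)) = int (enc w (x * y))"
    by (simp add: i zmod_int mod_simps)
  then show "binop_val w Mul (enc w x) (enc w y) = enc w (x * y)" by (simp only: of_nat_eq_iff)
  show "binop_val w Sub (enc w x) (enc w y) = enc w (x - y)"
    by (simp add: i enc_def mod_simps)
qed

lemma enc_nat: "a < 2 ^ w \<Longrightarrow> enc w (int a) = a"
  unfolding enc_def by (simp add: nat_mod_distrib nat_power_eq)

lemma enc_0: "enc w 0 = 0"
  by (simp add: enc_def)

lemma sub_val: "b \<le> a \<Longrightarrow> a < 2 ^ w \<Longrightarrow> nat ((int a - int b) mod 2 ^ w) = a - b"
proof -
  assume "b \<le> a" "a < 2 ^ w"
  then have "nat ((int a - int b) mod 2 ^ w) = enc w (int (a - b))" by (simp only: enc_def of_nat_diff [OF \<open>b \<le> a\<close>])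
  also have "\<dots> = a - b" using \<open>a < 2 ^ w\<close> by (intro enc_nat) simp
  finally show ?thesis .
qed

section \<open>Programs for the transform\<close>

text \<open>
  Registers: 0 to 2 hold the input, 3 the bound \<open>L\<close> on rounded entries, 4 the stride \<open>2 L + 1\<close>,
  5 the transform length \<open>2 ^ m\<close>, 6 the fixed-point unit \<open>scl m\<close>, 7 and 8 a bias making dividends
  nonnegative (7 before and 8 after division by the unit), 9 the base address of the records,
  10 twice the length of the input, 11 the biased threshold for counts, 12 the number of positions
  read off, 13 the largest entry, 14 and 15 the root of unity, 20 the scale, 21 the width \<open>S\<close> of
  an FFT stage, 22 the innermost loop counter; higher registers are temporary.

  Memory: the input in the first \<open>2 n\<close> cells, then \<open>n\<close> cells of results, then \<open>2 ^ m\<close> records of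
  eight cells; the fields of the records are the real and imaginary parts of the FFT input
  (0, 1), of its output (2, 3) and of the twiddle factors (4, 5).
\<close>

definition fld_addr :: "nat \<Rightarrow> nat \<Rightarrow> wexp" where
  "fld_addr f r = Bin Add (Bin Add (Reg 9) (Bin Mul (Const 8) (Reg r))) (Const f)"

definition fld :: "nat \<Rightarrow> nat \<Rightarrow> wexp" where
  "fld f r = Load (fld_addr f r)"

definition div_unit :: "wexp \<Rightarrow> wexp" where
  "div_unit e = Bin Sub (Bin Div (Bin Add e (Reg 7)) (Reg 6)) (Reg 8)"

definition mul_re :: "wexp \<Rightarrow> wexp \<Rightarrow> wexp \<Rightarrow> wexp \<Rightarrow> wexp" where
  "mul_re a b c d = div_unit (Bin Sub (Bin Mul a c) (Bin Mul b d))"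

definition mul_im :: "wexp \<Rightarrow> wexp \<Rightarrow> wexp \<Rightarrow> wexp \<Rightarrow> wexp" where
  "mul_im a b c d = div_unit (Bin Add (Bin Mul a d) (Bin Mul b c))"

lemma cost_macros [simp]:
  "wexp_cost (fld_addr f r) = 7" "wexp_cost (fld f r) = 8"
  "wexp_cost (mul_re a b c d) = 9 + wexp_cost a + wexp_cost b + wexp_cost c + wexp_cost d"
  "wexp_cost (mul_im a b c d) = 9 + wexp_cost a + wexp_cost b + wexp_cost c + wexp_cost d"
  by (simp_all add: fld_addr_def fld_def mul_re_def mul_im_def div_unit_def)

definition fft_indices :: wcom where
  "fft_indices = Seq (Assign 23 (Bin Mod (Reg 22) (Reg 21)))
    (Seq (Assign 24 (Bin Sub (Reg 22) (Reg 23)))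
    (Seq (Assign 25 (Bin Add (Bin Mod (Bin Mul (Const 2) (Reg 24)) (Reg 5)) (Reg 23)))
      (Assign 26 (Bin Add (Reg 25) (Reg 21)))))"

definition fft_body :: wcom where
  "fft_body = Seq fft_indices
    (Seq (Store (fld_addr 2 22) (Bin Add (fld 0 25) (mul_re (fld 4 24) (fld 5 24) (fld 0 26) (fld 1 26))))
      (Store (fld_addr 3 22) (Bin Add (fld 1 25) (mul_im (fld 4 24) (fld 5 24) (fld 0 26) (fld 1 26)))))"

text \<open>A stage reads fields 0 and 1 but writes fields 2 and 3, because its output positions
  overlap with inputs that are still to be read; hence a copy after every stage.\<close>

definition copy_body :: wcom where
  "copy_body = Seq (Store (fld_addr 0 22) (fld 2 22)) (Store (fld_addr 1 22) (fld 3 22))"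

definition fft_prog :: wcom where
  "fft_prog = Seq (Assign 21 (Reg 5))
    (While (Bin Less (Const 1) (Reg 21))
      (Seq (Assign 21 (Bin Div (Reg 21) (Const 2))) (Seq (For 22 5 fft_body) (For 22 5 copy_body))))"

text \<open>Register 23 holds back the new real part until the imaginary part, which needs the old
  one, has been stored.\<close>

definition square_body :: wcom where
  "square_body = Seq (Assign 23 (mul_re (fld 0 22) (fld 1 22) (fld 0 22) (fld 1 22)))
    (Seq (Store (fld_addr 1 22) (mul_im (fld 0 22) (fld 1 22) (fld 0 22) (fld 1 22)))
      (Store (fld_addr 0 22) (Reg 23)))"

text \<open>Dividends reach up to \<open>2 * N ^ 20\<close> after adding the bias, where
  \<open>N = 2 ^ m\<close>; two further powers of \<open>N\<close> give ample room for constants.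
  The last assumption makes all record addresses representable.\<close>

locale transform =
  fixes w m base :: nat
  assumes m6: "m \<ge> 6" and word: "22 * m \<le> w" and mem: "base + 8 * 2 ^ m + 8 \<le> 2 ^ w"
begin

definition adr :: "nat \<Rightarrow> nat \<Rightarrow> nat" where
  "adr f i = base + 8 * i + f"

lemma adr_eq_iff [simp]: "f < 8 \<Longrightarrow> g < 8 \<Longrightarrow> adr f i = adr g j \<longleftrightarrow> f = g \<and> i = j"
  unfolding adr_def by presburger

text \<open>\<open>K\<close> is the set of record fields that may differ. Cells below
  \<open>base\<close>, which will hold the input and the results, are never among them.\<close>

definition frame :: "nat set \<Rightarrow> (nat \<Rightarrow> nat) \<Rightarrow> (nat \<Rightarrow> nat) \<Rightarrow> bool" where
  "frame K M M0 \<longleftrightarrow> (\<forall>a. M a = M0 a \<or> (base \<le> a \<and> (a - base) mod 8 \<in> K))"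

lemma frame_refl [simp]: "frame K M M"
  by (simp add: frame_def)

lemma frame_trans: "frame K M M1 \<Longrightarrow> frame K M1 M0 \<Longrightarrow> frame K M M0"
  unfolding frame_def by metis

lemma frame_mono: "frame K M M0 \<Longrightarrow> K \<subseteq> K' \<Longrightarrow> frame K' M M0"
  unfolding frame_def by blast

lemma frame_upd [simp]: "frame K M M0 \<Longrightarrow> f \<in> K \<Longrightarrow> f < 8 \<Longrightarrow> frame K (M(adr f i := v)) M0"
  unfolding frame_def by (auto simp: adr_def)

lemma frame_low: "frame K M M0 \<Longrightarrow> a < base \<Longrightarrow> M a = M0 a"
  unfolding frame_def by (meson not_le)

lemma frame_adr: "frame K M M0 \<Longrightarrow> f \<notin> K \<Longrightarrow> f < 8 \<Longrightarrow> M (adr f i) = M0 (adr f i)"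
  unfolding frame_def adr_def by (drule spec [where x = "base + 8 * i + f"]) auto

definition holds :: "(nat \<Rightarrow> nat) \<Rightarrow> nat \<Rightarrow> (nat \<Rightarrow> int \<times> int) \<Rightarrow> nat \<Rightarrow> bool" where
  "holds M f g k \<longleftrightarrow> (\<forall>i<k. M (adr f i) = enc w (fst (g i)) \<and> M (adr (Suc f) i) = enc w (snd (g i)))"

lemma holds_frame: "holds M f g k \<Longrightarrow> frame K M' M \<Longrightarrow> f \<notin> K \<Longrightarrow> Suc f \<notin> K \<Longrightarrow> f < 7 \<Longrightarrow> holds M' f g k"
proof -
  assume "holds M f g k" and fr: "frame K M' M" "f \<notin> K" "Suc f \<notin> K" "f < 7"
  moreover have "M' (adr f i) = M (adr f i)" "M' (adr (Suc f) i) = M (adr (Suc f) i)" for i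
    by (rule frame_adr [OF fr(1)]; use fr in simp)+
  ultimately show ?thesis by (simp only: holds_def)
qed

definition env :: "(nat \<Rightarrow> nat) \<Rightarrow> bool" where
  "env E \<longleftrightarrow> E 5 = 2 ^ m \<and> E 6 = scl m \<and> E 7 = 2 ^ (20 * m) \<and> E 8 = 2 ^ (12 * m) \<and> E 9 = base"

lemma word_ge: "2 ^ (22 * m) \<le> (2::nat) ^ w"
  using word by (intro power_increasing) auto

lemma small_powers:
  "4096 * 2 ^ (20 * m) \<le> (2::nat) ^ w" "64 \<le> (2::nat) ^ m" "2 * 2 ^ m \<le> (2::nat) ^ w" "2 ^ m < (2::nat) ^ w" "8 < (2::nat) ^ w"
proof -
  show *: "64 \<le> (2::nat) ^ m" using power_increasing [OF m6, of "2::nat"] by simp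
  have "4096 \<le> (2::nat) ^ (2 * m)"
    using m6 power_increasing [of 12 "2 * m" "2::nat"] by simp
  then have "4096 * 2 ^ (20 * m) \<le> (2::nat) ^ (2 * m) * 2 ^ (20 * m)" by (intro mult_right_mono) auto
  also have "\<dots> = 2 ^ (22 * m)" by (simp add: power_add [symmetric])
  finally show "4096 * 2 ^ (20 * m) \<le> (2::nat) ^ w" using word_ge by (rule order_trans)
  show "2 * 2 ^ m \<le> (2::nat) ^ w" "2 ^ m < (2::nat) ^ w" "8 < (2::nat) ^ w" using mem * by linarith+
qed

lemma fld_addr_val [simp]:
  assumes "fst s 9 = base" "fst s r < 2 ^ m" "f < 8"
  shows "wexp_val w (fld_addr f r) s = adr f (fst s r)"
proof -
  have "base + 8 * fst s r + f < 2 ^ w" using assms mem by linarith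
  then show ?thesis using assms small_powers by (simp add: fld_addr_def adr_def)
qed

lemma fld_val [simp]:
  assumes "fst s 9 = base" "fst s r < 2 ^ m" "f < 8"
  shows "wexp_val w (fld f r) s = snd s (adr f (fst s r))"
  using assms by (simp add: fld_def)

text \<open>Adding the bias decodes a signed word into a natural number in an order-preserving way.
  This serves division in \<open>div_unit_val\<close> as well as the comparison with the threshold
  in \<open>extract_runs\<close>.\<close>

lemma bias_val:
  assumes "fst s 7 = 2 ^ (20 * m)" and v: "wexp_val w e s = enc w v" "\<bar>v\<bar> \<le> 2 ^ (20 * m)"
  shows "wexp_val w (Bin Add e (Reg 7)) s = nat (v + 2 ^ (20 * m))" "nat (v + 2 ^ (20 * m)) < 2 ^ w"
proof -
  define u where "u = nat (v + 2 ^ (20 * m))"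
  have u: "int u = v + 2 ^ (20 * m)" using v(2) by (simp add: u_def)
  have le: "(2::nat) ^ (20 * m) < 2 ^ w" using small_powers(1) zero_less_power [of "2::nat" "20 * m"] by linarith
  have "int u < 2 ^ w"
  proof -
    have "int (4096 * 2 ^ (20 * m)) \<le> int (2 ^ w)" using small_powers(1) by (simp only: of_nat_le_iff)
    then have "4096 * 2 ^ (20 * m) \<le> (2::int) ^ w" by simp
    moreover have "0 < (2::int) ^ (20 * m)" by simp
    ultimately show ?thesis using v(2) u by linarith
  qed
  then have "int u < int (2 ^ w)" by simp
  then have uw: "u < 2 ^ w" by (simp only: of_nat_less_iff)
  then show "nat (v + 2 ^ (20 * m)) < 2 ^ w" by (simp only: u_def)
  have "wexp_val w (Bin Add e (Reg 7)) s = binop_val w Add (enc w v) (enc w (int (2 ^ (20 * m))))"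
    using v(1) assms(1) le by (simp only: wexp_val.simps enc_nat)
  also have "\<dots> = enc w (int u)" unfolding enc_binop u by simp
  also have "\<dots> = u" by (rule enc_nat [OF uw])
  finally show "wexp_val w (Bin Add e (Reg 7)) s = nat (v + 2 ^ (20 * m))" by (simp only: u_def)
qed

text \<open>The bias \<open>2 ^ (20 * m)\<close> is \<open>2 ^ (12 * m)\<close> times the unit, so
  it shifts the floor of the quotient by exactly \<open>2 ^ (12 * m)\<close>, which the final
  subtraction removes.\<close>

lemma div_unit_val:
  assumes "fst s 6 = scl m" "fst s 7 = 2 ^ (20 * m)" "fst s 8 = 2 ^ (12 * m)"
    and v: "wexp_val w e s = enc w v" "\<bar>v\<bar> \<le> 2 ^ (20 * m)"
  shows "wexp_val w (div_unit e) s = enc w (v div int (scl m))"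
proof -
  have split: "2 ^ (20 * m) = (2::nat) ^ (12 * m) * scl m"
    by (simp add: scl_def power_add [symmetric])
  define u where "u = nat (v + 2 ^ (20 * m))"
  have u: "int u = v + 2 ^ (20 * m)" using v(2) by (simp add: u_def)
  note add = bias_val(1) [OF assms(2) v, folded u_def]
  note uw = bias_val(2) [OF assms(2) v, folded u_def]
  have "int (u div scl m) = (v + 2 ^ (12 * m) * int (scl m)) div int (scl m)"
  proof -
    have "int (2 ^ (20 * m)) = int (2 ^ (12 * m) * scl m)" by (simp only: split)
    then show ?thesis by (simp add: zdiv_int u)
  qed
  also have "\<dots> = v div int (scl m) + 2 ^ (12 * m)" by (simp add: scl_def)
  finally have d: "int (u div scl m) = v div int (scl m) + 2 ^ (12 * m)" .
  have lt: "u div scl m < 2 ^ w" using div_le_dividend uw by (rule le_less_trans)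
  have "(2::nat) ^ (12 * m) \<le> 2 ^ (20 * m)" by (intro power_increasing) auto
  then have le2: "(2::nat) ^ (12 * m) < 2 ^ w"
    using small_powers(1) zero_less_power [of "2::nat" "20 * m"] by linarith
  have "wexp_val w (div_unit e) s = binop_val w Sub (u div scl m) (2 ^ (12 * m))"
    using add assms(1,3) by (simp only: div_unit_def wexp_val.simps binop_val.simps(4))
  also have "\<dots> = binop_val w Sub (enc w (int (u div scl m))) (enc w (int (2 ^ (12 * m))))"
    by (simp only: enc_nat [OF le2] enc_nat [OF lt])
  also have "\<dots> = enc w (v div int (scl m))" unfolding enc_binop d by simp
  finally show ?thesis .
qed

lemma mul_val:
  assumes "fst s 6 = scl m" "fst s 7 = 2 ^ (20 * m)" "fst s 8 = 2 ^ (12 * m)"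
    and "wexp_val w a s = enc w (fst z)" "wexp_val w b s = enc w (snd z)"
    and "wexp_val w c s = enc w (fst y)" "wexp_val w d s = enc w (snd y)"
    and "fits m z y"
  shows "wexp_val w (mul_re a b c d) s = enc w (fst (fmul (int (scl m)) z y))"
    "wexp_val w (mul_im a b c d) s = enc w (snd (fmul (int (scl m)) z y))"
proof -
  have re: "wexp_val w (Bin Sub (Bin Mul a c) (Bin Mul b d)) s = enc w (fst z * fst y - snd z * snd y)"
    and im: "wexp_val w (Bin Add (Bin Mul a d) (Bin Mul b c)) s = enc w (fst z * snd y + snd z * fst y)"
    using assms(4-7) by (simp_all only: wexp_val.simps enc_binop)
  have b: "\<bar>fst z * fst y - snd z * snd y\<bar> \<le> 2 ^ (20 * m)" "\<bar>fst z * snd y + snd z * fst y\<bar> \<le> 2 ^ (20 * m)"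
    using assms(8) by (simp_all only: fits_def)
  show "wexp_val w (mul_re a b c d) s = enc w (fst (fmul (int (scl m)) z y))"
    unfolding mul_re_def fmul_def fst_conv by (rule div_unit_val [OF assms(1-3) re b(1)])
  show "wexp_val w (mul_im a b c d) s = enc w (snd (fmul (int (scl m)) z y))"
    unfolding mul_im_def fmul_def snd_conv by (rule div_unit_val [OF assms(1-3) im b(2)])
qed

lemma enc_add: "(enc w x + enc w y) mod 2 ^ w = enc w (x + y)"
  using enc_binop(1) [of w x y] by simp

text \<open>The hypothesis on \<open>Z'\<close> has the shape of the recursion of
  \<open>int_fft\<close>, so that \<open>int_fft.simps(2)\<close> discharges it. Fields 0 and 1 stay
  intact throughout the loop, hence every butterfly reads values of the old stage.\<close>

lemma fft_inner:
  assumes env: "env E" "E 21 = 2 ^ (m - Suc t)" "t < m"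
    and Z: "Z' = (\<lambda>i. let S = 2 ^ (m - Suc t); a = src (2 ^ m) S i; u = Z a; v = fmul (int (scl m)) (tw m (i - i mod S)) (Z (a + S))
       in (fst u + fst v, snd u + snd v))"
    and fit: "\<And>i e. i < 2 ^ m \<Longrightarrow> e \<le> 2 ^ m \<Longrightarrow> fits m (tw m e) (Z i)"
    and s: "agree 22 E s" "holds (snd s) 0 Z (2 ^ m)" "holds (snd s) 4 (tw m) (2 ^ m)"
  shows "runs w (For 22 5 fft_body) s (2 ^ m * 191 + 6)
    (\<lambda>s'. agree 22 E s' \<and> frame {2, 3} (snd s') (snd s) \<and> holds (snd s') 2 Z' (2 ^ m))"
proof -
  define I where "I = (\<lambda>i s'. agree 22 E s' \<and> frame {2, 3} (snd s') (snd s) \<and> holds (snd s') 2 Z' i)"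
  have "runs w (For 22 5 fft_body) s (2 ^ m * (183 + 8) + 6) (I (2 ^ m))"
  proof (rule runs_For)
    show "I 0 s" using s by (simp add: I_def holds_def)
    show "I j ((fst s')(22 := v), snd s')" if "I j s'" for j s' v using that by (simp add: I_def)
    show "fst s' 5 = 2 ^ m" if "I j s'" for j s' using that env by (simp add: I_def env_def agree_def)
    fix i s' assume i: "i < 2 ^ m" and I: "I i s'" and x: "fst s' 22 = i"
    define S :: nat where "S = 2 ^ (m - Suc t)"
    define a where "a = src (2 ^ m) S i"
    have aS: "a + S < 2 ^ m" unfolding a_def S_def by (rule src_less(1) [OF env(3) i])
    then have a: "a < 2 ^ m" by simp
    define k where "k = i - i mod S"
    have k: "k < 2 ^ m" using i by (simp add: k_def)
    have ag: "agree 22 E s'" and fr: "frame {2, 3} (snd s') (snd s)" and h: "holds (snd s') 2 Z' i"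
      using I by (auto simp: I_def)
    have regs: "fst s' 5 = 2 ^ m" "fst s' 6 = scl m" "fst s' 7 = 2 ^ (20 * m)" "fst s' 8 = 2 ^ (12 * m)"
      "fst s' 9 = base" "fst s' 21 = S"
      using ag env by (simp_all add: agree_def env_def S_def)
    have idx: "sem w fft_indices s' = ((fst s')(23 := i mod S, 24 := k, 25 := a, 26 := a + S), snd s')"
    proof -
      have "2 * k < 2 ^ w" using k small_powers by linarith
      moreover have "i < 2 ^ w" using i small_powers by linarith
      moreover have "a = 2 * k mod 2 ^ m + i mod S" by (simp add: a_def src_def k_def)
      moreover have "a + S < 2 ^ w" "a < 2 ^ w" using aS small_powers by linarith+
      moreover have "k = nat ((int i - int (i mod S)) mod 2 ^ w)"
        unfolding k_def using \<open>i < 2 ^ w\<close> by (intro sub_val [symmetric]) auto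
      moreover have "(2::nat) < 2 ^ w" using small_powers by linarith
      ultimately show ?thesis using regs x by (simp add: fft_indices_def)
    qed
    define s1 where "s1 = ((fst s')(23 := i mod S, 24 := k, 25 := a, 26 := a + S), snd s')"
    have r1: "fst s1 6 = scl m" "fst s1 7 = 2 ^ (20 * m)" "fst s1 8 = 2 ^ (12 * m)"
      "fst s1 9 = base" "fst s1 22 = i" "fst s1 24 = k" "fst s1 25 = a" "fst s1 26 = a + S"
      using regs x by (simp_all add: s1_def)
    have Zv: "snd s1 (adr 0 j) = enc w (fst (Z j))" "snd s1 (adr 1 j) = enc w (snd (Z j))" if "j < 2 ^ m" for j
      using that s(2) frame_adr [OF fr, of 0 j] frame_adr [OF fr, of 1 j] by (simp_all add: s1_def holds_def)
    have Wv: "snd s1 (adr 4 j) = enc w (fst (tw m j))" "snd s1 (adr 5 j) = enc w (snd (tw m j))" if "j < 2 ^ m" for j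
      using that s(3) frame_adr [OF fr, of 4 j] frame_adr [OF fr, of 5 j] by (simp_all add: s1_def holds_def)
    have fits: "fits m (tw m k) (Z (a + S))" using fit [OF aS, of k] k by simp
    have Z'i: "Z' i = (fst (Z a) + fst (fmul (int (scl m)) (tw m k) (Z (a + S))), snd (Z a) + snd (fmul (int (scl m)) (tw m k) (Z (a + S))))"
      by (simp add: Z Let_def a_def S_def k_def)
    define M where "M = (snd s1)(adr 2 i := enc w (fst (Z' i)))"
    have v1: "wexp_val w (Bin Add (fld 0 25) (mul_re (fld 4 24) (fld 5 24) (fld 0 26) (fld 1 26))) s1 = enc w (fst (Z' i))"
      using mul_val(1) [of s1 "fld 4 24" "tw m k" "fld 5 24" "fld 0 26" "Z (a + S)" "fld 1 26"] r1 Zv Wv a aS k fits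
      by (simp add: enc_add Z'i)
    have v2: "wexp_val w (Bin Add (fld 1 25) (mul_im (fld 4 24) (fld 5 24) (fld 0 26) (fld 1 26))) (fst s1, M) = enc w (snd (Z' i))"
      using mul_val(2) [of "(fst s1, M)" "fld 4 24" "tw m k" "fld 5 24" "fld 0 26" "Z (a + S)" "fld 1 26"] r1 Zv Wv a aS k fits
      by (simp add: enc_add Z'i M_def)
    have sem: "sem w fft_body s' = (fst s1, M(adr 3 i := enc w (snd (Z' i))))"
      using r1 i v1 v2 unfolding fft_body_def sem.simps idx s1_def [symmetric]
      by (simp add: M_def del: wexp_val.simps)
    have "agree 22 E s1" using ag by (simp add: s1_def agree_def)
    then have "agree 22 E (sem w fft_body s')" by (simp add: sem agree_def)
    moreover have "frame {2, 3} (snd (sem w fft_body s')) (snd s)"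
      using fr by (simp add: sem M_def s1_def)
    moreover have "holds (snd (sem w fft_body s')) 2 Z' (Suc i)"
      using h by (auto simp: holds_def sem M_def s1_def less_Suc_eq)
    moreover have "fst (sem w fft_body s') 22 = i" using r1 by (simp add: sem)
    ultimately have post: "I (Suc i) (sem w fft_body s') \<and> fst (sem w fft_body s') 22 = i" by (simp add: I_def)
    show "runs w fft_body s' 183 (\<lambda>s'. I (Suc i) s' \<and> fst s' 22 = i)"
    proof (rule runs_straight)
      show "straight fft_body" "cost fft_body \<le> 183" by (simp_all add: fft_body_def fft_indices_def)
    qed (rule post)
  qed (use small_powers in auto)
  then show ?thesis by (simp add: I_def)
qed

end

definition twiddle_body :: wcom where
  "twiddle_body = Seq (Store (fld_addr 4 22) (Reg 23)) (Seq (Store (fld_addr 5 22) (Reg 24))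
    (Seq (Assign 25 (mul_re (Reg 23) (Reg 24) (Reg 14) (Reg 15)))
    (Seq (Assign 24 (mul_im (Reg 23) (Reg 24) (Reg 14) (Reg 15))) (Assign 23 (Reg 25)))))"

definition twiddle_prog :: wcom where
  "twiddle_prog = Seq (Seq (Assign 23 (Reg 6)) (Assign 24 (Const 0))) (For 22 5 twiddle_body)"

context transform
begin

lemma env_agree:
  assumes "env E" "agree k E s" "10 \<le> k"
  shows "fst s 5 = 2 ^ m" "fst s 6 = scl m" "fst s 7 = 2 ^ (20 * m)" "fst s 8 = 2 ^ (12 * m)" "fst s 9 = base"
  using assms by (simp_all add: env_def agree_def)

lemma copy_runs:
  assumes env: "env E" and s: "agree 22 E s" "holds (snd s) 2 Z (2 ^ m)"
  shows "runs w (For 22 5 copy_body) s (2 ^ m * 40 + 6)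
    (\<lambda>s'. agree 22 E s' \<and> frame {0, 1} (snd s') (snd s) \<and> holds (snd s') 0 Z (2 ^ m))"
proof -
  define I where "I = (\<lambda>i s'. agree 22 E s' \<and> frame {0, 1} (snd s') (snd s) \<and> holds (snd s') 0 Z i)"
  have "runs w (For 22 5 copy_body) s (2 ^ m * (32 + 8) + 6) (I (2 ^ m))"
  proof (rule runs_For)
    show "I 0 s" using s by (simp add: I_def holds_def)
    show "I j ((fst s')(22 := v), snd s')" if "I j s'" for j s' v using that by (simp add: I_def)
    show "fst s' 5 = 2 ^ m" if "I j s'" for j s' using that env_agree(1) [OF env, of 22 s'] by (simp add: I_def)
    fix i s' assume i: "i < 2 ^ m" and I: "I i s'" and x: "fst s' 22 = i"
    have ag: "agree 22 E s'" and fr: "frame {0, 1} (snd s') (snd s)" and h: "holds (snd s') 0 Z i"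
      using I by (auto simp: I_def)
    have b: "fst s' 9 = base" using env_agree(5) [OF env ag] by simp
    have v: "snd s' (adr 2 i) = enc w (fst (Z i))" "snd s' (adr 3 i) = enc w (snd (Z i))"
      using s(2) i frame_adr [OF fr, of 2 i] frame_adr [OF fr, of 3 i] by (simp_all add: holds_def)
    have sem: "sem w copy_body s' = (fst s', (snd s')(adr 0 i := enc w (fst (Z i)), adr 1 i := enc w (snd (Z i))))"
      using b x i v by (simp add: copy_body_def)
    have post: "I (Suc i) (sem w copy_body s') \<and> fst (sem w copy_body s') 22 = i"
      using ag fr h x by (auto simp: I_def sem holds_def less_Suc_eq agree_def)
    show "runs w copy_body s' 32 (\<lambda>s'. I (Suc i) s' \<and> fst s' 22 = i)"
    proof (rule runs_straight)
      show "straight copy_body" "cost copy_body \<le> 32" by (simp_all add: copy_body_def)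
    qed (rule post)
  qed (use small_powers in auto)
  then show ?thesis by (simp add: I_def)
qed

text \<open>\<open>fit\<close>, the absence of overflow, is kept as a hypothesis because the two
  transforms of a convolution meet it by different bounds, \<open>spectrum_fits\<close> and
  \<open>counts_fits\<close>.\<close>

lemma fft_runs:
  assumes env: "env E"
    and fit: "\<And>t i e. t < m \<Longrightarrow> i < 2 ^ m \<Longrightarrow> e \<le> 2 ^ m \<Longrightarrow> fits m (tw m e) (int_fft (int (scl m)) (tw m) m x t i)"
    and s: "agree 21 E s" "holds (snd s) 0 x (2 ^ m)" "holds (snd s) 4 (tw m) (2 ^ m)"
  shows "runs w fft_prog s (m * (2 ^ m * 231 + 20) + 6)
    (\<lambda>s'. agree 21 E s' \<and> frame {0, 1, 2, 3} (snd s') (snd s) \<and>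
       holds (snd s') 0 (int_fft (int (scl m)) (tw m) m x m) (2 ^ m))"
proof -
  let ?Z = "int_fft (int (scl m)) (tw m) m x"
  define I where "I = (\<lambda>t s'. agree 21 E s' \<and> fst s' 21 = 2 ^ (m - t) \<and> frame {0, 1, 2, 3} (snd s') (snd s) \<and>
    holds (snd s') 0 (?Z t) (2 ^ m))"
  have w: "1 mod 2 ^ w = (1::nat)" "2 mod 2 ^ w = (2::nat)" using small_powers by auto
  let ?g = "Bin Less (Const 1) (Reg 21)"
  let ?c = "Seq (Assign 21 (Bin Div (Reg 21) (Const 2))) (Seq (For 22 5 fft_body) (For 22 5 copy_body))"
  let ?T = "4 + ((2 ^ m * 191 + 6) + (2 ^ m * 40 + 6))"
  let ?s = "sem w (Assign 21 (Reg 5)) s"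
  have loop: "runs w (While ?g ?c) ?s (m * (1 + wexp_cost ?g + ?T) + (1 + wexp_cost ?g)) (I m)"
  proof (rule runs_While)
    show "I 0 ?s" using s env_agree(1) [OF env s(1)] by (simp add: I_def)
    show "wexp_val w ?g s' \<noteq> 0" if "t < m" "I t s'" for t s'
    proof -
      have "(1::nat) < 2 ^ (m - t)" using that by (intro one_less_power) auto
      then show ?thesis using that w by (simp add: I_def)
    qed
    show "wexp_val w ?g s' = 0" if "I m s'" for s' using that w by (simp add: I_def)
    fix t s' assume t: "t < m" and I: "I t s'"
    define S :: nat where "S = 2 ^ (m - Suc t)"
    have "m - t = Suc (m - Suc t)" using t by simp
    then have half: "2 ^ (m - t) div 2 = S" by (simp add: S_def)
    \<comment> \<open>The width in register 21 is constant within a stage only, so each stage has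
      its own environment.\<close>
    define E' where "E' = E(21 := S)"
    have env': "env E'" using env by (simp add: env_def E'_def)
    define s1 where "s1 = sem w (Assign 21 (Bin Div (Reg 21) (Const 2))) s'"
    have s1: "agree 22 E' s1" "snd s1 = snd s'"
      using I w half by (auto simp: I_def s1_def agree_def E'_def less_Suc_eq numeral_eq_Suc)
    have fr: "frame {0, 1, 2, 3} (snd s') (snd s)" using I by (simp add: I_def)
    have h: "holds (snd s1) 0 (?Z t) (2 ^ m)" using I s1 by (simp add: I_def)
    have h4: "holds (snd s1) 4 (tw m) (2 ^ m)" unfolding s1(2) by (rule holds_frame [OF s(3) fr]) auto
    have E21: "E' 21 = 2 ^ (m - Suc t)" by (simp add: E'_def S_def)
    note inner = fft_inner [OF env' E21 t int_fft.simps(2) fit [OF t] s1(1) h h4]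
    have A: "runs w (Seq (For 22 5 fft_body) (For 22 5 copy_body)) s1 ((2 ^ m * 191 + 6) + (2 ^ m * 40 + 6)) (I (Suc t))"
    proof (rule runs_Seq [OF inner])
      fix s2 assume s2: "agree 22 E' s2 \<and> frame {2, 3} (snd s2) (snd s1) \<and> holds (snd s2) 2 (?Z (Suc t)) (2 ^ m)"
      show "runs w (For 22 5 copy_body) s2 (2 ^ m * 40 + 6) (I (Suc t))"
      proof (rule runs_mono [OF copy_runs [OF env', where Z = "?Z (Suc t)"]])
        fix s3 assume s3: "agree 22 E' s3 \<and> frame {0, 1} (snd s3) (snd s2) \<and> holds (snd s3) 0 (?Z (Suc t)) (2 ^ m)"
        have "frame {0, 1, 2, 3} (snd s3) (snd s2)" by (rule frame_mono [of "{0, 1}"]) (use s3 in auto)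
        moreover have "frame {0, 1, 2, 3} (snd s2) (snd s')" by (rule frame_mono [of "{2, 3}"]) (use s2 s1 in auto)
        ultimately have "frame {0, 1, 2, 3} (snd s3) (snd s)" using fr frame_trans by blast
        moreover have "agree 21 E s3" "fst s3 21 = S" using s3 by (simp_all add: agree_def E'_def)
        ultimately show "I (Suc t) s3" using s3 by (simp add: I_def S_def)
      qed (use s2 in auto)
    qed
    have 1: "runs w (Assign 21 (Bin Div (Reg 21) (Const 2))) s' 4 (\<lambda>s''. s'' = s1)"
      by (rule runs_straight) (simp_all add: s1_def)
    show "runs w ?c s' ?T (I (Suc t))"
      by (rule runs_Seq [OF 1]) (simp only: A)
  qed
  have 1: "runs w (Assign 21 (Reg 5)) s 2 (\<lambda>s''. s'' = ?s)" by (rule runs_straight) simp_all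
  have "runs w fft_prog s (2 + (m * (1 + wexp_cost ?g + ?T) + (1 + wexp_cost ?g))) (I m)"
    unfolding fft_prog_def by (rule runs_Seq [OF 1]) (simp only: loop)
  then show ?thesis by (rule runs_mono) (auto simp: I_def algebra_simps)
qed

lemma square_runs:
  assumes env: "env E" and fit: "\<And>i. i < 2 ^ m \<Longrightarrow> fits m (Z i) (Z i)"
    and s: "agree 22 E s" "holds (snd s) 0 Z (2 ^ m)"
  shows "runs w (For 22 5 square_body) s (2 ^ m * 108 + 6)
    (\<lambda>s'. agree 22 E s' \<and> frame {0, 1} (snd s') (snd s) \<and>
      holds (snd s') 0 (\<lambda>i. fmul (int (scl m)) (Z i) (Z i)) (2 ^ m))"
proof -
  define sq where "sq = (\<lambda>i. fmul (int (scl m)) (Z i) (Z i))"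
  define I where "I = (\<lambda>i s'. agree 22 E s' \<and> frame {0, 1} (snd s') (snd s) \<and>
    holds (snd s') 0 (\<lambda>j. if j < i then sq j else Z j) (2 ^ m))"
  have "runs w (For 22 5 square_body) s (2 ^ m * (100 + 8) + 6) (I (2 ^ m))"
  proof (rule runs_For)
    show "I 0 s" using s by (simp add: I_def)
    show "I j ((fst s')(22 := v), snd s')" if "I j s'" for j s' v using that by (simp add: I_def)
    show "fst s' 5 = 2 ^ m" if "I j s'" for j s' using that env_agree(1) [OF env, of 22 s'] by (simp add: I_def)
    fix i s' assume i: "i < 2 ^ m" and I: "I i s'" and x: "fst s' 22 = i"
    have ag: "agree 22 E s'" and fr: "frame {0, 1} (snd s') (snd s)"
      and h: "holds (snd s') 0 (\<lambda>j. if j < i then sq j else Z j) (2 ^ m)"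
      using I by (auto simp: I_def)
    note r = env_agree [OF env ag]
    have v: "snd s' (adr 0 i) = enc w (fst (Z i))" "snd s' (adr 1 i) = enc w (snd (Z i))"
      using h i by (simp_all add: holds_def)
    define s1 where "s1 = ((fst s')(23 := enc w (fst (sq i))), snd s')"
    have v1: "wexp_val w (mul_re (fld 0 22) (fld 1 22) (fld 0 22) (fld 1 22)) s' = enc w (fst (sq i))"
      unfolding sq_def by (rule mul_val(1)) (use r x i v fit in auto)
    have v2: "wexp_val w (mul_im (fld 0 22) (fld 1 22) (fld 0 22) (fld 1 22)) s1 = enc w (snd (sq i))"
      unfolding sq_def by (rule mul_val(2)) (use r x i v fit in \<open>auto simp: s1_def\<close>)
    have sem: "sem w square_body s' = (fst s1, (snd s')(adr 1 i := enc w (snd (sq i)), adr 0 i := enc w (fst (sq i))))"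
      using r x i v1 v2 by (simp add: square_body_def s1_def)
    have post: "I (Suc i) (sem w square_body s') \<and> fst (sem w square_body s') 22 = i"
      using ag fr h x by (auto simp: I_def sem holds_def less_Suc_eq agree_def s1_def)
    show "runs w square_body s' 100 (\<lambda>s'. I (Suc i) s' \<and> fst s' 22 = i)"
    proof (rule runs_straight)
      show "straight square_body" "cost square_body \<le> 100" by (simp_all add: square_body_def)
    qed (rule post)
  qed (use small_powers in auto)
  then show ?thesis by (rule runs_mono) (auto simp: I_def sq_def holds_def)
qed

lemma scl_less: "scl m < 2 ^ w"
proof -
  have "scl m \<le> 2 ^ (20 * m)" unfolding scl_def by (intro power_increasing) auto
  also have "\<dots> < 2 ^ w" using small_powers(1) zero_less_power [of "2::nat" "20 * m"] by linarith
  finally show ?thesis .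
qed

lemma twiddle_runs:
  assumes env: "env E"
    and root: "E 14 = enc w (fst (root_approx m))" "E 15 = enc w (snd (root_approx m))"
    and s: "agree k E s" "16 \<le> k" "k \<le> 22"
  shows "runs w twiddle_prog s (2 ^ m * 58 + 10)
    (\<lambda>s'. agree k E s' \<and> frame {4, 5} (snd s') (snd s) \<and> holds (snd s') 4 (tw m) (2 ^ m))"
proof -
  define I where "I = (\<lambda>i s'. agree k E s' \<and> frame {4, 5} (snd s') (snd s) \<and> holds (snd s') 4 (tw m) i \<and>
    fst s' 23 = enc w (fst (tw m i)) \<and> fst s' 24 = enc w (snd (tw m i)))"
  let ?s = "sem w (Seq (Assign 23 (Reg 6)) (Assign 24 (Const 0))) s"
  have loop: "runs w (For 22 5 twiddle_body) ?s (2 ^ m * (50 + 8) + 6) (I (2 ^ m))"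
  proof (rule runs_For)
    show "I 0 ?s" using s env_agree(2) [OF env s(1)] enc_nat [OF scl_less]
      by (auto simp: I_def holds_def tw_def enc_0 agree_def)
    show "I j ((fst s')(22 := v), snd s')" if "I j s'" for j s' v using that s by (simp add: I_def)
    show "fst s' 5 = 2 ^ m" if "I j s'" for j s' using that s env_agree(1) [OF env, of k s'] by (simp add: I_def)
    fix i s' assume i: "i < 2 ^ m" and I: "I i s'" and x: "fst s' 22 = i"
    have ag: "agree k E s'" and fr: "frame {4, 5} (snd s') (snd s)" and h: "holds (snd s') 4 (tw m) i"
      and cur: "fst s' 23 = enc w (fst (tw m i))" "fst s' 24 = enc w (snd (tw m i))"
      using I by (auto simp: I_def)
    have r: "fst s' 6 = scl m" "fst s' 7 = 2 ^ (20 * m)" "fst s' 8 = 2 ^ (12 * m)" "fst s' 9 = base"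
      using env_agree [OF env ag] s(2) by simp_all
    have rt: "fst s' 14 = enc w (fst (root_approx m))" "fst s' 15 = enc w (snd (root_approx m))"
      using agreeD [OF ag, of 14] agreeD [OF ag, of 15] s(2) root by simp_all
    have fit: "fits m (tw m i) (root_approx m)" using tw_fits_root [OF m6] i by simp
    have nxt: "tw m (Suc i) = fmul (int (scl m)) (tw m i) (root_approx m)" by (simp add: tw_def)
    define M where "M = (snd s')(adr 4 i := enc w (fst (tw m i)), adr 5 i := enc w (snd (tw m i)))"
    define s1 where "s1 = ((fst s')(25 := enc w (fst (tw m (Suc i)))), M)"
    have v1: "wexp_val w (mul_re (Reg 23) (Reg 24) (Reg 14) (Reg 15)) (fst s', M) = enc w (fst (tw m (Suc i)))"
      unfolding nxt by (rule mul_val(1)) (use r cur rt fit in auto)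
    have v2: "wexp_val w (mul_im (Reg 23) (Reg 24) (Reg 14) (Reg 15)) s1 = enc w (snd (tw m (Suc i)))"
      unfolding nxt by (rule mul_val(2)) (use r cur rt fit in \<open>auto simp: s1_def\<close>)
    have sem: "sem w twiddle_body s' =
        ((fst s1)(24 := enc w (snd (tw m (Suc i))), 23 := enc w (fst (tw m (Suc i)))), M)"
      using r x i v1 v2 cur by (simp add: twiddle_body_def s1_def M_def)
    have post: "I (Suc i) (sem w twiddle_body s') \<and> fst (sem w twiddle_body s') 22 = i"
      using ag fr h x s by (auto simp: I_def sem holds_def less_Suc_eq agree_def s1_def M_def)
    show "runs w twiddle_body s' 50 (\<lambda>s'. I (Suc i) s' \<and> fst s' 22 = i)"
    proof (rule runs_straight)
      show "straight twiddle_body" "cost twiddle_body \<le> 50" by (simp_all add: twiddle_body_def)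
    qed (rule post)
  qed (use small_powers in auto)
  have 1: "runs w (Seq (Assign 23 (Reg 6)) (Assign 24 (Const 0))) s 4 (\<lambda>s''. s'' = ?s)"
    by (rule runs_straight) simp_all
  have "runs w twiddle_prog s (4 + (2 ^ m * (50 + 8) + 6)) (I (2 ^ m))"
    unfolding twiddle_prog_def by (rule runs_Seq [OF 1]) (simp only: loop)
  then show ?thesis by (rule runs_mono) (auto simp: I_def)
qed

end

section \<open>Integer square roots and the root of unity on the machine\<close>

definition isqrt_body :: wcom where
  "isqrt_body = Seq (Assign 25 (Bin Add (Reg 23) (Reg 24)))
    (Seq (Cond (Bin Less (Reg 22) (Bin Mul (Reg 25) (Reg 25))) Skip (Assign 23 (Reg 25)))
      (Assign 24 (Bin Div (Reg 24) (Const 2))))"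

definition isqrt_prog :: wcom where
  "isqrt_prog = Seq (Seq (Assign 23 (Const 0)) (Assign 24 (Reg 6)))
    (While (Bin Less (Const 0) (Reg 24)) isqrt_body)"

text \<open>Register 20 carries the denominator of the current angle
  \<open>2 * pi / 2 ^ (j + 2)\<close>, so comparing it with the transform length stops the halving
  at the right root.\<close>

definition root_body :: wcom where
  "root_body = Seq (Assign 22 (Bin Div (Bin Mul (Reg 6) (Bin Add (Reg 6) (Reg 14))) (Const 2)))
    (Seq isqrt_prog (Seq (Assign 14 (Reg 23)) (Assign 20 (Bin Mul (Const 2) (Reg 20)))))"

definition root_prog :: wcom where
  "root_prog = Seq (Seq (Assign 20 (Const 4)) (Assign 14 (Const 0)))
    (Seq (While (Bin Less (Reg 20) (Reg 5)) root_body)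
    (Seq (Assign 22 (Bin Sub (Bin Mul (Reg 6) (Reg 6)) (Bin Mul (Reg 14) (Reg 14))))
    (Seq isqrt_prog (Assign 15 (Reg 23)))))"

context transform
begin

lemma scl_square: "4 * (scl m * scl m) < 2 ^ w"
proof -
  have "scl m * scl m = 2 ^ (16 * m)" by (simp add: scl_def power_add [symmetric])
  also have "\<dots> \<le> 2 ^ (20 * m)" by (intro power_increasing) auto
  finally show ?thesis using small_powers(1) zero_less_power [of "2::nat" "20 * m"] by linarith
qed

text \<open>The root is found bit by bit from the top. The weights start at \<open>scl m\<close>
  itself because the root can reach that value, which makes \<open>8 * m + 1\<close> rounds. In the
  invariant \<open>u\<close> is twice the weight under trial, so that \<open>u = 1\<close> at the
  end and the remaining interval determines the root.\<close>

lemma isqrt_runs: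
  assumes reg: "fst s 6 = scl m" and x: "fst s 22 = x" "x \<le> scl m * scl m"
  shows "runs w isqrt_prog s ((8 * m + 1) * 20 + 8)
    (\<lambda>s'. agree 22 (fst s) s' \<and> snd s' = snd s \<and> fst s' 23 = floor_sqrt x)"
proof -
  define I where "I = (\<lambda>j s'. agree 23 (fst s) s' \<and> snd s' = snd s \<and>
    (let u = 2 ^ (8 * m + 1 - j) in
      fst s' 24 = u div 2 \<and> (fst s' 23)\<^sup>2 \<le> x \<and> x < (fst s' 23 + u)\<^sup>2))"
  have w: "2 mod 2 ^ w = (2::nat)" using small_powers by auto
  let ?g = "Bin Less (Const 0) (Reg 24)"
  let ?c = "Seq (Assign 23 (Const 0)) (Assign 24 (Reg 6))"
  have loop: "runs w (While ?g isqrt_body) (sem w ?c s)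
      ((8 * m + 1) * (1 + wexp_cost ?g + 16) + (1 + wexp_cost ?g)) (I (8 * m + 1))"
  proof (rule runs_While)
    have "x \<le> (scl m)\<^sup>2" using x(2) by (simp add: power2_eq_square)
    also have "\<dots> < (2 * scl m)\<^sup>2" by (rule power_strict_mono) (simp_all add: scl_def)
    finally show "I 0 (sem w ?c s)" using reg by (simp add: I_def agree_def scl_def)
    fix j s' assume j: "j < 8 * m + 1" and I: "I j s'"
    define t where "t = 8 * m - j"
    define r where "r = fst s' 23"
    have u: "2 ^ (8 * m + 1 - j) = (2 * 2 ^ t :: nat)" using j by (simp add: t_def Suc_diff_le)
    have s': "agree 23 (fst s) s'" "snd s' = snd s" "fst s' 24 = 2 ^ t" "r\<^sup>2 \<le> x" "x < (r + 2 * 2 ^ t)\<^sup>2"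
      using I unfolding I_def Let_def u r_def by simp_all
    have s5: "x < (r + 2 ^ t + 2 ^ t)\<^sup>2" using s'(5) by (simp only: mult_2 add.assoc)
    show "wexp_val w ?g s' \<noteq> 0" using s' by simp
    have r22: "fst s' 22 = x" using s'(1) x(1) by (simp add: agree_def)
    have "r\<^sup>2 \<le> (scl m)\<^sup>2" using s'(4) x(2) by (simp add: power2_eq_square)
    then have "r \<le> scl m" by (rule power2_le_imp_le) simp
    moreover have "2 ^ t \<le> scl m" unfolding scl_def t_def by (intro power_increasing) auto
    ultimately have le: "r + 2 ^ t \<le> 2 * scl m" by simp
    have "(r + 2 ^ t) * (r + 2 ^ t) \<le> (2 * scl m) * (2 * scl m)" by (intro mult_mono le) auto
    then have sq: "(r + 2 ^ t) * (r + 2 ^ t) < 2 ^ w" using scl_square by simp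
    have "0 < r + 2 ^ t" by simp
    then have "r + 2 ^ t \<le> (r + 2 ^ t) * (r + 2 ^ t)" by (simp only: le_square)
    then have lt: "r + 2 ^ t < 2 ^ w" using sq by (rule le_less_trans)
    have j': "8 * m + 1 - Suc j = t" by (simp add: t_def)
    have post: "I (Suc j) (sem w isqrt_body s')"
      unfolding I_def Let_def j'
      using s' s5 r22 sq lt w by (auto simp: isqrt_body_def r_def [symmetric] power2_eq_square [symmetric] agree_def)
    show "runs w isqrt_body s' 16 (I (Suc j))"
    proof (rule runs_straight)
      show "straight isqrt_body" "cost isqrt_body \<le> 16" by (simp_all add: isqrt_body_def)
    qed (rule post)
  next
    show "wexp_val w ?g s' = 0" if "I (8 * m + 1) s'" for s' using that by (simp add: I_def)
  qed
  have 1: "runs w ?c s 4 (\<lambda>s''. s'' = sem w ?c s)"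
    by (rule runs_straight) simp_all
  have "runs w isqrt_prog s (4 + ((8 * m + 1) * (1 + wexp_cost ?g + 16) + (1 + wexp_cost ?g))) (I (8 * m + 1))"
    unfolding isqrt_prog_def by (rule runs_Seq [OF 1]) (simp only: loop)
  then show ?thesis
  proof (rule runs_mono)
    fix s' assume "I (8 * m + 1) s'"
    then show "agree 22 (fst s) s' \<and> snd s' = snd s \<and> fst s' 23 = floor_sqrt x"
      by (auto simp: I_def agree_def intro!: floor_sqrt_unique [symmetric])
  qed simp
qed

text \<open>The cost is quadratic in \<open>m\<close>: there are \<open>m - 2\<close> halvings, each
  with a square root of \<open>8 * m + 1\<close> bits, and one more root for the sine. It is paid
  once and is dominated by a single transform.\<close>

lemma root_runs:
  assumes reg: "fst s 5 = 2 ^ m" "fst s 6 = scl m"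
  shows "runs w root_prog s (m * (m * 160 + 60) + 200)
    (\<lambda>s'. agree 14 (fst s) s' \<and> snd s' = snd s \<and>
      fst s' 14 = enc w (fst (root_approx m)) \<and> fst s' 15 = enc w (snd (root_approx m)))"
proof -
  define I where "I = (\<lambda>j s'. agree 14 (fst s) s' \<and> snd s' = snd s \<and>
    fst s' 20 = 4 * 2 ^ j \<and> fst s' 14 = half_angle_cos (scl m) j)"
  let ?T = "(8 * m + 1) * 20 + 8"
  let ?g = "Bin Less (Reg 20) (Reg 5)"
  let ?c = "Seq (Assign 20 (Const 4)) (Assign 14 (Const 0))"
  have w: "4 mod 2 ^ w = (4::nat)" "2 mod 2 ^ w = (2::nat)" using small_powers by auto
  have sq: "(x::nat) * y < 2 ^ w" if "x \<le> 2 * scl m" "y \<le> 2 * scl m" for x y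
  proof -
    have "x * y \<le> (2 * scl m) * (2 * scl m)" using that by (intro mult_mono) auto
    then show ?thesis using scl_square by simp
  qed
  have m: "4 * 2 ^ (m - 2) = (2::nat) ^ m"
  proof -
    have "2 + (m - 2) = m" using m6 by simp
    then have "(2::nat) ^ m = 2 ^ (2 + (m - 2))" by (simp only:)
    also have "\<dots> = 4 * 2 ^ (m - 2)" by (simp only: power_add) simp
    finally show ?thesis by simp
  qed
  have loop: "runs w (While ?g root_body) (sem w ?c s) ((m - 2) * (1 + wexp_cost ?g + (8 + (?T + 6))) + (1 + wexp_cost ?g)) (I (m - 2))"
  proof (rule runs_While)
    show "I 0 (sem w ?c s)" using w by (simp add: I_def agree_def)
    show "wexp_val w ?g s' = 0" if "I (m - 2) s'" for s'
      using that m reg by (simp add: I_def agree_def)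
    fix j s' assume j: "j < m - 2" and I: "I j s'"
    have lt: "4 * 2 ^ j < (2::nat) ^ m"
      unfolding m [symmetric] using j by simp
    have r: "fst s' 5 = 2 ^ m" "fst s' 6 = scl m" using I reg by (auto simp: I_def agree_def)
    show "wexp_val w ?g s' \<noteq> 0" using I lt r by (simp add: I_def)
    define C where "C = half_angle_cos (scl m) j"
    define x where "x = scl m * (scl m + C) div 2"
    have C: "C \<le> scl m" "fst s' 14 = C" using I by (simp_all add: C_def half_angle_cos_le I_def)
    have "scl m * (scl m + C) \<le> scl m * (scl m + scl m)" using C by (intro mult_le_mono) auto
    then have "scl m * (scl m + C) div 2 \<le> scl m * (scl m + scl m) div 2" by (rule div_le_mono)
    also have "scl m * (scl m + scl m) = scl m * scl m * 2" by (simp only: mult_2_right distrib_left)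
    finally have x: "x \<le> scl m * scl m" by (simp add: x_def)
    define s1 where "s1 = sem w (Assign 22 (Bin Div (Bin Mul (Reg 6) (Bin Add (Reg 6) (Reg 14))) (Const 2))) s'"
    have "scl m + C < 2 ^ w" using C sq [of "scl m + C" 1] by (simp add: scl_def)
    moreover have "scl m * (scl m + C) < 2 ^ w" using C by (intro sq) auto
    ultimately have s1: "s1 = ((fst s')(22 := x), snd s')" using r C w by (simp add: s1_def x_def)
    have 1: "runs w (Assign 22 (Bin Div (Bin Mul (Reg 6) (Bin Add (Reg 6) (Reg 14))) (Const 2))) s' 8 (\<lambda>s''. s'' = s1)"
      by (rule runs_straight) (simp_all add: s1_def)
    have 2: "runs w isqrt_prog s1 ?T (\<lambda>s''. agree 22 (fst s1) s'' \<and> snd s'' = snd s1 \<and> fst s'' 23 = floor_sqrt x)"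
      using r x by (intro isqrt_runs) (simp_all add: s1)
    have 3: "runs w (Seq (Assign 14 (Reg 23)) (Assign 20 (Bin Mul (Const 2) (Reg 20)))) s2 6 (I (Suc j))"
      if s2: "agree 22 (fst s1) s2 \<and> snd s2 = snd s1 \<and> fst s2 23 = floor_sqrt x" for s2
    proof (rule runs_straight)
      have "fst s2 20 = 4 * 2 ^ j" using s2 I by (simp add: agree_def s1 I_def)
      moreover have "2 * (4 * 2 ^ j) < (2::nat) ^ w" using lt small_powers by linarith
      ultimately show "I (Suc j) (sem w (Seq (Assign 14 (Reg 23)) (Assign 20 (Bin Mul (Const 2) (Reg 20)))) s2)"
        using s2 I w by (auto simp: I_def agree_def s1 x_def C_def)
    qed simp_all
    have 23: "runs w (Seq isqrt_prog (Seq (Assign 14 (Reg 23)) (Assign 20 (Bin Mul (Const 2) (Reg 20))))) s1 (?T + 6) (I (Suc j))"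
      by (rule runs_Seq [OF 2 3])
    show "runs w root_body s' (8 + (?T + 6)) (I (Suc j))"
      unfolding root_body_def by (rule runs_Seq [OF 1]) (simp only: 23)
  qed
  let ?Q = "\<lambda>s'. agree 14 (fst s) s' \<and> snd s' = snd s \<and>
      fst s' 14 = enc w (fst (root_approx m)) \<and> fst s' 15 = enc w (snd (root_approx m))"
  let ?a = "Assign 22 (Bin Sub (Bin Mul (Reg 6) (Reg 6)) (Bin Mul (Reg 14) (Reg 14)))"
  have rest: "runs w (Seq ?a (Seq isqrt_prog (Assign 15 (Reg 23)))) s' (8 + (?T + 2)) ?Q"
    if I: "I (m - 2) s'" for s'
  proof -
    define C where "C = half_angle_cos (scl m) (m - 2)"
    have C: "C \<le> scl m" "fst s' 14 = C" using I by (simp_all add: C_def half_angle_cos_le I_def)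
    have r: "fst s' 6 = scl m" using I reg by (auto simp: I_def agree_def)
    have I': "agree 14 (fst s) s'" "snd s' = snd s" using I by (auto simp: I_def)
    define x where "x = scl m * scl m - C * C"
    have "C * C \<le> scl m * scl m" using C by (intro mult_le_mono)
    moreover have "scl m * scl m < 2 ^ w" "C * C < 2 ^ w" using C by (auto intro: sq)
    ultimately have s1: "sem w ?a s' = ((fst s')(22 := x), snd s')"
      using C r sub_val [of "C * C" "scl m * scl m" w] by (simp add: x_def)
    have 1: "runs w ?a s' 8 (\<lambda>s''. s'' = sem w ?a s')" by (rule runs_straight) simp_all
    have 2: "runs w isqrt_prog (sem w ?a s') ?T (\<lambda>s''. agree 22 (fst (sem w ?a s')) s'' \<and>
        snd s'' = snd (sem w ?a s') \<and> fst s'' 23 = floor_sqrt x)"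
      unfolding s1 using r by (intro isqrt_runs) (simp_all add: x_def)
    have "floor_sqrt x \<le> floor_sqrt ((scl m)\<^sup>2)"
      by (rule mono_floor_sqrt') (simp add: x_def power2_eq_square)
    then have sn: "floor_sqrt x \<le> scl m" by simp
    have root: "root_approx m = (int C, int (floor_sqrt x))"
      by (simp add: root_approx_def C_def half_angle_sin_def x_def)
    have enc: "enc w (int C) = C" "enc w (int (floor_sqrt x)) = floor_sqrt x"
      using C sn scl_less by (auto intro!: enc_nat)
    have 3: "runs w (Assign 15 (Reg 23)) s2 2 ?Q"
      if s2: "agree 22 (fst (sem w ?a s')) s2 \<and> snd s2 = snd (sem w ?a s') \<and> fst s2 23 = floor_sqrt x" for s2
    proof (rule runs_straight)
      show "?Q (sem w (Assign 15 (Reg 23)) s2)"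
        using s2 I' C(2) unfolding s1 root by (auto simp: agree_def enc)
    qed simp_all
    have 23: "runs w (Seq isqrt_prog (Assign 15 (Reg 23))) (sem w ?a s') (?T + 2) ?Q"
      by (rule runs_Seq [OF 2 3])
    show ?thesis by (rule runs_Seq [OF 1]) (simp only: 23)
  qed
  have 1: "runs w ?c s 4 (\<lambda>s''. s'' = sem w ?c s)" by (rule runs_straight) simp_all
  have "runs w root_prog s (4 + (((m - 2) * (1 + wexp_cost ?g + (8 + (?T + 6))) + (1 + wexp_cost ?g)) + (8 + (?T + 2)))) ?Q"
    unfolding root_prog_def by (rule runs_Seq [OF 1]) (simp only: runs_Seq [OF loop rest])
  then show ?thesis
  proof (rule runs_mono)
    have "m = m - 2 + 2" using m6 by simp
    then obtain k where "m = k + 2" by blast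
    then show "4 + (((m - 2) * (1 + wexp_cost ?g + (8 + (?T + 6))) + (1 + wexp_cost ?g)) + (8 + (?T + 2))) \<le> m * (m * 160 + 60) + 200"
      by (simp add: algebra_simps)
  qed
qed

end

section \<open>Scaling\<close>

definition rnd :: "nat \<Rightarrow> nat \<Rightarrow> nat" where
  "rnd s v = (v + s - 1) div s"

lemma rnd_bounds:
  assumes "s > 0"
  shows "v \<le> s * rnd s v" "s * rnd s v \<le> v + s - 1"
proof -
  have "v + s - 1 < s * Suc (rnd s v)"
    unfolding rnd_def using assms by (metis dividend_less_div_times mult.commute mult_Suc_right add.commute)
  then show "v \<le> s * rnd s v" by simp
  show "s * rnd s v \<le> v + s - 1" unfolding rnd_def by (rule times_div_less_eq_dividend)
qed

lemma rnd_1 [simp]: "rnd (Suc 0) v = v"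
  by (simp add: rnd_def)

lemma rnd_pos: "s > 0 \<Longrightarrow> v > 0 \<Longrightarrow> rnd s v > 0"
  using rnd_bounds(1) [of s v] by (cases "rnd s v") auto

lemma rnd_le:
  assumes "s > 0" "v \<le> s * c"
  shows "rnd s v \<le> c"
proof -
  have "s * rnd s v < s * Suc c" using rnd_bounds(2) [of s v] assms by simp
  then have "rnd s v < Suc c" by (simp only: mult_less_cancel1)
  then show ?thesis by simp
qed

text \<open>The last assumption is the bound on the word size in integer form. With
  \<open>S = n + W + q\<close> the transform length is at most \<open>S ^ 6\<close>, so the
  \<open>22 * m\<close> bits of \<open>transform\<close> call for \<open>S ^ 132\<close>; 140 leaves
  some slack.\<close>

locale conv_input =
  fixes n p q W w :: nat and A B :: "nat \<Rightarrow> nat"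
  assumes n: "1 \<le> n" and p: "0 < p" "p < q"
    and A: "bounded_positive_seq n W A" and B: "bounded_positive_seq n W B"
    and size: "(n + W + q) ^ 140 \<le> 2 ^ w"
begin

text \<open>\<open>L - 4\<close> is the least multiple of 4 exceeding \<open>4 * q / p\<close>, so
  that \<open>4 / (L - 4) \<le> p / q\<close>; this ratio bounds the relative rounding error in
  \<open>rounding_error\<close>.\<close>

definition L :: nat where "L = 4 * (q div p + 2)"

definition D :: nat where "D = 2 * L + 1"

text \<open>The factor 2 keeps sums of two marked positions below \<open>2 ^ m\<close>, where cyclic
  and ordinary convolution agree; minimality bounds the transform length by a constant times
  \<open>n * D\<close>.\<close>

definition m :: nat where "m = (LEAST m. 2 * (n * D) \<le> 2 ^ m)"

lemma L_bounds: "12 \<le> L" "4 * q \<le> p * (L - 4)" "p * L \<le> 12 * q"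
proof -
  have "1 \<le> q div p" using p div_le_mono [of p q p] by simp
  then show "12 \<le> L" by (simp add: L_def)
  have "q < p * (q div p + 1)" using p by (metis Suc_eq_plus1 dividend_less_div_times mult.commute mult_Suc)
  then show "4 * q \<le> p * (L - 4)" by (simp add: L_def algebra_simps)
  have "p * (q div p) \<le> q" by simp
  moreover have "p * L = 4 * (p * (q div p)) + 8 * p" by (simp add: L_def algebra_simps)
  ultimately show "p * L \<le> 12 * q" using p by linarith
qed

lemma m_upper: "2 * (n * D) \<le> 2 ^ m"
  unfolding m_def by (rule LeastI [of _ "2 * (n * D)"]) simp

lemma m_minimal: "j < m \<Longrightarrow> 2 ^ j < 2 * (n * D)"
  using not_less_Least [of j "\<lambda>m. 2 * (n * D) \<le> 2 ^ m"] by (simp add: m_def)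

lemma D_ge: "25 \<le> D" "D \<le> n * D"
  using L_bounds mult_le_mono1 [OF n, of D] by (simp_all add: D_def)

lemma m_ge: "6 \<le> m"
proof -
  have "32 < (2::nat) ^ m" using m_upper D_ge by linarith
  then have "(2::nat) ^ 5 < 2 ^ m" by simp
  then have "5 < m" by (rule power_less_imp_less_exp [rotated]) simp
  then show ?thesis by simp
qed

lemma m_lower: "2 ^ m \<le> 4 * (n * D)"
proof -
  have "2 ^ m = 2 * (2::nat) ^ (m - 1)" using m_ge by (metis One_nat_def Suc_le_D Suc_le_eq diff_Suc_1 numeral_eq_Suc power_Suc zero_less_Suc le_trans)
  then show ?thesis using m_minimal [of "m - 1"] m_ge by simp
qed

lemma W_ge: "1 \<le> W"
  using A n by (auto simp: bounded_positive_seq_def intro: le_trans)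

lemma big: "64 * (2 ^ m * (W + 2)) \<le> 2 ^ w" "22 * m \<le> w" "3 * n + 8 * 2 ^ m + 8 \<le> 2 ^ w"
proof -
  define S where "S = n + W + q"
  have S: "4 \<le> S" "n \<le> S" "q \<le> S" "W + 2 \<le> S" using n p W_ge by (auto simp: S_def)
  have mono: "S ^ i \<le> S ^ j" if "i \<le> j" for i j using that S(1) by (intro power_increasing) auto
  have "q div p \<le> q" by simp
  moreover have "D = 8 * (q div p) + 17" by (simp add: D_def L_def)
  \<comment> \<open>\<open>0 < p < q\<close> gives \<open>q \<ge> 2\<close>, hence
    \<open>8 * q + 17 \<le> 17 * q\<close>.\<close>
  ultimately have "D \<le> 17 * q" using p by linarith
  then have "4 * (n * D) \<le> 4 * (S * (17 * S))" using S by (intro mult_le_mono) auto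
  also have "\<dots> = 68 * S ^ 2" by (simp add: power2_eq_square)
  also have "\<dots> \<le> S ^ 4 * S ^ 2"
    using power_mono [OF S(1), of 4] by (intro mult_right_mono) auto
  also have "\<dots> = S ^ 6" by (simp add: power_add [symmetric])
  finally have m6: "2 ^ m \<le> S ^ 6" using m_lower by simp
  have c64: "64 \<le> S ^ 3" using power_mono [OF S(1), of 3] by simp
  have s: "S ^ 140 \<le> 2 ^ w" using size by (simp add: S_def)
  have "64 * (2 ^ m * (W + 2)) \<le> S ^ 3 * (S ^ 6 * S)"
    using c64 m6 S by (intro mult_le_mono)
  also have "\<dots> = S ^ 10" by (simp add: eval_nat_numeral)
  also have "\<dots> \<le> 2 ^ w" using mono [of 10 140] s by simp
  finally show 1: "64 * (2 ^ m * (W + 2)) \<le> 2 ^ w" .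
  have "(2::nat) ^ (22 * m) = (2 ^ m) ^ 22" by (simp add: power_mult [symmetric] mult.commute)
  also have "\<dots> \<le> (S ^ 6) ^ 22" by (rule power_mono [OF m6]) simp
  also have "\<dots> \<le> 2 ^ w" using mono [of 132 140] s by (simp add: power_mult [symmetric])
  finally show "22 * m \<le> w" by (rule power_le_imp_le_exp [rotated]) simp
  have "D \<le> n * D" "25 \<le> D" using D_ge by auto
  then have "n \<le> n * D" using n by simp
  then have "n \<le> 2 ^ m" "8 \<le> (2::nat) ^ m" using m_upper \<open>25 \<le> D\<close> \<open>D \<le> n * D\<close> by linarith+
  then have "3 * n + 8 * 2 ^ m + 8 \<le> 12 * 2 ^ m" by simp
  also have "\<dots> \<le> 64 * (2 ^ m * (W + 2))" by simp
  finally show "3 * n + 8 * 2 ^ m + 8 \<le> 2 ^ w" using 1 by simp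
qed

sublocale transform w m "3 * n"
  using m_ge big(2,3) by unfold_locales

section \<open>Coding pairs of entries as sums of marked positions\<close>

text \<open>The prefix length \<open>k\<close> is a parameter so that the state in the middle of the
  marking loop is an instance.\<close>

definition marked :: "nat \<Rightarrow> (nat \<Rightarrow> nat) \<Rightarrow> nat \<Rightarrow> nat \<Rightarrow> bool" where
  "marked l X k u \<longleftrightarrow> (\<exists>i<k. rnd (2 ^ l) (X i) \<le> L \<and> u = i * D + rnd (2 ^ l) (X i))"

definition hit :: "nat \<Rightarrow> nat \<Rightarrow> bool" where
  "hit l j \<longleftrightarrow> (\<exists>u v. marked l A n u \<and> marked l B n v \<and> u + v = j)"

definition accepted :: "nat \<Rightarrow> nat \<Rightarrow> nat \<Rightarrow> bool" where
  "accepted l k d \<longleftrightarrow> hit l (k * D + d) \<and> (l = 0 \<or> L < 2 * d)"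

definition cand :: "nat \<Rightarrow> nat \<Rightarrow> nat set" where
  "cand l k = {2 ^ l * d | d. d < D \<and> accepted l k d}"

lemma marked_less: "marked l X n u \<Longrightarrow> u + L < n * D"
proof -
  assume "marked l X n u"
  then obtain i where i: "i < n" "rnd (2 ^ l) (X i) \<le> L" "u = i * D + rnd (2 ^ l) (X i)"
    by (auto simp: marked_def)
  have "(i + 1) * D \<le> n * D" using i by (intro mult_right_mono) auto
  then show ?thesis using i by (simp add: D_def algebra_simps)
qed

text \<open>A sum of two kept entries is at most \<open>2 * L < D\<close>, so adding two codes never
  carries into the index digit, and quotient and remainder by \<open>D\<close> recover both
  sums.\<close>

lemma hit_decode:
  assumes "hit l (k * D + d)" "d < D"
  obtains i where "i \<le> k" "i < n" "k - i < n" "d = rnd (2 ^ l) (A i) + rnd (2 ^ l) (B (k - i))"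
proof -
  obtain i j where i: "i < n" "rnd (2 ^ l) (A i) \<le> L" and j: "j < n" "rnd (2 ^ l) (B j) \<le> L"
    and eq: "(i * D + rnd (2 ^ l) (A i)) + (j * D + rnd (2 ^ l) (B j)) = k * D + d"
    using assms by (auto simp: hit_def marked_def)
  define r where "r = rnd (2 ^ l) (A i) + rnd (2 ^ l) (B j)"
  have "r < D" using i j by (simp add: r_def D_def)
  have eq': "(i + j) * D + r = k * D + d" using eq by (simp add: r_def algebra_simps)
  have "((i + j) * D + r) div D = i + j" "((i + j) * D + r) mod D = r" using \<open>r < D\<close> by simp_all
  moreover have "(k * D + d) div D = k" "(k * D + d) mod D = d" using assms(2) by simp_all
  ultimately have "i + j = k" "r = d" using eq' by simp_all
  then show ?thesis using that [of i] i j by (auto simp: r_def)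
qed

lemma hit_encode:
  assumes "i \<le> k" "k < n" "rnd (2 ^ l) (A i) \<le> L" "rnd (2 ^ l) (B (k - i)) \<le> L"
  shows "hit l (k * D + (rnd (2 ^ l) (A i) + rnd (2 ^ l) (B (k - i))))"
proof -
  have "marked l A n (i * D + rnd (2 ^ l) (A i))"
    unfolding marked_def using assms by (intro exI [of _ i]) auto
  moreover have "marked l B n ((k - i) * D + rnd (2 ^ l) (B (k - i)))"
    unfolding marked_def using assms by (intro exI [of _ "k - i"]) auto
  moreover have "k * D = i * D + (k - i) * D"
    using assms(1) by (simp flip: distrib_right)
  then have "i * D + rnd (2 ^ l) (A i) + ((k - i) * D + rnd (2 ^ l) (B (k - i))) =
      k * D + (rnd (2 ^ l) (A i) + rnd (2 ^ l) (B (k - i)))" by linarith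
  ultimately show ?thesis unfolding hit_def by blast
qed

lemma positive: "i < n \<Longrightarrow> 0 < A i \<and> A i \<le> W" "i < n \<Longrightarrow> 0 < B i \<and> B i \<le> W"
  using A B by (auto simp: bounded_positive_seq_def Suc_le_eq)

text \<open>Positive entries stay positive under rounding up. Hence 0 is never a candidate and can
  mark a result cell that is still empty.\<close>

lemma accepted_pos: "accepted l k d \<Longrightarrow> d < D \<Longrightarrow> 0 < d"
proof -
  assume "accepted l k d" "d < D"
  then obtain i where "i < n" "d = rnd (2 ^ l) (A i) + rnd (2 ^ l) (B (k - i))"
    by (meson accepted_def hit_decode)
  then show "0 < d" using rnd_pos [of "2 ^ l" "A i"] positive(1) [of i] by simp
qed

text \<open>Rounding up two entries costs less than \<open>2 * s\<close>, and the second assumption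
  says that their sum \<open>P\<close> is at least \<open>s * (L - 4) / 2\<close>; the choice of
  \<open>L\<close> makes the quotient of the two at most \<open>p / q\<close>.\<close>

lemma rounding_error:
  assumes "p / q \<le> \<epsilon>" "s * L \<le> 2 * P + 4 * s"
  shows "real (2 * s) \<le> \<epsilon> * real P"
proof -
  have "s * (L - 4) \<le> 2 * P" using assms(2) by (simp add: diff_mult_distrib2)
  then have "p * (s * (L - 4)) \<le> p * (2 * P)" by (rule mult_le_mono2)
  moreover have "s * (4 * q) \<le> s * (p * (L - 4))" using L_bounds(2) by (rule mult_le_mono2)
  ultimately have "s * (4 * q) \<le> p * (2 * P)" by (simp only: mult_ac)
  then have "2 * s * q \<le> p * P" by (simp add: mult_ac)
  then have "real (2 * s * q) \<le> real (p * P)" by (simp only: of_nat_le_iff)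
  then have "real (2 * s) \<le> real p / real q * real P" using p by (simp add: field_simps)
  also have "\<dots> \<le> \<epsilon> * real P" using assms(1) by (intro mult_right_mono) auto
  finally show ?thesis .
qed

text \<open>Rounding up never goes below the true sum, which gives the lower bound. For the upper
  one, \<open>2 * d > L\<close> means \<open>s * L < 2 * v\<close>, and \<open>v\<close> exceeds the
  true sum by at most \<open>2 * s - 2\<close>.\<close>

lemma cand_sound:
  assumes "p / q \<le> \<epsilon>" "v \<in> cand l k"
  shows "\<exists>i\<le>k. A i + B (k - i) \<le> v \<and> real v \<le> (1 + \<epsilon>) * real (A i + B (k - i))"
proof -
  obtain d where d: "v = 2 ^ l * d" "d < D" "hit l (k * D + d)" "l = 0 \<or> L < 2 * d"
    using assms(2) by (auto simp: cand_def accepted_def)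
  obtain i where i: "i \<le> k" "i < n" "k - i < n" "d = rnd (2 ^ l) (A i) + rnd (2 ^ l) (B (k - i))"
    using hit_decode [OF d(3,2)] .
  define s :: nat where "s = 2 ^ l"
  have "s > 0" by (simp add: s_def)
  define P where "P = A i + B (k - i)"
  have v: "v = s * rnd s (A i) + s * rnd s (B (k - i))" by (simp add: d(1) i(4) s_def algebra_simps)
  have up: "P \<le> v" unfolding v P_def using rnd_bounds(1) [OF \<open>s > 0\<close>] by (intro add_mono)
  have lo: "v \<le> P + 2 * s - 2"
    using rnd_bounds(2) [OF \<open>s > 0\<close>, of "A i"] rnd_bounds(2) [OF \<open>s > 0\<close>, of "B (k - i)"] \<open>s > 0\<close>
    unfolding v P_def by linarith
  have "0 < real p / real q" using p by simp
  then have "\<epsilon> \<ge> 0" using assms(1) by linarith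
  have "real v \<le> (1 + \<epsilon>) * real P"
  proof (cases "l = 0")
    case True
    \<comment> \<open>At scale 1 the slack \<open>2 * s - 2\<close> is zero.\<close>
    then have "v \<le> P" using lo by (simp add: s_def)
    then have "real v \<le> 1 * real P" by simp
    also have "\<dots> \<le> (1 + \<epsilon>) * real P" using \<open>\<epsilon> \<ge> 0\<close> by (intro mult_right_mono) auto
    finally show ?thesis .
  next
    case False
    then have "L < 2 * d" using d by simp
    then have "s * L \<le> s * (2 * d)" by simp
    then have "s * L \<le> 2 * v" by (simp add: d(1) s_def)
    then have "s * L \<le> 2 * P + 4 * s" using lo by linarith
    then have "real (2 * s) \<le> \<epsilon> * real P" by (rule rounding_error [OF assms(1)])
    moreover have "real v \<le> real P + real (2 * s)" using lo of_nat_mono [of v "P + 2 * s", where 'a = real] by simp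
    ultimately show ?thesis by (simp add: algebra_simps)
  qed
  then show ?thesis using up i(1) unfolding P_def by blast
qed

text \<open>At the least scale with \<open>P \<le> s * L\<close> both entries are kept. Unless
  \<open>s = 1\<close>, half of that scale is too small, so \<open>P > s * L / 2\<close>; this one
  inequality yields the acceptance test, the bound on the rounding error and, through
  \<open>P \<le> 2 * wm\<close>, that \<open>s\<close> does not exceed \<open>wm\<close>.\<close>

lemma cand_complete:
  assumes "p / q \<le> \<epsilon>" "k < n" "i \<le> k"
    and wm: "\<And>i. i < n \<Longrightarrow> A i \<le> wm \<and> B i \<le> wm" "wm < 2 ^ K"
  shows "\<exists>l<K. \<exists>v\<in>cand l k. A i + B (k - i) \<le> v \<and> real v \<le> (1 + \<epsilon>) * real (A i + B (k - i))"
proof -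
  define P where "P = A i + B (k - i)"
  have le: "A i \<le> wm" "B (k - i) \<le> wm" using wm(1) assms(2,3) by (auto intro: le_less_trans)
  have pos: "0 < A i" using positive(1) [of i] assms(2,3) by simp
  define l where "l = (LEAST l. P \<le> 2 ^ l * L)"
  have "P * 1 \<le> 2 ^ P * L"
    using L_bounds(1) by (intro mult_le_mono less_imp_le [OF less_exp]) auto
  then have ex: "P \<le> 2 ^ P * L" by simp
  have l: "P \<le> 2 ^ l * L" unfolding l_def by (rule LeastI [of _ P]) (rule ex)
  define s :: nat where "s = 2 ^ l"
  have "s > 0" by (simp add: s_def)
  define d where "d = rnd s (A i) + rnd s (B (k - i))"
  have rl: "rnd s (A i) \<le> L" "rnd s (B (k - i)) \<le> L"
    using l by (auto intro!: rnd_le \<open>s > 0\<close> simp: s_def P_def)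
  have "d < D" using rl by (simp add: d_def D_def)
  have "P \<le> s * d" unfolding P_def d_def distrib_left using rnd_bounds(1) [OF \<open>s > 0\<close>] by (intro add_mono)
  have small: "P > s div 2 * L \<and> s = 2 * (s div 2)" if "l \<noteq> 0"
  proof -
    have "\<not> P \<le> 2 ^ (l - 1) * L" using not_less_Least [of "l - 1" "\<lambda>l. P \<le> 2 ^ l * L"] that by (simp add: l_def)
    moreover have "s = 2 * 2 ^ (l - 1)" using that by (simp add: s_def power_eq_if)
    ultimately show ?thesis by simp
  qed
  have "l = 0 \<or> L < 2 * d"
  proof (cases "l = 0")
    case False
    have "s * L = 2 * (s div 2 * L)" using small [OF False] by (metis mult.assoc)
    also have "\<dots> < 2 * P" using small [OF False] by simp
    also have "\<dots> \<le> s * (2 * d)" using \<open>P \<le> s * d\<close> by simp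
    finally show ?thesis by simp
  qed simp
  moreover have "hit l (k * D + d)" using rl assms unfolding d_def s_def by (intro hit_encode)
  ultimately have v: "2 ^ l * d \<in> cand l k" using \<open>d < D\<close> by (auto simp: cand_def accepted_def)
  have "l < K"
  proof -
    have "s \<le> wm"
    proof (cases "l = 0")
      case True
      then show ?thesis using le pos by (simp add: s_def)
    next
      case False
      have "s div 2 * 4 \<le> s div 2 * L" using L_bounds(1) by (intro mult_le_mono2) simp
      then have "s div 2 * 4 \<le> 2 * wm" using small [OF False] le unfolding P_def by linarith
      then show ?thesis using small [OF False] by linarith
    qed
    then have "(2::nat) ^ l < 2 ^ K" unfolding s_def using wm(2) by (rule le_less_trans)
    then show ?thesis by (rule power_less_imp_less_exp [rotated]) simp
  qed
  moreover have "real (2 ^ l * d) \<le> (1 + \<epsilon>) * real P"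
  proof (cases "l = 0")
    case True
    have "0 < real p / real q" using p by simp
    then have "\<epsilon> \<ge> 0" using assms(1) by linarith
    then have "1 * real P \<le> (1 + \<epsilon>) * real P" by (intro mult_right_mono) auto
    then show ?thesis using True by (simp add: d_def s_def P_def)
  next
    case False
    have "s * d \<le> P + 2 * s"
      using rnd_bounds(2) [OF \<open>s > 0\<close>, of "A i"] rnd_bounds(2) [OF \<open>s > 0\<close>, of "B (k - i)"]
      unfolding d_def P_def distrib_left by linarith
    have "s * L \<le> 2 * P" using small [OF False] by (metis less_imp_le mult.assoc mult_le_mono2)
    then have "real (2 * s) \<le> \<epsilon> * real P" by (intro rounding_error [OF assms(1)]) simp
    moreover have "real (s * d) \<le> real P + real (2 * s)"
      using \<open>s * d \<le> P + 2 * s\<close> of_nat_mono [of "s * d" "P + 2 * s", where 'a = real] by simp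
    ultimately show ?thesis by (simp add: algebra_simps s_def)
  qed
  ultimately show ?thesis using v \<open>P \<le> s * d\<close> unfolding P_def s_def by blast
qed

end

section \<open>The complete program\<close>

definition clear_body :: wcom where
  "clear_body = Seq (Store (fld_addr 0 22) (Const 0)) (Store (fld_addr 1 22) (Const 0))"

definition mark_cell :: "wexp \<Rightarrow> nat \<Rightarrow> wcom" where
  "mark_cell x f = Seq (Assign 24 (Bin Div (Bin Sub (Bin Add (Load x) (Reg 20)) (Const 1)) (Reg 20)))
    (Seq (Assign 25 (Bin Add (Bin Mul (Reg 22) (Reg 4)) (Reg 24)))
      (Cond (Bin Less (Reg 3) (Reg 24)) Skip (Store (fld_addr f 25) (Reg 6))))"

definition mark_body :: wcom where
  "mark_body = Seq (mark_cell (Reg 22) 0) (mark_cell (Bin Add (Reg 22) (Reg 0)) 1)"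

definition extract_index :: wcom where
  "extract_index = Seq (Assign 23 (Bin Div (Reg 22) (Reg 4)))
    (Seq (Assign 24 (Bin Mod (Reg 22) (Reg 4))) (Assign 25 (Bin Mod (Bin Sub (Reg 5) (Reg 22)) (Reg 5))))"

definition extract_cand :: wcom where
  "extract_cand = Seq (Assign 26 (Bin Add (Reg 10) (Reg 23)))
    (Seq (Assign 27 (Load (Reg 26))) (Assign 28 (Bin Mul (Reg 20) (Reg 24))))"

text \<open>The sum of two truth values acts as a disjunction. \<open>better\<close> is left open:
  it compares the current result in register 27 with the candidate in register 28.\<close>

definition extract_body :: "wexp \<Rightarrow> wcom" where
  "extract_body better = Seq extract_index
    (Cond (Bin Less (Reg 11) (Bin Add (fld 1 25) (Reg 7)))
      (Cond (Bin Add (Bin Equal (Reg 20) (Const 1)) (Bin Less (Reg 3) (Bin Mul (Const 2) (Reg 24))))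
        (Seq extract_cand (Cond better (Store (Reg 26) (Reg 28)) Skip)) Skip) Skip)"

definition scale_body :: "wexp \<Rightarrow> wcom" where
  "scale_body better = Seq (For 22 5 clear_body) (Seq (For 22 0 mark_body) (Seq fft_prog
    (Seq (For 22 5 square_body) (Seq fft_prog (Seq (For 22 12 (extract_body better))
      (Assign 20 (Bin Mul (Const 2) (Reg 20))))))))"

lemma agree_self [simp]: "agree k (fst s) s"
  by (simp add: agree_def)

lemma agree_trans: "agree k (fst s) s' \<Longrightarrow> agree k E s \<Longrightarrow> agree k E s'"
  by (simp add: agree_def)

lemma less_val: "wexp_val w (Bin Less a b) s \<noteq> 0 \<longleftrightarrow> wexp_val w a s < wexp_val w b s"
  by simp

section \<open>Marking rounded entries and collecting candidates\<close>

context conv_input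
begin

lemma word_bounds:
  "8 * 2 ^ m + 8 * W + 8 < 2 ^ w" "x \<le> 2 * W \<Longrightarrow> y \<le> 2 ^ m \<Longrightarrow> x * y < 2 ^ w"
proof -
  have le: "(2 ^ m + 2) * (W + 2) \<le> 2 * (2 ^ m * (W + 2))"
  proof -
    have "(2::nat) ^ m + 2 \<le> 2 * 2 ^ m" using small_powers by linarith
    then have "(2 ^ m + 2) * (W + 2) \<le> 2 * 2 ^ m * (W + 2)" by (rule mult_le_mono1)
    then show ?thesis by (simp only: mult.assoc)
  qed
  have "2 ^ m + W \<le> (2 ^ m + 2) * (W + 2)" by (simp add: algebra_simps)
  then have "2 ^ m + W \<le> 2 * (2 ^ m * (W + 2))" using le by (rule le_trans)
  then show "8 * 2 ^ m + 8 * W + 8 < 2 ^ w" using big(1) small_powers(2) by linarith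
  assume "x \<le> 2 * W" "y \<le> 2 ^ m"
  then have "x * y \<le> 2 * W * 2 ^ m" by (rule mult_le_mono)
  also have "\<dots> = 2 * (2 ^ m * W)" by (simp only: mult_ac)
  also have "2 ^ m * W \<le> 2 ^ m * (W + 2)" by (rule mult_le_mono2) simp
  finally have "x * y \<le> 2 * (2 ^ m * (W + 2))" by simp
  moreover have "0 < 2 ^ m * (W + 2)" by simp
  ultimately show "x * y < 2 ^ w" using big(1) by linarith
qed

definition ready :: "nat \<Rightarrow> nat \<Rightarrow> state \<Rightarrow> bool" where
  "ready l wm s \<longleftrightarrow> env (fst s) \<and> fst s 0 = n \<and> fst s 3 = L \<and> fst s 4 = D \<and>
    fst s 11 = 2 ^ m * scl m + 2 ^ (20 * m) \<and> fst s 12 = n * D \<and> fst s 13 = wm \<and>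
    fst s 10 = 2 * n \<and> fst s 20 = 2 ^ l"

lemma ready_agree: "ready l wm s \<Longrightarrow> agree 21 (fst s) s' \<Longrightarrow> ready l wm s'"
  by (simp add: ready_def agree_def env_def)

lemma ready_regs:
  assumes "ready l wm s"
  shows "env (fst s)" "fst s 0 = n" "fst s 3 = L" "fst s 4 = D"
    "fst s 11 = 2 ^ m * scl m + 2 ^ (20 * m)" "fst s 12 = n * D" "fst s 13 = wm"
    "fst s 10 = 2 * n" "fst s 20 = 2 ^ l" "fst s 5 = 2 ^ m" "fst s 6 = scl m"
    "fst s 7 = 2 ^ (20 * m)" "fst s 8 = 2 ^ (12 * m)" "fst s 9 = 3 * n"
  using assms by (simp_all add: ready_def env_def)

definition input :: "(nat \<Rightarrow> nat) \<Rightarrow> bool" where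
  "input M \<longleftrightarrow> (\<forall>i<n. M i = A i \<and> M (n + i) = B i)"

lemma input_frame: "frame K M' M \<Longrightarrow> input M \<Longrightarrow> input M'"
  by (simp add: input_def frame_low [of K M' M])

lemma clear_runs:
  assumes "ready l wm s"
  shows "runs w (For 22 5 clear_body) s (2 ^ m * 26 + 6)
    (\<lambda>s'. agree 22 (fst s) s' \<and> frame {0, 1} (snd s') (snd s) \<and> holds (snd s') 0 (\<lambda>_. (0, 0)) (2 ^ m))"
proof -
  note r = ready_regs [OF assms]
  define I where "I = (\<lambda>i s'. agree 22 (fst s) s' \<and> frame {0, 1} (snd s') (snd s) \<and> holds (snd s') 0 (\<lambda>_. (0, 0)) i)"
  have "runs w (For 22 5 clear_body) s (2 ^ m * (18 + 8) + 6) (I (2 ^ m))"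
  proof (rule runs_For)
    show "I 0 s" by (simp add: I_def holds_def)
    show "I j ((fst s')(22 := v), snd s')" if "I j s'" for j s' v using that by (simp add: I_def)
    show "fst s' 5 = 2 ^ m" if "I j s'" for j s' using that r by (simp add: I_def agree_def)
    fix i s' assume i: "i < 2 ^ m" and I: "I i s'" and x: "fst s' 22 = i"
    have b: "fst s' 9 = 3 * n" using I r by (simp add: I_def agree_def)
    have sem: "sem w clear_body s' = (fst s', (snd s')(adr 0 i := 0, adr 1 i := 0))"
      using b x i by (simp add: clear_body_def)
    have post: "I (Suc i) (sem w clear_body s') \<and> fst (sem w clear_body s') 22 = i"
      using I x by (auto simp: I_def sem holds_def less_Suc_eq agree_def enc_0)
    show "runs w clear_body s' 18 (\<lambda>s'. I (Suc i) s' \<and> fst s' 22 = i)"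
    proof (rule runs_straight)
      show "straight clear_body" "cost clear_body \<le> 18" by (simp_all add: clear_body_def)
    qed (rule post)
  qed (use small_powers in auto)
  then show ?thesis by (simp add: I_def)
qed

lemma mark_cell_sem:
  assumes reg: "fst s 3 = L" "fst s 4 = D" "fst s 6 = scl m" "fst s 9 = 3 * n" "fst s 20 = 2 ^ l" "fst s 22 = i"
    and i: "i < n" and l: "2 ^ l \<le> W" and v: "snd s (wexp_val w x s) = v" "0 < v" "v \<le> W" and "f < 8"
  shows "sem w (mark_cell x f) s = ((fst s)(24 := rnd (2 ^ l) v, 25 := i * D + rnd (2 ^ l) v),
    if rnd (2 ^ l) v \<le> L then (snd s)(adr f (i * D + rnd (2 ^ l) v) := scl m) else snd s)"
proof -
  define c where "c = rnd (2 ^ l) v"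
  have c: "c \<le> W" using rnd_le [of "2 ^ l" v v] v by (simp add: c_def)
  have sum: "v + 2 ^ l < 2 ^ w" using v l word_bounds(1) by linarith
  have one: "Suc 0 mod 2 ^ w = 1" using small_powers by simp
  have "nat ((int (v + 2 ^ l) - int 1) mod 2 ^ w) = v + 2 ^ l - 1"
    using v sum by (intro sub_val) auto
  then have sub: "nat ((int v + 2 ^ l - 1) mod 2 ^ w) div 2 ^ l = c"
    by (simp add: c_def rnd_def)
  have "i * D \<le> n * D" using i by simp
  then have iD: "i * D \<le> 2 ^ m" using m_upper by linarith
  have idx: "i * D < 2 ^ w" "i * D + c < 2 ^ w" using iD c word_bounds(1) by linarith+
  have lt: "i * D + c < 2 ^ m" if "c \<le> L"
  proof -
    have "marked l (\<lambda>_. v) n (i * D + c)" using i that by (auto simp: marked_def c_def)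
    then have "i * D + c + L < n * D" by (rule marked_less)
    then show ?thesis using m_upper by linarith
  qed
  show ?thesis
    using reg v(1) sum one sub idx lt \<open>f < 8\<close> unfolding c_def [symmetric] by (simp add: mark_cell_def not_less)
qed

lemma marked_Suc: "marked l X (Suc i) u \<longleftrightarrow> marked l X i u \<or> (rnd (2 ^ l) (X i) \<le> L \<and> u = i * D + rnd (2 ^ l) (X i))"
  by (auto simp: marked_def less_Suc_eq)

lemma mark_runs:
  assumes "ready l wm s" and l: "2 ^ l \<le> W" and inp: "input (snd s)" and z: "holds (snd s) 0 (\<lambda>_. (0, 0)) (2 ^ m)"
  shows "runs w (For 22 0 mark_body) s (n * 66 + 6)
    (\<lambda>s'. agree 22 (fst s) s' \<and> frame {0, 1} (snd s') (snd s) \<and>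
      holds (snd s') 0 (marks m (marked l A n) (marked l B n)) (2 ^ m))"
proof -
  note r = ready_regs [OF assms(1)]
  define I where "I = (\<lambda>i s'. agree 22 (fst s) s' \<and> frame {0, 1} (snd s') (snd s) \<and>
    holds (snd s') 0 (marks m (marked l A i) (marked l B i)) (2 ^ m))"
  have "n \<le> n * D" using D_ge by simp
  then have n_le: "2 * n \<le> 2 ^ m" using m_upper by linarith
  have "runs w (For 22 0 mark_body) s (n * (58 + 8) + 6) (I n)"
  proof (rule runs_For)
    show "I 0 s" using z by (simp add: I_def holds_def marks_def [OF m6] marked_def)
    show "I j ((fst s')(22 := v), snd s')" if "I j s'" for j s' v using that by (simp add: I_def)
    show "fst s' 0 = n" if "I j s'" for j s' using that r by (simp add: I_def agree_def)
    show "n < 2 ^ w" using n_le small_powers by linarith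
    fix i s' assume i: "i < n" and I: "I i s'" and x: "fst s' 22 = i"
    have ag: "agree 22 (fst s) s'" and fr: "frame {0, 1} (snd s') (snd s)"
      and h: "holds (snd s') 0 (marks m (marked l A i) (marked l B i)) (2 ^ m)"
      using I by (auto simp: I_def)
    have r': "fst s' 0 = n" "fst s' 3 = L" "fst s' 4 = D" "fst s' 6 = scl m" "fst s' 9 = 3 * n" "fst s' 20 = 2 ^ l"
      using r ag by (simp_all add: agree_def)
    define a where "a = rnd (2 ^ l) (A i)"
    define c where "c = rnd (2 ^ l) (B i)"
    have inp': "input (snd s')" using input_frame [OF fr inp] .
    define s1 where "s1 = sem w (mark_cell (Reg 22) 0) s'"
    have s1: "s1 = ((fst s')(24 := a, 25 := i * D + a), if a \<le> L then (snd s')(adr 0 (i * D + a) := scl m) else snd s')"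
      unfolding s1_def a_def using r' x i l inp' positive(1) [OF i]
      by (intro mark_cell_sem) (auto simp: input_def)
    have "snd s1 (n + i) = B i" using inp' i by (auto simp: s1 input_def adr_def)
    moreover have "n + i < 2 ^ w" using i n_le small_powers by linarith
    ultimately have s2: "sem w (mark_cell (Bin Add (Reg 22) (Reg 0)) 1) s1 = ((fst s1)(24 := c, 25 := i * D + c),
        if c \<le> L then (snd s1)(adr 1 (i * D + c) := scl m) else snd s1)"
      unfolding c_def using r' x i l positive(2) [OF i]
      by (intro mark_cell_sem) (auto simp: s1 add.commute)
    have sem: "sem w mark_body s' = ((fst s1)(24 := c, 25 := i * D + c),
        if c \<le> L then (snd s1)(adr 1 (i * D + c) := scl m) else snd s1)"
      unfolding mark_body_def sem.simps s1_def [symmetric] by (rule s2)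
    have e: "enc w (int (scl m)) = scl m" by (rule enc_nat [OF scl_less])
    have "holds (snd (sem w mark_body s')) 0 (marks m (marked l A (Suc i)) (marked l B (Suc i))) (2 ^ m)"
      using h unfolding sem s1
      by (auto simp: holds_def marks_def [OF m6] marked_Suc a_def [symmetric] c_def [symmetric] e enc_0)
    moreover have "frame {0, 1} (snd (sem w mark_body s')) (snd s)"
      using fr unfolding sem s1 by auto
    moreover have "agree 22 (fst s) (sem w mark_body s')" using ag unfolding sem s1 by (simp add: agree_def)
    moreover have "fst (sem w mark_body s') 22 = i" using x by (simp add: sem s1)
    ultimately have post: "I (Suc i) (sem w mark_body s') \<and> fst (sem w mark_body s') 22 = i"
      by (simp add: I_def)
    show "runs w mark_body s' 58 (\<lambda>s'. I (Suc i) s' \<and> fst s' 22 = i)"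
    proof (rule runs_straight)
      show "straight mark_body" "cost mark_body \<le> 58" by (simp_all add: mark_body_def mark_cell_def)
    qed (rule post)
  qed auto
  then show ?thesis by (simp add: I_def)
qed

definition part :: "nat \<Rightarrow> nat \<Rightarrow> nat \<Rightarrow> nat set" where
  "part l j k = {2 ^ l * d | d. d < D \<and> k * D + d < j \<and> accepted l k d}"

lemma part_0: "part l 0 k = {}"
  by (simp add: part_def)

lemma part_all:
  assumes "k < n"
  shows "part l (n * D) k = cand l k"
proof -
  have "k * D + d < n * D" if "d < D" for d
  proof -
    have "(k + 1) * D \<le> n * D" using assms by (intro mult_right_mono) auto
    then show ?thesis using that by simp
  qed
  then show ?thesis by (auto simp: part_def cand_def)
qed

text \<open>Every position \<open>j\<close> belongs to a single result index, its quotient by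
  \<open>D\<close>, so one step of the scan changes at most one result.\<close>

lemma part_Suc:
  "part l (Suc j) k = (if k = j div D \<and> accepted l (j div D) (j mod D)
     then insert (2 ^ l * (j mod D)) (part l j k) else part l j k)"
proof -
  have "k * D + d = j \<longleftrightarrow> k = j div D \<and> d = j mod D" if "d < D" for d
    using that div_mult_mod_eq [of j D] by auto
  moreover have "j mod D < D" using D_ge by simp
  ultimately show ?thesis by (auto simp: part_def less_Suc_eq)
qed

lemma finite_part: "finite (part l j k)"
  by (rule finite_subset [of _ "(\<lambda>d. 2 ^ l * d) ` {..<D}"]) (auto simp: part_def)

lemma part_pos: "0 \<notin> part l j k"
  using accepted_pos by (auto simp: part_def)

lemma finite_cand: "finite (cand l k)"
  by (rule finite_subset [of _ "(\<lambda>d. 2 ^ l * d) ` {..<D}"]) (auto simp: cand_def)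

lemma cand_pos: "0 \<notin> cand l k"
  using accepted_pos by (auto simp: cand_def)

end

text \<open>Minimum and maximum are handled together by an incremental description of
  \<open>opt\<close>. The value 0 stands for a result not yet found, which is why
  \<open>opt_insert\<close> speaks of positive values only; the cost bound 7 is that of the
  comparison used for the minimum.\<close>

locale conv_opt = conv_input +
  fixes opt :: "nat set \<Rightarrow> nat" and better :: wexp and improves :: "nat \<Rightarrow> nat \<Rightarrow> bool"
  assumes opt_empty: "opt {} = 0"
    and opt_insert: "\<And>V v. finite V \<Longrightarrow> 0 \<notin> V \<Longrightarrow> 0 < v \<Longrightarrow> opt (insert v V) = (if improves (opt V) v then v else opt V)"
    and better: "\<And>s. wexp_val w better s \<noteq> 0 \<longleftrightarrow> improves (fst s 27) (fst s 28)"
    and better_cost: "wexp_cost better \<le> 7"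
begin

definition results :: "(nat \<Rightarrow> nat) \<Rightarrow> (nat \<Rightarrow> nat set) \<Rightarrow> bool" where
  "results M V \<longleftrightarrow> (\<forall>k<n. M (2 * n + k) = opt (V k))"

lemma results_frame: "frame K M' M \<Longrightarrow> results M V \<Longrightarrow> results M' V"
  by (simp add: results_def frame_low [of K M' M])

lemma extract_runs:
  assumes "ready l wm s" and l: "2 ^ l \<le> W"
    and h: "holds (snd s) 0 (counts m (marked l A n) (marked l B n) m) (2 ^ m)"
    and V: "results (snd s) V" "\<And>k. finite (V k)" "\<And>k. 0 \<notin> V k"
  shows "runs w (For 22 12 (extract_body better)) s (n * D * 70 + 6)
    (\<lambda>s'. agree 22 (fst s) s' \<and> (\<forall>a. a < 2 * n \<or> 3 * n \<le> a \<longrightarrow> snd s' a = snd s a) \<and>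
      results (snd s') (\<lambda>k. V k \<union> cand l k))"
proof -
  note r = ready_regs [OF assms(1)]
  define I where "I = (\<lambda>j s'. agree 22 (fst s) s' \<and> (\<forall>a. a < 2 * n \<or> 3 * n \<le> a \<longrightarrow> snd s' a = snd s a) \<and>
      results (snd s') (\<lambda>k. V k \<union> part l j k))"
  have nD: "2 * (n * D) \<le> 2 ^ m" by (rule m_upper)
  have "runs w (For 22 12 (extract_body better)) s (n * D * (62 + 8) + 6) (I (n * D))"
  proof (rule runs_For)
    show "I 0 s" using V by (simp add: I_def part_0)
    show "I j ((fst s')(22 := v), snd s')" if "I j s'" for j s' v using that by (simp add: I_def)
    show "fst s' 12 = n * D" if "I j s'" for j s' using that r by (simp add: I_def agree_def)
    show "n * D < 2 ^ w" using nD small_powers by linarith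
    fix j s' assume j: "j < n * D" and I: "I j s'" and x: "fst s' 22 = j"
    have ag: "agree 22 (fst s) s'" and low: "\<And>a. a < 2 * n \<or> 3 * n \<le> a \<Longrightarrow> snd s' a = snd s a"
      and res: "results (snd s') (\<lambda>k. V k \<union> part l j k)"
      using I by (auto simp: I_def)
    have r': "fst s' 3 = L" "fst s' 4 = D" "fst s' 5 = 2 ^ m" "fst s' 7 = 2 ^ (20 * m)" "fst s' 9 = 3 * n"
      "fst s' 11 = 2 ^ m * scl m + 2 ^ (20 * m)" "fst s' 10 = 2 * n" "fst s' 20 = 2 ^ l"
      using r ag by (simp_all add: agree_def)
    define k where "k = j div D"
    define d where "d = j mod D"
    define i where "i = (2 ^ m - j) mod 2 ^ m"
    define c where "c = snd (counts m (marked l A n) (marked l B n) m i)"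
    have jm: "j < 2 ^ m" using j nD by linarith
    have k: "k < n" using j D_ge by (simp add: k_def div_less_iff_less_mult)
    have d: "d < D" using D_ge by (simp add: d_def)
    have kd: "k * D + d = j" unfolding k_def d_def by (rule div_mult_mod_eq)
    have i: "i < 2 ^ m" by (simp add: i_def)
    have "nat ((int (2 ^ m) - int j) mod 2 ^ w) = 2 ^ m - j"
      using jm small_powers by (intro sub_val) auto
    then have idx: "sem w extract_index s' = ((fst s')(23 := k, 24 := d, 25 := i), snd s')"
      using r' x by (simp add: extract_index_def k_def d_def i_def)
    define s1 where "s1 = ((fst s')(23 := k, 24 := d, 25 := i), snd s')"
    have cell: "wexp_val w (fld 1 25) s1 = enc w c"
    proof -
      have "snd s' (adr 1 i) = snd s (adr 1 i)" by (rule low) (simp add: adr_def)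
      then show ?thesis using r' i h by (simp add: s1_def holds_def c_def)
    qed
    have bound: "\<bar>c\<bar> \<le> 2 ^ (20 * m)" unfolding c_def by (rule counts_bound [OF m6 order_refl i])
    have val: "wexp_val w (Bin Add (fld 1 25) (Reg 7)) s1 = nat (c + 2 ^ (20 * m))"
      by (rule bias_val(1) [OF _ cell bound]) (simp add: s1_def r')
    have "wexp_val w (Bin Less (Reg 11) (Bin Add (fld 1 25) (Reg 7))) s1 \<noteq> 0 \<longleftrightarrow>
        2 ^ m * scl m + 2 ^ (20 * m) < nat (c + 2 ^ (20 * m))"
      unfolding less_val val by (simp add: s1_def r')
    \<comment> \<open>Both sides carry the same bias, so the machine comparison of naturals decides
      the signed one.\<close>
    also have "\<dots> \<longleftrightarrow> int (2 ^ m * scl m) < c"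
      by (simp add: zless_nat_eq_int_zless)
    also have "\<dots> \<longleftrightarrow> hit l j"
      unfolding c_def i_def hit_def
    proof (rule counts_hit [OF m6 _ jm])
      fix u assume "marked l A n u \<or> marked l B n u"
      then have "u + L < n * D" using marked_less by blast
      then show "2 * u < 2 ^ m" using nD by linarith
    qed
    finally have test1: "wexp_val w (Bin Less (Reg 11) (Bin Add (fld 1 25) (Reg 7))) s1 \<noteq> 0 \<longleftrightarrow> hit l j" .
    have "d \<le> n * D" using d D_ge by linarith
    then have d2: "2 * d \<le> 2 ^ m" using nD by linarith
    then have "2 * d < 2 ^ w" using small_powers by linarith
    moreover have "2 mod 2 ^ w = (2::nat)" "Suc (Suc 0) mod 2 ^ w = 2" "0 < w"
      using small_powers(5) word m6 by simp_all
    ultimately have test2: "wexp_val w (Bin Add (Bin Equal (Reg 20) (Const 1)) (Bin Less (Reg 3) (Bin Mul (Const 2) (Reg 24)))) s1 \<noteq> 0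
        \<longleftrightarrow> l = 0 \<or> L < 2 * d"
      using r' by (auto simp: s1_def)
    define v where "v = 2 ^ l * d"
    define cur where "cur = opt (V k \<union> part l j k)"
    define s2 where "s2 = ((fst s1)(26 := 2 * n + k, 27 := cur, 28 := v), snd s')"
    have cand: "sem w extract_cand s1 = s2"
    proof -
      have "v < 2 ^ w" unfolding v_def using l d2 by (intro word_bounds(2)) auto
      moreover have "n \<le> n * D" using D_ge by simp
      then have "2 * n + k < 2 ^ w" using k nD small_powers by linarith
      moreover have "snd s' (2 * n + k) = cur" using res k by (simp add: results_def cur_def)
      ultimately show ?thesis using r' by (simp add: extract_cand_def s1_def s2_def v_def)
    qed
    have imp: "wexp_val w better s2 \<noteq> 0 \<longleftrightarrow> improves cur v" using better [of s2] by (simp add: s2_def)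
    have sem: "sem w (extract_body better) s' = (if accepted l k d then
        if improves cur v then (fst s2, (snd s')(2 * n + k := v)) else s2 else s1)"
    proof -
      have "sem w (extract_body better) s' = (if hit l j then if l = 0 \<or> L < 2 * d then
          if wexp_val w better s2 \<noteq> 0 then sem w (Store (Reg 26) (Reg 28)) s2 else s2 else s1 else s1)"
        unfolding extract_body_def sem.simps(1,4,5) idx s1_def [symmetric] test1 test2 cand ..
      moreover have "sem w (Store (Reg 26) (Reg 28)) s2 = (fst s2, (snd s')(2 * n + k := v))"
        by (simp add: s2_def)
      ultimately show ?thesis by (simp only: imp accepted_def kd) auto
    qed
    have new: "snd (sem w (extract_body better) s') =
      (if accepted l k d \<and> improves cur v then (snd s')(2 * n + k := v) else snd s')"
      by (simp add: sem s1_def s2_def)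
    have "results (snd (sem w (extract_body better) s')) (\<lambda>k. V k \<union> part l (Suc j) k)"
    proof -
      have hits: "opt (V k \<union> part l (Suc j) k) = (if improves cur v then v else cur)" if acc: "accepted l k d"
      proof -
        have "V k \<union> part l (Suc j) k = insert v (V k \<union> part l j k)"
          using acc by (simp add: part_Suc k_def d_def v_def)
        moreover have "0 < v" using accepted_pos [OF acc d] by (simp add: v_def)
        ultimately show ?thesis unfolding cur_def
          using V(2,3) finite_part part_pos by (simp add: opt_insert)
      qed
      have misses: "part l (Suc j) k' = part l j k'" if "k' \<noteq> k \<or> \<not> accepted l k d" for k'
        using that by (auto simp: part_Suc k_def d_def)
      show ?thesis
        unfolding results_def
      proof (intro allI impI)
        fix k' assume k': "k' < n"
        have old: "snd s' (2 * n + k') = opt (V k' \<union> part l j k')" using res k' by (simp add: results_def)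
        show "snd (sem w (extract_body better) s') (2 * n + k') = opt (V k' \<union> part l (Suc j) k')"
        proof (cases "k' = k \<and> accepted l k d")
          case True
          then show ?thesis using hits old by (simp add: new cur_def)
        next
          case False
          then have "snd (sem w (extract_body better) s') (2 * n + k') = snd s' (2 * n + k')" by (auto simp: new)
          then show ?thesis using misses [of k'] False old by simp
        qed
      qed
    qed
    moreover have "agree 22 (fst s) (sem w (extract_body better) s')"
      using ag by (auto simp: sem s1_def s2_def agree_def)
    moreover have "snd (sem w (extract_body better) s') a = snd s a" if "a < 2 * n \<or> 3 * n \<le> a" for a
      using low [OF that] that k by (auto simp: new)
    moreover have "fst (sem w (extract_body better) s') 22 = j" using x by (simp add: sem s1_def s2_def)
    ultimately have post: "I (Suc j) (sem w (extract_body better) s') \<and> fst (sem w (extract_body better) s') 22 = j"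
      by (simp add: I_def)
    show "runs w (extract_body better) s' 62 (\<lambda>s'. I (Suc j) s' \<and> fst s' 22 = j)"
    proof (rule runs_straight)
      show "straight (extract_body better)" "cost (extract_body better) \<le> 62"
        using better_cost by (simp_all add: extract_body_def extract_index_def extract_cand_def)
    qed (rule post)
  qed auto
  then show ?thesis by (rule runs_mono) (auto simp: I_def results_def part_all)
qed

end

section \<open>Preparation and the loop over the scales\<close>

definition sizes_prog :: wcom where
  "sizes_prog = Seq (Assign 3 (Bin Mul (Const 4) (Bin Add (Bin Div (Reg 2) (Reg 1)) (Const 2))))
    (Seq (Assign 4 (Bin Add (Bin Mul (Const 2) (Reg 3)) (Const 1)))
    (Seq (Assign 10 (Bin Mul (Const 2) (Reg 0)))
    (Seq (Assign 12 (Bin Mul (Reg 0) (Reg 4))) (Assign 5 (Const 1)))))"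

definition length_prog :: wcom where
  "length_prog = While (Bin Less (Reg 5) (Bin Mul (Const 2) (Reg 12))) (Assign 5 (Bin Mul (Const 2) (Reg 5)))"

text \<open>An addition chain for the exponents of \<open>N = 2 ^ m\<close>: registers 6 and 8 pass
  through \<open>N ^ 2\<close>, \<open>N ^ 4\<close>, \<open>N ^ 8\<close>, \<open>N ^ 12\<close>,
  and register 7 receives \<open>N ^ 20\<close>. The program thereby obtains its units without
  knowing \<open>m\<close>.\<close>

definition units_prog :: wcom where
  "units_prog = Seq (Assign 6 (Bin Mul (Reg 5) (Reg 5))) (Seq (Assign 8 (Bin Mul (Reg 6) (Reg 6)))
    (Seq (Assign 6 (Bin Mul (Reg 8) (Reg 8))) (Seq (Assign 8 (Bin Mul (Reg 8) (Reg 6)))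
    (Seq (Assign 7 (Bin Mul (Reg 8) (Reg 6))) (Seq (Assign 9 (Bin Mul (Const 3) (Reg 0)))
    (Seq (Assign 11 (Bin Add (Bin Mul (Reg 5) (Reg 6)) (Reg 7))) (Assign 13 (Const 0))))))))"

definition max_body :: wcom where
  "max_body = Seq (Assign 23 (Load (Reg 22))) (Cond (Bin Less (Reg 13) (Reg 23)) (Assign 13 (Reg 23)) Skip)"

definition out_body :: wcom where
  "out_body = Store (Reg 22) (Load (Bin Add (Reg 10) (Reg 22)))"

text \<open>\<open>W\<close> is not part of the input, so the scales are bounded by the largest
  entry, found beforehand in register 13; the added 1 turns the strict comparison into
  \<open>\<le>\<close>.\<close>

definition scales_prog :: "wexp \<Rightarrow> wcom" where
  "scales_prog better = While (Bin Less (Reg 20) (Bin Add (Reg 13) (Const 1))) (scale_body better)"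

definition conv_prog :: "wexp \<Rightarrow> wcom" where
  "conv_prog better = Seq sizes_prog (Seq length_prog (Seq units_prog (Seq (For 22 10 max_body)
    (Seq root_prog (Seq (Seq twiddle_prog (Assign 20 (Const 1))) (Seq (scales_prog better) (For 22 0 out_body)))))))"

context conv_opt
begin

text \<open>The summands are nested like the commands of \<open>scale_body\<close>, so that
  \<open>runs_Seq\<close> composes the bounds verbatim; estimation is left to
  \<open>conv_time_bound\<close>.\<close>

definition scale_time :: nat where
  "scale_time = (2 ^ m * 26 + 6) + ((n * 66 + 6) + ((m * (2 ^ m * 231 + 20) + 6) + ((2 ^ m * 108 + 6) +
    ((m * (2 ^ m * 231 + 20) + 6) + ((n * D * 70 + 6) + 4)))))"

lemma scale_runs:
  assumes rd: "ready l wm s" and l: "2 ^ l \<le> wm" "wm \<le> W"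
    and tw: "holds (snd s) 4 (tw m) (2 ^ m)" and inp: "input (snd s)"
    and V: "results (snd s) V" "\<And>k. finite (V k)" "\<And>k. 0 \<notin> V k"
  shows "runs w (scale_body better) s scale_time
    (\<lambda>s'. agree 20 (fst s) s' \<and> fst s' 20 = 2 ^ Suc l \<and> holds (snd s') 4 (tw m) (2 ^ m) \<and>
      input (snd s') \<and> results (snd s') (\<lambda>k. V k \<union> cand l k))"
proof -
  let ?Q = "\<lambda>s'. agree 20 (fst s) s' \<and> fst s' 20 = 2 ^ Suc l \<and> holds (snd s') 4 (tw m) (2 ^ m) \<and>
      input (snd s') \<and> results (snd s') (\<lambda>k. V k \<union> cand l k)"
  let ?fft = "m * (2 ^ m * 231 + 20) + 6"
  let ?next = "Assign 20 (Bin Mul (Const 2) (Reg 20))"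
  have lW: "2 ^ l \<le> W" using l by simp
  \<comment> \<open>\<open>ok\<close> records what every phase before the read-off preserves: the
    registers below 21 and all memory outside fields 0 to 3, hence twiddle factors, input and
    results.\<close>
  define ok where "ok = (\<lambda>s'. agree 21 (fst s) s' \<and> frame {0, 1, 2, 3} (snd s') (snd s))"
  have ok: "ready l wm s'" "holds (snd s') 4 (tw m) (2 ^ m)" "input (snd s')" "results (snd s') V" if "ok s'" for s'
  proof -
    have ag: "agree 21 (fst s) s'" and fr: "frame {0, 1, 2, 3} (snd s') (snd s)" using that by (auto simp: ok_def)
    show "ready l wm s'" by (rule ready_agree [OF rd ag])
    show "holds (snd s') 4 (tw m) (2 ^ m)" by (rule holds_frame [OF tw fr]) auto
    show "input (snd s')" by (rule input_frame [OF fr inp])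
    show "results (snd s') V" by (rule results_frame [OF fr V(1)])
  qed
  have step: "ok s2" if "ok s1" "agree j (fst s1) s2" "21 \<le> j" "frame K (snd s2) (snd s1)" "K \<subseteq> {0, 1, 2, 3}" for s1 s2 j K
  proof -
    have "agree 21 (fst s1) s2" using that(2,3) by (rule agree_mono)
    then have "agree 21 (fst s) s2" using that(1) unfolding ok_def by (auto intro: agree_trans)
    moreover have "frame {0, 1, 2, 3} (snd s2) (snd s)"
      using frame_trans [OF frame_mono [OF that(4,5)]] that(1) by (simp add: ok_def)
    ultimately show ?thesis by (simp add: ok_def)
  qed
  have ok0: "ok s" by (simp add: ok_def)
  let ?a = "marked l A n" and ?b = "marked l B n"
  have final: "runs w ?next s7 4 ?Q"
    if s6: "ok s6" and s7: "agree 22 (fst s6) s7 \<and> (\<forall>a. a < 2 * n \<or> 3 * n \<le> a \<longrightarrow> snd s7 a = snd s6 a) \<and>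
        results (snd s7) (\<lambda>k. V k \<union> cand l k)" for s6 s7
  proof (rule runs_straight)
    have "agree 21 (fst s6) s7" using s7 agree_mono [of 22 "fst s6" s7 21] by simp
    then have ag: "agree 21 (fst s) s7" using s6 unfolding ok_def by (auto intro: agree_trans)
    then have "fst s7 20 = 2 ^ l" using ready_regs(9) [OF rd] by (simp add: agree_def)
    moreover have "2 * 2 ^ l < (2::nat) ^ w" "(2::nat) < 2 ^ w" using lW word_bounds(1) by linarith+
    ultimately have sem: "sem w ?next s7 = ((fst s7)(20 := 2 ^ Suc l), snd s7)"
      by simp
    have "agree 20 (fst s) s7" using ag by (rule agree_mono) simp
    moreover have "holds (snd s7) 4 (tw m) (2 ^ m)"
    proof -
      have "snd s7 (adr f i) = snd s6 (adr f i)" for f i using s7 by (simp add: adr_def)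
      then show ?thesis using ok(2) [OF s6] by (simp add: holds_def)
    qed
    moreover have "input (snd s7)" using ok(3) [OF s6] s7 by (auto simp: input_def)
    ultimately show "?Q (sem w ?next s7)"
      using s7 unfolding sem by simp
  qed simp_all
  show ?thesis
    unfolding scale_body_def scale_time_def
  proof (rule runs_Seq [OF clear_runs [OF rd]], elim conjE)
    fix s1 assume "agree 22 (fst s) s1" "frame {0, 1} (snd s1) (snd s)" and h1: "holds (snd s1) 0 (\<lambda>_. (0, 0)) (2 ^ m)"
    then have s1: "ok s1" using step [OF ok0] by auto
    show "runs w (Seq (For 22 0 mark_body) (Seq fft_prog (Seq (For 22 5 square_body) (Seq fft_prog
        (Seq (For 22 12 (extract_body better)) ?next))))) s1
      ((n * 66 + 6) + (?fft + ((2 ^ m * 108 + 6) +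
        (?fft + ((n * D * 70 + 6) + 4))))) ?Q"
    proof (rule runs_Seq [OF mark_runs [OF ok(1) [OF s1] lW ok(3) [OF s1] h1]], elim conjE)
      fix s2 assume "agree 22 (fst s1) s2" "frame {0, 1} (snd s2) (snd s1)" and h2: "holds (snd s2) 0 (marks m ?a ?b) (2 ^ m)"
      then have s2: "ok s2" using step [OF s1] by auto
      have fit2: "fits m (tw m e) (int_fft (int (scl m)) (tw m) m (marks m ?a ?b) t i)"
        if "t < m" "i < 2 ^ m" "e \<le> 2 ^ m" for t i e
        using spectrum_fits(1) [OF m6 less_imp_le that(2,3)] that(1) by (simp add: spectrum_def [OF m6])
      have fft2: "runs w fft_prog s2 ?fft (\<lambda>s'. agree 21 (fst s2) s' \<and>
          frame {0, 1, 2, 3} (snd s') (snd s2) \<and> holds (snd s') 0 (int_fft (int (scl m)) (tw m) m (marks m ?a ?b) m) (2 ^ m))"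
        using ok [OF s2] fit2 h2 by (intro fft_runs) (auto simp: ready_regs(1))
      show "runs w (Seq fft_prog (Seq (For 22 5 square_body) (Seq fft_prog
          (Seq (For 22 12 (extract_body better)) ?next)))) s2
        (?fft + ((2 ^ m * 108 + 6) +
          (?fft + ((n * D * 70 + 6) + 4)))) ?Q"
      proof (rule runs_Seq [OF fft2], elim conjE)
        fix s3 assume "agree 21 (fst s2) s3" "frame {0, 1, 2, 3} (snd s3) (snd s2)"
          and h3: "holds (snd s3) 0 (int_fft (int (scl m)) (tw m) m (marks m ?a ?b) m) (2 ^ m)"
        then have s3: "ok s3" using step [OF s2] by auto
        have h3: "holds (snd s3) 0 (spectrum m ?a ?b m) (2 ^ m)" using h3 by (simp add: spectrum_def [OF m6])
        have sq: "(\<lambda>i. fmul (int (scl m)) (spectrum m ?a ?b m i) (spectrum m ?a ?b m i)) = squared m ?a ?b"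
          by (simp add: squared_def [OF m6] fun_eq_iff)
        have fit3: "fits m (spectrum m ?a ?b m i) (spectrum m ?a ?b m i)" if "i < 2 ^ m" for i
          by (rule spectrum_fits(2) [OF m6 order_refl that order_refl])
        have square: "runs w (For 22 5 square_body) s3 (2 ^ m * 108 + 6) (\<lambda>s'. agree 22 (fst s3) s' \<and>
            frame {0, 1} (snd s') (snd s3) \<and> holds (snd s') 0 (squared m ?a ?b) (2 ^ m))"
          unfolding sq [symmetric] using ok [OF s3] fit3 h3
          by (intro square_runs) (auto simp: ready_regs(1))
        show "runs w (Seq (For 22 5 square_body) (Seq fft_prog
            (Seq (For 22 12 (extract_body better)) ?next))) s3
          ((2 ^ m * 108 + 6) + (?fft + ((n * D * 70 + 6) + 4))) ?Q"
        proof (rule runs_Seq [OF square], elim conjE)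
          fix s4 assume "agree 22 (fst s3) s4" "frame {0, 1} (snd s4) (snd s3)"
            and h4: "holds (snd s4) 0 (squared m ?a ?b) (2 ^ m)"
          then have s4: "ok s4" using step [OF s3] by auto
          have fit4: "fits m (tw m e) (int_fft (int (scl m)) (tw m) m (squared m ?a ?b) t i)"
            if "t < m" "i < 2 ^ m" "e \<le> 2 ^ m" for t i e
            using counts_fits [OF m6 less_imp_le that(2,3)] that(1) by (simp add: counts_def [OF m6])
          have fft4: "runs w fft_prog s4 ?fft (\<lambda>s'. agree 21 (fst s4) s' \<and>
              frame {0, 1, 2, 3} (snd s') (snd s4) \<and> holds (snd s') 0 (int_fft (int (scl m)) (tw m) m (squared m ?a ?b) m) (2 ^ m))"
            using ok [OF s4] fit4 h4 by (intro fft_runs) (auto simp: ready_regs(1))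
          show "runs w (Seq fft_prog
              (Seq (For 22 12 (extract_body better)) ?next)) s4
            (?fft + ((n * D * 70 + 6) + 4)) ?Q"
          proof (rule runs_Seq [OF fft4], elim conjE)
            fix s5 assume "agree 21 (fst s4) s5" "frame {0, 1, 2, 3} (snd s5) (snd s4)"
              and h5: "holds (snd s5) 0 (int_fft (int (scl m)) (tw m) m (squared m ?a ?b) m) (2 ^ m)"
            then have s5: "ok s5" using step [OF s4] by auto
            have h5: "holds (snd s5) 0 (counts m ?a ?b m) (2 ^ m)" using h5 by (simp add: counts_def [OF m6])
            show "runs w (Seq (For 22 12 (extract_body better)) ?next) s5
              ((n * D * 70 + 6) + 4) ?Q"
              by (rule runs_Seq [OF extract_runs [OF ok(1) [OF s5] lW h5 ok(4) [OF s5] V(2,3)] final [OF s5]])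
          qed
        qed
      qed
    qed
  qed
qed

end

context conv_opt
begin

definition memory :: "nat \<Rightarrow> nat" where
  "memory = snd (input_state n p q A B)"

definition wm :: nat where
  "wm = Max (insert 0 (memory ` {..<2 * n}))"

definition K :: nat where
  "K = Suc (floor_log wm)"

lemma memory_props: "input memory" "results memory (\<lambda>_. {})"
  using n by (auto simp: input_def results_def memory_def input_state_def opt_empty)

lemma wm_bounds: "i < n \<Longrightarrow> A i \<le> wm \<and> B i \<le> wm" "wm \<le> W" "0 < wm" "wm < 2 ^ K" "l < K \<Longrightarrow> 2 ^ l \<le> wm"
proof -
  have le: "memory a \<le> wm" if "a < 2 * n" for a
    unfolding wm_def using that by (intro Max_ge) auto
  show 1: "A i \<le> wm \<and> B i \<le> wm" if "i < n" for i
    using le [of i] le [of "n + i"] that memory_props(1) by (simp add: input_def)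
  have "memory a \<le> W" if "a < 2 * n" for a
    using that positive(1) [of a] positive(2) [of "a - n"]
    by (cases "a < n") (auto simp: memory_def input_state_def)
  then show "wm \<le> W" unfolding wm_def by (intro Max.boundedI) auto
  show pos: "0 < wm" using 1 [of 0] positive(1) [of 0] n by simp
  show "wm < 2 ^ K" using floor_log_exp2_gt [of wm] by (simp add: K_def)
  assume "l < K"
  then have "(2::nat) ^ l \<le> 2 ^ floor_log wm" by (intro power_increasing) (auto simp: K_def)
  also have "\<dots> \<le> wm" using pos by (rule floor_log_exp2_le)
  finally show "2 ^ l \<le> wm" .
qed

definition sized :: "state \<Rightarrow> bool" where
  "sized s \<longleftrightarrow> snd s = memory \<and> fst s 0 = n \<and> fst s 3 = L \<and> fst s 4 = D \<and> fst s 10 = 2 * n \<and> fst s 12 = n * D"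

lemma sizes_runs:
  "runs w sizes_prog (input_state n p q A B) 30 (\<lambda>s. sized s \<and> fst s 5 = 1)"
proof (rule runs_straight)
  have "D \<le> n * D" "n \<le> n * D" using D_ge by auto
  then have "2 * D \<le> 2 ^ m" "2 * n \<le> 2 ^ m" "2 * (n * D) \<le> 2 ^ m" using m_upper by linarith+
  then have b: "2 * D < 2 ^ w" "2 * n < 2 ^ w" "n * D < 2 ^ w" "8 < (2::nat) ^ w" using small_powers by linarith+
  have c: "2 mod 2 ^ w = (2::nat)" "4 mod 2 ^ w = (4::nat)" "0 < w"
    using b word m6 by auto
  have "q div p + 2 < 2 ^ w" "L < 2 ^ w" "2 * L < 2 ^ w" "D < 2 ^ w" using b by (auto simp: L_def D_def)
  moreover have "4 * (q div p + 2) = L" "Suc (2 * L) = D" by (simp_all add: L_def D_def)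
  moreover have "n \<noteq> 0" using n by simp
  ultimately show "sized (sem w sizes_prog (input_state n p q A B)) \<and> fst (sem w sizes_prog (input_state n p q A B)) 5 = 1"
    using b c unfolding sizes_prog_def sized_def memory_def sem.simps
    by (simp add: input_state_def)
qed (simp_all add: sizes_prog_def)

lemma length_runs:
  assumes "sized s" "fst s 5 = 1"
  shows "runs w length_prog s (m * 10 + 6) (\<lambda>s'. sized s' \<and> fst s' 5 = 2 ^ m)"
proof -
  have c: "2 mod 2 ^ w = (2::nat)" using small_powers by auto
  define I where "I = (\<lambda>j s'. sized s' \<and> fst s' 5 = 2 ^ j)"
  let ?g = "Bin Less (Reg 5) (Bin Mul (Const 2) (Reg 12))"
  let ?c = "Assign 5 (Bin Mul (Const 2) (Reg 5))"
  have g: "wexp_val w ?g s' \<noteq> 0 \<longleftrightarrow> fst s' 5 < 2 * (n * D)" if "sized s'" for s'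
  proof -
    have "2 * (n * D) < 2 ^ w" using m_upper small_powers by linarith
    then show ?thesis using that c unfolding less_val by (simp add: sized_def)
  qed
  have "runs w (While ?g ?c) s (m * (1 + wexp_cost ?g + 4) + (1 + wexp_cost ?g)) (I m)"
  proof (rule runs_While)
    show "I 0 s" using assms by (simp add: I_def)
    show "wexp_val w ?g s' \<noteq> 0" if "j < m" "I j s'" for j s'
    proof -
      have "sized s'" "fst s' 5 < 2 * (n * D)" using that m_minimal [of j] by (simp_all add: I_def)
      then show ?thesis using g by blast
    qed
    show "wexp_val w ?g s' = 0" if "I m s'" for s'
    proof -
      have "sized s'" "\<not> fst s' 5 < 2 * (n * D)" using that m_upper by (simp_all add: I_def)
      then show ?thesis using g by blast
    qed
    fix j s' assume j: "j < m" and I: "I j s'"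
    have "(2::nat) ^ Suc j \<le> 2 ^ m" using j by (intro power_increasing) auto
    then have "2 * 2 ^ j < (2::nat) ^ w" using small_powers by simp
    then have "I (Suc j) (sem w ?c s')" using I c by (simp add: I_def sized_def)
    then show "runs w ?c s' 4 (I (Suc j))" by (intro runs_straight) simp_all
  qed
  then show ?thesis unfolding length_prog_def by (rule runs_mono) (simp_all add: I_def)
qed

definition prepared :: "state \<Rightarrow> bool" where
  "prepared s \<longleftrightarrow> sized s \<and> env (fst s) \<and> fst s 11 = 2 ^ m * scl m + 2 ^ (20 * m)"

lemma units_runs:
  assumes "sized s" "fst s 5 = 2 ^ m"
  shows "runs w units_prog s 50 (\<lambda>s'. prepared s' \<and> fst s' 13 = 0)"
proof (rule runs_straight)
  define N :: nat where "N = 2 ^ m"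
  define N2 :: nat where "N2 = 2 ^ (2 * m)"
  define N4 :: nat where "N4 = 2 ^ (4 * m)"
  define N8 :: nat where "N8 = 2 ^ (8 * m)"
  define N12 :: nat where "N12 = 2 ^ (12 * m)"
  define N20 :: nat where "N20 = 2 ^ (20 * m)"
  have mult: "N * N = N2" "N2 * N2 = N4" "N4 * N4 = N8" "N4 * N8 = N12" "N12 * N8 = N20"
    unfolding N_def N2_def N4_def N8_def N12_def N20_def by (simp_all add: power_add [symmetric])
  have big: "2 * N20 < 2 ^ w" using small_powers(1) zero_less_power [of "2::nat" "20 * m"] unfolding N20_def by linarith
  have le: "N2 \<le> N20" "N4 \<le> N20" "N8 \<le> N20" "N12 \<le> N20"
    unfolding N2_def N4_def N8_def N12_def N20_def by (intro power_increasing; simp)+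
  have "N * N8 = 2 ^ (9 * m)" unfolding N_def N8_def by (simp add: power_add [symmetric])
  also have "\<dots> \<le> N20" unfolding N20_def by (intro power_increasing) auto
  finally have le9: "N * N8 \<le> N20" .
  have lt: "N2 < 2 ^ w" "N4 < 2 ^ w" "N8 < 2 ^ w" "N12 < 2 ^ w" "N20 < 2 ^ w" "N * N8 < 2 ^ w" "N * N8 + N20 < 2 ^ w"
    using le le9 big by linarith+
  have three: "3 * n < 2 ^ w" "3 mod 2 ^ w = (3::nat)" using mem small_powers by auto
  have s: "fst s 0 = n" "fst s 5 = N" using assms by (simp_all add: sized_def N_def)
  have sem: "sem w units_prog s = ((fst s)(6 := N2, 8 := N4, 6 := N8, 8 := N12, 7 := N20, 9 := 3 * n, 11 := N * N8 + N20, 13 := 0), snd s)"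
    unfolding units_prog_def using s mult lt three by simp
  show "prepared (sem w units_prog s) \<and> fst (sem w units_prog s) 13 = 0"
    unfolding sem prepared_def using assms
    by (simp add: sized_def env_def N_def N8_def N12_def N20_def scl_def)
qed (simp_all add: units_prog_def)

lemma max_runs:
  assumes "prepared s" "fst s 13 = 0"
  shows "runs w (For 22 10 max_body) s (2 * n * 17 + 6) (\<lambda>s'. prepared s' \<and> fst s' 13 = wm)"
proof -
  define I where "I = (\<lambda>j s'. prepared s' \<and> fst s' 13 = Max (insert 0 (memory ` {..<j})))"
  have "runs w (For 22 10 max_body) s (2 * n * (9 + 8) + 6) (I (2 * n))"
  proof (rule runs_For)
    show "I 0 s" using assms by (simp add: I_def)
    show "I j ((fst s')(22 := v), snd s')" if "I j s'" for j s' v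
      using that by (simp add: I_def prepared_def sized_def env_def)
    show "fst s' 10 = 2 * n" if "I j s'" for j s' using that by (simp add: I_def prepared_def sized_def)
    show "2 * n < 2 ^ w" using mem small_powers by linarith
    fix j s' assume "j < 2 * n" and I: "I j s'" and x: "fst s' 22 = j"
    have mx: "Max (insert 0 (memory ` {..<Suc j})) = max (memory j) (Max (insert 0 (memory ` {..<j})))"
      by (simp add: lessThan_Suc insert_commute [of 0])
    have "snd s' = memory" using I by (simp add: I_def prepared_def sized_def)
    then have sem: "fst (sem w max_body s') 13 = max (memory j) (fst s' 13)" "snd (sem w max_body s') = snd s'"
      "\<And>r. r \<noteq> 13 \<Longrightarrow> r \<noteq> 23 \<Longrightarrow> fst (sem w max_body s') r = fst s' r"
      using x by (simp_all add: max_body_def max_def)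
    have "prepared (sem w max_body s')"
      using I by (simp add: I_def prepared_def sized_def env_def sem)
    then have post: "I (Suc j) (sem w max_body s') \<and> fst (sem w max_body s') 22 = j"
      using I x unfolding I_def mx by (simp add: sem)
    show "runs w max_body s' 9 (\<lambda>s'. I (Suc j) s' \<and> fst s' 22 = j)"
    proof (rule runs_straight)
      show "straight max_body" "cost max_body \<le> 9" by (simp_all add: max_body_def)
    qed (rule post)
  qed auto
  then show ?thesis by (rule runs_mono) (simp_all add: I_def wm_def)
qed

definition initialized :: "state \<Rightarrow> bool" where
  "initialized s \<longleftrightarrow> prepared s \<and> fst s 13 = wm \<and>
    fst s 14 = enc w (fst (root_approx m)) \<and> fst s 15 = enc w (snd (root_approx m))"

lemma init_root_runs:
  assumes "prepared s" "fst s 13 = wm"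
  shows "runs w root_prog s (m * (m * 160 + 60) + 200) initialized"
proof (rule runs_mono [OF root_runs])
  show "fst s 5 = 2 ^ m" "fst s 6 = scl m" using assms by (simp_all add: prepared_def env_def)
  show "initialized s'" if "agree 14 (fst s) s' \<and> snd s' = snd s \<and>
      fst s' 14 = enc w (fst (root_approx m)) \<and> fst s' 15 = enc w (snd (root_approx m))" for s'
    using that assms by (simp add: initialized_def prepared_def sized_def env_def agree_def)
qed simp

definition loop_inv :: "nat \<Rightarrow> state \<Rightarrow> bool" where
  "loop_inv l s \<longleftrightarrow> ready l wm s \<and> holds (snd s) 4 (tw m) (2 ^ m) \<and> input (snd s) \<and>
    results (snd s) (\<lambda>k. \<Union>l'<l. cand l' k)"

lemma init_twiddle_runs:
  assumes "initialized s"
  shows "runs w (Seq twiddle_prog (Assign 20 (Const 1))) s ((2 ^ m * 58 + 10) + 2) (loop_inv 0)"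
proof (rule runs_Seq [OF twiddle_runs [where E = "fst s" and k = 20]])
  fix s' assume s': "agree 20 (fst s) s' \<and> frame {4, 5} (snd s') (snd s) \<and> holds (snd s') 4 (tw m) (2 ^ m)"
  have one: "1 mod 2 ^ w = (1::nat)" using small_powers by auto
  have ag: "agree 20 (fst s) s'" and fr: "frame {4, 5} (snd s') memory"
    using s' assms by (auto simp: initialized_def prepared_def sized_def)
  have "ready 0 wm ((fst s')(20 := 1), snd s')"
    using ag assms by (simp add: ready_def initialized_def prepared_def sized_def env_def agree_def)
  moreover have "input (snd s')" by (rule input_frame [OF fr memory_props(1)])
  moreover have "results (snd s') (\<lambda>k. \<Union>l'<0. cand l' k)"
    using results_frame [OF fr memory_props(2)] by simp
  ultimately have "loop_inv 0 (sem w (Assign 20 (Const 1)) s')"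
    using s' one by (simp add: loop_inv_def)
  then show "runs w (Assign 20 (Const 1)) s' 2 (loop_inv 0)"
    by (intro runs_straight) simp_all
qed (use assms in \<open>simp_all add: initialized_def prepared_def\<close>)

lemma scales_runs:
  assumes "loop_inv 0 s"
  shows "runs w (scales_prog better) s (K * (6 + scale_time) + 6) (loop_inv K)"
proof -
  let ?g = "Bin Less (Reg 20) (Bin Add (Reg 13) (Const 1))"
  have g: "wexp_val w ?g s' \<noteq> 0 \<longleftrightarrow> 2 ^ l \<le> wm" if "ready l wm s'" for l s'
  proof -
    have "Suc wm < 2 ^ w" "0 < w" using wm_bounds(2) word_bounds(1) word m6 by auto
    then show ?thesis using that unfolding less_val by (simp add: ready_def less_Suc_eq_le)
  qed
  have "runs w (While ?g (scale_body better)) s (K * (1 + wexp_cost ?g + scale_time) + (1 + wexp_cost ?g)) (loop_inv K)"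
  proof (rule runs_While)
    show "wexp_val w ?g s' \<noteq> 0" if "l < K" "loop_inv l s'" for l s'
    proof -
      have "ready l wm s'" using that(2) by (simp only: loop_inv_def)
      then show ?thesis using wm_bounds(5) [OF that(1)] g by blast
    qed
    show "wexp_val w ?g s' = 0" if "loop_inv K s'" for s'
    proof -
      have "ready K wm s'" using that by (simp only: loop_inv_def)
      moreover have "\<not> 2 ^ K \<le> wm" using wm_bounds(4) by simp
      ultimately show ?thesis using g by blast
    qed
    fix l s' assume l: "l < K" and I: "loop_inv l s'"
    define V where "V = (\<lambda>k. \<Union>l'<l. cand l' k)"
    have r: "ready l wm s'" "holds (snd s') 4 (tw m) (2 ^ m)" "input (snd s')" "results (snd s') V"
      using I by (simp_all add: loop_inv_def V_def)
    have V: "finite (V k)" "0 \<notin> V k" for k using finite_cand cand_pos by (auto simp: V_def)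
    have Suc: "V k \<union> cand l k = (\<Union>l'<Suc l. cand l' k)" for k
      by (auto simp: V_def less_Suc_eq)
    show "runs w (scale_body better) s' scale_time (loop_inv (Suc l))"
    proof (rule runs_mono [OF scale_runs [OF r(1) wm_bounds(5) [OF l] wm_bounds(2) r(2-4) V]])
      fix s'' assume *: "agree 20 (fst s') s'' \<and> fst s'' 20 = 2 ^ Suc l \<and> holds (snd s'') 4 (tw m) (2 ^ m) \<and>
        input (snd s'') \<and> results (snd s'') (\<lambda>k. V k \<union> cand l k)"
      then have "ready (Suc l) wm s''" using r(1) by (simp add: ready_def env_def agree_def)
      then show "loop_inv (Suc l) s''" using * by (simp only: loop_inv_def Suc)
    qed simp
  qed (rule assms)
  then show ?thesis unfolding scales_prog_def by (rule runs_mono) (simp_all add: algebra_simps)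
qed

text \<open>Results are read from cells from \<open>2 * n\<close> on and written below
  \<open>n\<close>, so overwriting the input does no harm.\<close>

lemma out_runs:
  assumes "loop_inv K s"
  shows "runs w (For 22 0 out_body) s (n * 14 + 6) (\<lambda>s'. \<forall>k<n. snd s' k = opt (\<Union>l<K. cand l k))"
proof -
  define I where "I = (\<lambda>i s'. agree 22 (fst s) s' \<and> (\<forall>a\<ge>n. snd s' a = snd s a) \<and>
    (\<forall>k<i. snd s' k = opt (\<Union>l<K. cand l k)))"
  have reg: "fst s 0 = n" "fst s 10 = 2 * n" using assms by (simp_all add: loop_inv_def ready_def)
  have res: "snd s (2 * n + k) = opt (\<Union>l<K. cand l k)" if "k < n" for k
    using assms that by (simp add: loop_inv_def results_def)
  have "runs w (For 22 0 out_body) s (n * (6 + 8) + 6) (I n)"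
  proof (rule runs_For)
    show "I 0 s" by (simp add: I_def)
    show "I j ((fst s')(22 := v), snd s')" if "I j s'" for j s' v using that by (simp add: I_def)
    show "fst s' 0 = n" if "I j s'" for j s' using that reg by (simp add: I_def agree_def)
    show "n < 2 ^ w" using mem small_powers by linarith
    fix i s' assume i: "i < n" and I: "I i s'" and x: "fst s' 22 = i"
    have "fst s' 10 = 2 * n" using I reg by (simp add: I_def agree_def)
    moreover have "2 * n + i < 2 ^ w" using mem small_powers i by linarith
    moreover have "snd s' (2 * n + i) = opt (\<Union>l<K. cand l i)" using I res [OF i] by (simp add: I_def)
    ultimately have "sem w out_body s' = (fst s', (snd s')(i := opt (\<Union>l<K. cand l i)))"
      using x by (simp add: out_body_def)
    then have post: "I (Suc i) (sem w out_body s') \<and> fst (sem w out_body s') 22 = i"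
      using I x i by (auto simp: I_def less_Suc_eq)
    show "runs w out_body s' 6 (\<lambda>s'. I (Suc i) s' \<and> fst s' 22 = i)"
    proof (rule runs_straight)
      show "straight out_body" "cost out_body \<le> 6" by (simp_all add: out_body_def)
    qed (rule post)
  qed auto
  then show ?thesis by (rule runs_mono) (simp_all add: I_def)
qed

definition conv_time :: nat where
  "conv_time = 30 + ((m * 10 + 6) + (50 + ((2 * n * 17 + 6) + ((m * (m * 160 + 60) + 200) +
    (((2 ^ m * 58 + 10) + 2) + ((K * (6 + scale_time) + 6) + (n * 14 + 6)))))))"

lemma conv_runs:
  "runs w (conv_prog better) (input_state n p q A B) conv_time (\<lambda>s. \<forall>k<n. snd s k = opt (\<Union>l<K. cand l k))"
proof -
  let ?Q = "\<lambda>s. \<forall>k<n. snd s k = opt (\<Union>l<K. cand l k)"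
  let ?c1 = "Seq (scales_prog better) (For 22 0 out_body)"
  let ?c2 = "Seq (Seq twiddle_prog (Assign 20 (Const 1))) ?c1"
  let ?t1 = "(K * (6 + scale_time) + 6) + (n * 14 + 6)"
  let ?t2 = "((2 ^ m * 58 + 10) + 2) + ?t1"
  let ?t3 = "(m * (m * 160 + 60) + 200) + ?t2"
  let ?t4 = "(2 * n * 17 + 6) + ?t3"
  have 1: "runs w ?c1 s ?t1 ?Q" if "loop_inv 0 s" for s
    by (rule runs_Seq [OF scales_runs [OF that] out_runs])
  have 2: "runs w ?c2 s ?t2 ?Q" if "initialized s" for s
    by (rule runs_Seq [OF init_twiddle_runs [OF that] 1])
  have 3: "runs w (Seq root_prog ?c2) s ?t3 ?Q" if "prepared s \<and> fst s 13 = wm" for s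
    using that by (intro runs_Seq [OF init_root_runs 2]) auto
  have 4: "runs w (Seq (For 22 10 max_body) (Seq root_prog ?c2)) s ?t4 ?Q" if "prepared s \<and> fst s 13 = 0" for s
    using that by (intro runs_Seq [OF max_runs 3]) auto
  have 5: "runs w (Seq units_prog (Seq (For 22 10 max_body) (Seq root_prog ?c2))) s (50 + ?t4) ?Q"
    if "sized s \<and> fst s 5 = 2 ^ m" for s
    using that by (intro runs_Seq [OF units_runs 4]) auto
  have 6: "runs w (Seq length_prog (Seq units_prog (Seq (For 22 10 max_body) (Seq root_prog ?c2)))) s
      ((m * 10 + 6) + (50 + ?t4)) ?Q" if "sized s \<and> fst s 5 = 1" for s
    using that by (intro runs_Seq [OF length_runs 5]) auto
  show ?thesis
    unfolding conv_prog_def conv_time_def by (rule runs_Seq [OF sizes_runs 6])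
qed

text \<open>Everything is compared with \<open>P = m * 2 ^ m\<close>. The two transforms account for
  \<open>462 * P\<close> of a scale; terms linear in \<open>2 ^ m\<close> are absorbed through
  \<open>6 * 2 ^ m \<le> P\<close>, constants through \<open>384 \<le> P\<close>, and the quadratic
  cost of the root through \<open>m * m \<le> P\<close>.\<close>

lemma conv_time_bound: "conv_time \<le> 2000 * (m * 2 ^ m * K)"
proof -
  define P where "P = m * 2 ^ m"
  have m: "6 \<le> m" by (rule m_ge)
  have mN: "m \<le> 2 ^ m" using less_exp [of m] by simp
  have P: "6 * 2 ^ m \<le> P" unfolding P_def using m by (rule mult_le_mono1)
  have mm: "m * m \<le> P" unfolding P_def using mN by (rule mult_le_mono2)
  have "D \<le> n * D" "n \<le> n * D" using D_ge by auto
  then have nN: "n \<le> 2 ^ m" "n * D \<le> 2 ^ m" using m_upper by linarith+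
  have "64 \<le> (2::nat) ^ m" by (rule small_powers)
  then have "384 \<le> P" using P by linarith
  have e: "m * (2 ^ m * 231 + 20) = 231 * P + 20 * m" by (simp add: P_def algebra_simps)
  have st: "scale_time \<le> 700 * P"
    unfolding scale_time_def e using P nN mN \<open>384 \<le> P\<close> by linarith
  have "6 + scale_time \<le> 706 * P" using st \<open>384 \<le> P\<close> by linarith
  then have "K * (6 + scale_time) \<le> K * (706 * P)" by (rule mult_le_mono2)
  then have k: "K * (6 + scale_time) \<le> 706 * (P * K)" by (simp add: mult_ac)
  have "1 \<le> K" by (simp add: K_def)
  then have PK: "P \<le> P * K" by simp
  have r: "m * (m * 160 + 60) = 160 * (m * m) + 60 * m" by (simp add: algebra_simps)
  have "conv_time \<le> 2000 * (P * K)"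
    unfolding conv_time_def r using k PK P mm nN mN \<open>384 \<le> P\<close> by linarith
  then show ?thesis by (simp add: P_def)
qed

end

section \<open>From the machine run to approximate convolutions\<close>

text \<open>The assumption \<open>conv\<close> isolates the optimization: if every candidate is
  close to some pair and every pair to some candidate, then \<open>opt\<close> of the candidates is
  close to the optimum over pairs. \<open>better\<close> is specified for \<open>0 < w\<close>,
  since without any bits a sum of truth values would be reduced to 0.\<close>

lemma approx_conv_computable:
  fixes opt :: "nat set \<Rightarrow> nat" and conv :: "(nat \<Rightarrow> nat) \<Rightarrow> (nat \<Rightarrow> nat) \<Rightarrow> nat \<Rightarrow> nat"
  assumes opt: "opt {} = 0"
      "\<And>V v. finite V \<Longrightarrow> 0 \<notin> V \<Longrightarrow> 0 < v \<Longrightarrow> opt (insert v V) = (if improves (opt V) v then v else opt V)"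
    and better: "\<And>w s. 0 < w \<Longrightarrow> wexp_val w better s \<noteq> 0 \<longleftrightarrow> improves (fst s 27) (fst s 28)"
      "wexp_cost better \<le> 7"
    and conv: "\<And>A B k V \<epsilon>. finite V \<Longrightarrow> 0 < \<epsilon> \<Longrightarrow>
      (\<And>v. v \<in> V \<Longrightarrow> \<exists>i\<le>k. A i + B (k - i) \<le> v \<and> real v \<le> (1 + \<epsilon>) * real (A i + B (k - i))) \<Longrightarrow>
      (\<And>i. i \<le> k \<Longrightarrow> \<exists>v\<in>V. A i + B (k - i) \<le> v \<and> real v \<le> (1 + \<epsilon>) * real (A i + B (k - i))) \<Longrightarrow>
      conv A B k \<le> opt V \<and> real (opt V) \<le> (1 + \<epsilon>) * real (conv A B k)"
  shows "approx_conv_computable_in_time conv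
    (\<lambda>n W \<epsilon>. real n / \<epsilon> * log 2 (max 2 (real n / \<epsilon>)) * log 2 (max 2 (real W)))"
  unfolding approx_conv_computable_in_time_def
proof (rule exI [of _ "conv_prog better"], rule exI [of _ 140], rule exI [of _ 12000000], intro allI impI)
  fix n W :: nat and A B :: "nat \<Rightarrow> nat" and \<epsilon> :: real and p q w :: nat
  assume n: "1 \<le> n" and \<epsilon>: "0 < \<epsilon>" "\<epsilon> < 1"
    and AB: "bounded_positive_seq n W A" "bounded_positive_seq n W B"
    and enc: "encodes_accuracy p q \<epsilon>" and w: "140 * log 2 (real (n + W + q)) \<le> real w"
  have pq: "0 < p" "0 < q" "real p / real q \<le> \<epsilon>" "\<epsilon> \<le> 2 * (real p / real q)"
    using enc by (auto simp: encodes_accuracy_def)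
  have "real p / real q < 1" using pq(3) \<epsilon> by simp
  then have "p < q" using pq by simp
  have size: "(n + W + q) ^ 140 \<le> 2 ^ w"
  proof -
    define S where "S = n + W + q"
    have pos: "0 < real S" using n by (simp add: S_def)
    have log: "2 powr log 2 (real S) = real S" using pos by simp
    have "real (S ^ 140) = real S ^ 140" by (rule of_nat_power)
    also have "\<dots> = real S powr real 140" using pos by (rule powr_realpow [symmetric])
    also have "\<dots> = (2 powr log 2 (real S)) powr real 140" by (simp only: log)
    also have "\<dots> = 2 powr (log 2 (real S) * real 140)" by (rule powr_powr)
    also have "\<dots> \<le> 2 powr real w" using w by (intro powr_mono) (auto simp: S_def mult.commute)
    also have "\<dots> = real (2 ^ w)" by (simp add: powr_realpow)
    finally show ?thesis unfolding S_def by (simp only: of_nat_le_iff)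
  qed
  have "2 \<le> n + W + q" using n pq by linarith
  also have "\<dots> \<le> (n + W + q) ^ 140" using n by (intro self_le_power) auto
  also note size
  finally have "0 < w" by (cases w) auto
  note better_w = better(1) [OF \<open>0 < w\<close>]
  interpret conv_opt n p q W w A B opt better improves
    by unfold_locales (fact n pq(1) \<open>p < q\<close> AB size opt better_w better(2))+
  obtain t s where exec: "exec w (conv_prog better) (input_state n p q A B) t s" "t \<le> conv_time"
    and res: "\<And>k. k < n \<Longrightarrow> snd s k = opt (\<Union>l<K. cand l k)"
    using conv_runs unfolding runs_def by blast
  have "is_approximation \<epsilon> n (conv A B) (\<lambda>k. real (snd s k))"
    unfolding is_approximation_def
  proof (intro allI impI)
    fix k assume k: "k < n"
    have "conv A B k \<le> opt (\<Union>l<K. cand l k) \<and> real (opt (\<Union>l<K. cand l k)) \<le> (1 + \<epsilon>) * real (conv A B k)"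
    proof (rule conv)
      show "\<exists>i\<le>k. A i + B (k - i) \<le> v \<and> real v \<le> (1 + \<epsilon>) * real (A i + B (k - i))"
        if "v \<in> (\<Union>l<K. cand l k)" for v
        using that cand_sound [OF pq(3)] by blast
      show "\<exists>v\<in>\<Union>l<K. cand l k. A i + B (k - i) \<le> v \<and> real v \<le> (1 + \<epsilon>) * real (A i + B (k - i))"
        if "i \<le> k" for i
        using cand_complete [OF pq(3) k that wm_bounds(1,4)] by blast
    qed (use finite_cand \<epsilon> in auto)
    then show "real (conv A B k) \<le> real (snd s k) \<and> real (snd s k) \<le> (1 + \<epsilon>) * real (conv A B k)"
      using res [OF k] by simp
  qed
  moreover have "real t \<le> 12000000 * (real n / \<epsilon> * log 2 (max 2 (real n / \<epsilon>)) * log 2 (max 2 (real W)))"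
  proof -
    define X where "X = real n / \<epsilon>"
    define lX where "lX = log 2 (max 2 X)"
    define lW where "lW = log 2 (max 2 (real W))"
    have "X > 0" using n \<epsilon> by (simp add: X_def)
    have l1: "1 \<le> lX" "1 \<le> lW" by (simp_all add: lX_def lW_def)
    have N: "real (2 ^ m) \<le> 296 * X"
    proof -
      have "real (p * L) \<le> real (12 * q)" using L_bounds(3) by (simp only: of_nat_le_iff)
      then have "real L \<le> 12 * (real q / real p)" using pq by (simp add: field_simps)
      \<comment> \<open>The upper half of the encoding, \<open>\<epsilon> \<le> 2 * (p / q)\<close>,
        enters here and keeps the transform length of order \<open>n / \<epsilon>\<close>; the lower
        half serves the accuracy.\<close>
      also have "real q / real p \<le> 2 / \<epsilon>" using pq \<epsilon> by (simp add: field_simps)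
      finally have "real L \<le> 24 / \<epsilon>" by simp
      moreover have "1 \<le> 1 / \<epsilon>" using \<epsilon> by (simp add: field_simps)
      ultimately have "real D \<le> 49 * (1 / \<epsilon>)" by (simp add: D_def)
      then have D: "real n * real D \<le> real n * (49 * (1 / \<epsilon>))" by (intro mult_left_mono) auto
      have "real (2 ^ m) \<le> real (4 * (n * D))" using m_lower by (simp only: of_nat_le_iff)
      also have "\<dots> \<le> 196 * X" using D by (simp add: X_def)
      finally show ?thesis using \<open>X > 0\<close> by simp
    qed
    have m: "real m \<le> 10 * lX"
    proof -
      have "real m = log 2 (real (2 ^ m))" by (simp add: log_nat_power)
      \<comment> \<open>\<open>296 \<le> 512 = 2 ^ 9\<close> yields \<open>m \<le> 9 + lX\<close>,
        and \<open>lX \<ge> 1\<close> turns this into \<open>10 * lX\<close>.\<close>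
      also have "\<dots> \<le> log 2 (512 * max 2 X)" using N \<open>X > 0\<close> by (intro log_mono) auto
      also have "\<dots> = log 2 (2 ^ 9) + lX" unfolding lX_def by (subst log_mult) auto
      also have "log 2 (2 ^ 9) = (9::real)" by (subst log_nat_power) auto
      finally show ?thesis using l1 by simp
    qed
    have K: "real K \<le> 2 * lW"
    proof -
      have "2 ^ (K - 1) \<le> wm" by (rule wm_bounds(5)) (simp add: K_def)
      then have "real (2 ^ (K - 1)) \<le> real W" using wm_bounds(2) by (simp only: of_nat_le_iff)
      then have "real (2 ^ (K - 1)) \<le> max 2 (real W)" by (rule max.coboundedI2)
      then have "log 2 (real (2 ^ (K - 1))) \<le> lW" unfolding lW_def by (intro log_mono) simp_all
      then have "real (K - 1) \<le> lW" by (simp add: log_nat_power)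
      then show ?thesis using l1 by (simp add: K_def)
    qed
    have "real t \<le> real (2000 * (m * 2 ^ m * K))"
      using exec(2) conv_time_bound by (simp only: of_nat_le_iff)
    also have "\<dots> = 2000 * (real m * real (2 ^ m) * real K)" by simp
    also have "real m * real (2 ^ m) * real K \<le> (10 * lX) * (296 * X) * (2 * lW)"
      using m N K l1 \<open>X > 0\<close> by (intro mult_mono) auto
    also have "2000 * ((10 * lX) * (296 * X) * (2 * lW)) = 11840000 * (X * lX * lW)" by simp
    also have "\<dots> \<le> 12000000 * (X * lX * lW)"
      using l1 \<open>X > 0\<close> by (intro mult_right_mono) auto
    finally show ?thesis by (simp add: X_def lX_def lW_def)
  qed
  ultimately show "\<exists>t s. exec w (conv_prog better) (input_state n p q A B) t s \<and>
      real t \<le> 12000000 * (real n / \<epsilon> * log 2 (max 2 (real n / \<epsilon>)) * log 2 (max 2 (real W))) \<and>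
      is_approximation \<epsilon> n (conv A B) (\<lambda>k. real (snd s k))"
    using exec(1) by blast
qed

theorem mainTheorem10:
  "approx_conv_computable_in_time min_plus_conv
     (\<lambda>n W \<epsilon>. real n / \<epsilon> * log 2 (max 2 (real n / \<epsilon>)) * log 2 (max 2 (real W))) \<and>
   approx_conv_computable_in_time max_plus_conv
     (\<lambda>n W \<epsilon>. real n / \<epsilon> * log 2 (max 2 (real n / \<epsilon>)) * log 2 (max 2 (real W)))"
proof
  \<comment> \<open>0 marks an empty cell. A plain comparison would never replace it, as 0 is below
    every candidate; hence the disjunct \<open>r = 0\<close> in \<open>improves\<close>.\<close>
  let ?min = "\<lambda>V :: nat set. if V = {} then 0 else Min V"
  show "approx_conv_computable_in_time min_plus_conv
     (\<lambda>n W \<epsilon>. real n / \<epsilon> * log 2 (max 2 (real n / \<epsilon>)) * log 2 (max 2 (real W)))"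
  proof (rule approx_conv_computable [where opt = ?min and improves = "\<lambda>r v. r = 0 \<or> v < r"
        and better = "Bin Add (Bin Equal (Reg 27) (Const 0)) (Bin Less (Reg 28) (Reg 27))"])
    show "?min (insert v V) = (if ?min V = 0 \<or> v < ?min V then v else ?min V)"
      if "finite V" "0 \<notin> V" "0 < v" for V v
    proof (cases "V = {}")
      case False
      define mn where "mn = Min V"
      have "mn \<in> V" unfolding mn_def using that False by simp
      then have "mn \<noteq> 0" using that(2) by metis
      moreover have "Min (insert v V) = min v mn" unfolding mn_def using that False by simp
      ultimately show ?thesis using False by (simp add: mn_def [symmetric] min_def)
    qed simp
    show "min_plus_conv A B k \<le> ?min V \<and> real (?min V) \<le> (1 + \<epsilon>) * real (min_plus_conv A B k)"
      if V: "finite V" and \<epsilon>: "0 < \<epsilon>"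
        and sound: "\<And>v. v \<in> V \<Longrightarrow> \<exists>i\<le>k. A i + B (k - i) \<le> v \<and> real v \<le> (1 + \<epsilon>) * real (A i + B (k - i))"
        and complete: "\<And>i. i \<le> k \<Longrightarrow> \<exists>v\<in>V. A i + B (k - i) \<le> v \<and> real v \<le> (1 + \<epsilon>) * real (A i + B (k - i))"
      for A B k V \<epsilon>
    proof -
      let ?P = "(\<lambda>i. A i + B (k - i)) ` {0..k}"
      have "V \<noteq> {}" using complete [of 0] by auto
      have "Min ?P \<in> ?P" by (rule Min_in) auto
      then obtain i where e: "Min ?P = A i + B (k - i)" and "i \<in> {0..k}" by (rule imageE)
      then have i: "i \<le> k" by simp
      obtain v where v: "v \<in> V" "real v \<le> (1 + \<epsilon>) * real (A i + B (k - i))" using complete [OF i] by blast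
      have "Min V \<le> v" using V v(1) by simp
      then have "real (Min V) \<le> (1 + \<epsilon>) * real (Min ?P)" unfolding e using v(2) by linarith
      moreover have "Min V \<in> V" using V \<open>V \<noteq> {}\<close> by simp
      then obtain j where j: "j \<le> k" "A j + B (k - j) \<le> Min V" using sound by blast
      have "Min ?P \<le> A j + B (k - j)" using j(1) by (intro Min_le) auto
      ultimately show ?thesis using j(2) \<open>V \<noteq> {}\<close> by (simp add: min_plus_conv_def)
    qed
  qed auto
  \<comment> \<open>For the maximum 0 is a neutral start value, and plain comparison
    suffices.\<close>
  let ?max = "\<lambda>V :: nat set. Max (insert 0 V)"
  show "approx_conv_computable_in_time max_plus_conv
     (\<lambda>n W \<epsilon>. real n / \<epsilon> * log 2 (max 2 (real n / \<epsilon>)) * log 2 (max 2 (real W)))"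
  proof (rule approx_conv_computable [where opt = ?max and improves = "(<)" and better = "Bin Less (Reg 27) (Reg 28)"])
    show "?max (insert v V) = (if ?max V < v then v else ?max V)"
      if "finite V" "0 \<notin> V" "0 < v" for V v
    proof -
      define mx where "mx = ?max V"
      have "?max (insert v V) = max v mx"
        unfolding mx_def insert_commute [of 0] using that by (intro Max_insert) auto
      then show ?thesis unfolding mx_def [symmetric] by (simp add: max_def)
    qed
    show "max_plus_conv A B k \<le> ?max V \<and> real (?max V) \<le> (1 + \<epsilon>) * real (max_plus_conv A B k)"
      if V: "finite V" and \<epsilon>: "0 < \<epsilon>"
        and sound: "\<And>v. v \<in> V \<Longrightarrow> \<exists>i\<le>k. A i + B (k - i) \<le> v \<and> real v \<le> (1 + \<epsilon>) * real (A i + B (k - i))"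
        and complete: "\<And>i. i \<le> k \<Longrightarrow> \<exists>v\<in>V. A i + B (k - i) \<le> v \<and> real v \<le> (1 + \<epsilon>) * real (A i + B (k - i))"
      for A B k V \<epsilon>
    proof -
      let ?P = "(\<lambda>i. A i + B (k - i)) ` {0..k}"
      have "Max ?P \<in> ?P" by (rule Max_in) auto
      then obtain i where e: "Max ?P = A i + B (k - i)" and "i \<in> {0..k}" by (rule imageE)
      then have i: "i \<le> k" by simp
      obtain v where v: "v \<in> V" "Max ?P \<le> v" unfolding e using complete [OF i] by blast
      then have "Max ?P \<le> ?max V" using V by (intro order_trans [OF v(2)] Max_ge) auto
      moreover have "real (?max V) \<le> (1 + \<epsilon>) * real (Max ?P)"
      proof (cases "?max V = 0")
        case True
        then show ?thesis using \<epsilon> by simp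
      next
        case False
        have "?max V \<in> insert 0 V" using V by (intro Max_in) auto
        then have "?max V \<in> V" using False by auto
        then obtain j where j: "j \<le> k" "real (?max V) \<le> (1 + \<epsilon>) * real (A j + B (k - j))" using sound by blast
        have "A j + B (k - j) \<le> Max ?P" using j(1) by (intro Max_ge) auto
        then have "(1 + \<epsilon>) * real (A j + B (k - j)) \<le> (1 + \<epsilon>) * real (Max ?P)"
          using \<epsilon> by (intro mult_left_mono) auto
        then show ?thesis using j(2) by linarith
      qed
      ultimately show ?thesis by (simp add: max_plus_conv_def)
    qed
  qed auto
qed

end
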